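(* Let $p\in\mathbb{C}[T]$ satisfy $p(\boldsymbol{1})=1$ and $f=1-\sum_{\sigma\in G}p^{\sigma*}p^{\sigma}\ge0$ on $\mathbb{T}^d$. If the Hessian of $f$ is positive definite at every zero of $f$ in $\mathbb{T}^d$, then there exist $N\in\mathbb{N}$ and polynomials $q_1,\dots,q_N\in\mathbb{C}[T]$ satisfying $$\delta_{\sigma,\tau}-p^{\sigma*}p^{\tau}=\sum_{j=1}^N q_j^{\sigma*}q_j^{\tau}\qquad\text{for all }\sigma,\tau\in G.$$
   Context: Let $d\in\mathbb{N}$ and $\mathbb{C}[T]=\mathbb{C}[z_1^{\pm1},\dots,z_d^{\pm1}]$ be the ring of complex Laurent polynomials, with the involution $*$ given by $z_j^*=z_j^{-1}$ and complex conjugation on coefficients. Laurent polynomials are identified with trigonometric polynomials via $z=\boldsymbol{e}^{-i\omega}=(e^{-i\omega_1},\dots,e^{-i\omega_d})$, $\omega\in\mathbb{R}^d$; $\boldsymbol{1}=(1,\dots,1)$; $\mathbb{T}^d=\{z\in\mathbb{C}^d:|z_1|=\dots=|z_d|=1\}$. Let $M\in\mathbb{Z}^{d\times d}$ be expansive (all eigenvalues have modulus strictly larger than $1$), $m=|\det M|$, and $G=2\pi M^{-T}\mathbb{Z}^d/2\pi\mathbb{Z}^d$, a finite abelian group of order $m$. For $p\in\mathbb{C}[T]$ and $\sigma\in G$, $p^\sigma\in\mathbb{C}[T]$ is defined by $p^\sigma(\boldsymbol{e}^{-i\omega})=p(\boldsymbol{e}^{-i(\omega+\sigma)})$, and $p^{\sigma*}=(p^\sigma)^*$.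 The polynomial $f$ is real-valued on $\mathbb{T}^d$; its Hessian is the $d\times d$ matrix of second-order partial derivatives of $\omega\mapsto f(\boldsymbol{e}^{-i\omega})$ with respect to $\omega\in\mathbb{R}^d$. $\delta_{\sigma,\tau}$ is the Kronecker delta. *)

theory Defs
  imports "HOL-Analysis.Analysis" "HOL-Library.Poly_Mapping"
begin

text \<open>
  The complex Laurent polynomials in $d$ variables are the group algebra of the exponent group
  of integer vectors of length $d$. Ring operations are those of \<^theory>\<open>HOL-Library.Poly_Mapping\<close>,
  so that multiplication is convolution of coefficients.
\<close>

type_synonym 'd laurent = "(int ^ 'd) \<Rightarrow>\<^sub>0 complex"

definition laurent_monom :: "int ^ 'd \<Rightarrow> complex ^ 'd \<Rightarrow> complex" where
  "laurent_monom k z = (\<Prod>i\<in>UNIV. (z $ i) powi (k $ i))"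

definition laurent_eval :: "'d::finite laurent \<Rightarrow> complex ^ 'd \<Rightarrow> complex" where
  "laurent_eval p z = (\<Sum>k\<in>Poly_Mapping.keys p. Poly_Mapping.lookup p k * laurent_monom k z)"

definition laurent_star :: "'d::finite laurent \<Rightarrow> 'd laurent" where
  "laurent_star p = Poly_Mapping.map_key uminus (Poly_Mapping.map cnj p)"

definition torus :: "(complex ^ 'd) set" where
  "torus = {z. \<forall>i. norm (z $ i) = 1}"

definition torus_exp :: "real ^ 'd \<Rightarrow> complex ^ 'd" where
  "torus_exp \<omega> = (\<chi> i. exp (- \<i> * complex_of_real (\<omega> $ i)))"

text \<open>
  Replacing \<open>\<omega>\<close> by \<open>\<omega> + \<sigma>\<close> multiplies the coefficient of the monomial with exponent \<open>k\<close> by the value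
  of that monomial at \<open>torus_exp \<sigma>\<close>; the defining identity is \<open>laurent_eval_shift\<close> below.
\<close>

definition laurent_shift :: "'d::finite laurent \<Rightarrow> real ^ 'd \<Rightarrow> 'd laurent" where
  "laurent_shift p \<sigma> = Poly_Mapping.mapp (\<lambda>k c. c * laurent_monom k (torus_exp \<sigma>)) p"

definition expansive :: "int ^ 'd ^ 'd \<Rightarrow> bool" where
  "expansive M \<longleftrightarrow>
    (\<forall>(\<mu>::complex) v. v \<noteq> 0 \<and> map_matrix of_int M *v v = \<mu> *s v \<longrightarrow> norm \<mu> > 1)"

definition period_lattice :: "(real ^ 'd) set" where
  "period_lattice = {(2 * pi) *\<^sub>R x | x. \<forall>i. x $ i \<in> \<int>}"

definition dual_lattice :: "int ^ 'd ^ 'd \<Rightarrow> (real ^ 'd) set" where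
  "dual_lattice M =
    {(2 * pi) *\<^sub>R (matrix_inv (transpose (map_matrix real_of_int M)) *v x) | x. \<forall>i. x $ i \<in> \<int>}"

text \<open>The elements of $G$ are cosets, so that sums over $G$ count each class once.\<close>

definition dual_group :: "int ^ 'd ^ 'd \<Rightarrow> (real ^ 'd) set set" where
  "dual_group M = dual_lattice M // {(x, y). x - y \<in> period_lattice}"

text \<open>
  For a coset \<open>S\<close> of the period lattice, the shifts by its representatives all agree
  (\<open>laurent_shift_coset_eq\<close> below), and \<open>laurent_shift_coset p S\<close> is their common value.
\<close>

definition laurent_shift_coset :: "'d::finite laurent \<Rightarrow> (real ^ 'd) set \<Rightarrow> 'd laurent" where
  "laurent_shift_coset p S = the_elem (laurent_shift p ` S)"

definition partial_deriv :: "'d \<Rightarrow> (real ^ 'd::finite \<Rightarrow> real) \<Rightarrow> real ^ 'd \<Rightarrow> real" where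
  "partial_deriv i g x = deriv (\<lambda>t. g (x + t *\<^sub>R axis i 1)) 0"

definition hessian :: "(real ^ 'd::finite \<Rightarrow> real) \<Rightarrow> real ^ 'd \<Rightarrow> real ^ 'd ^ 'd" where
  "hessian g x = (\<chi> i j. partial_deriv i (partial_deriv j g) x)"

text \<open>
  Used only for Hessians of smooth functions, whose symmetry is automatic and is therefore
  not part of the definition.
\<close>

definition positive_definite :: "real ^ 'd ^ 'd \<Rightarrow> bool" where
  "positive_definite A \<longleftrightarrow> (\<forall>v. v \<noteq> 0 \<longrightarrow> v \<bullet> (A *v v) > 0)"


lemma lookup_laurent_star:
  "Poly_Mapping.lookup (laurent_star p) k = cnj (Poly_Mapping.lookup p (- k))"
  unfolding laurent_star_def
  by (simp add: Poly_Mapping.map_key.rep_eq Poly_Mapping.map.rep_eq when_def)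

lemma torus_exp_nz [simp]: "torus_exp \<omega> $ i \<noteq> 0"
  by (simp add: torus_exp_def)

lemma laurent_monom_torus_nz: "laurent_monom k (torus_exp \<omega>) \<noteq> 0"
  by (simp add: laurent_monom_def)

lemma laurent_monom_add:
  "laurent_monom k (torus_exp (\<omega> + \<sigma>)) = laurent_monom k (torus_exp \<omega>) * laurent_monom k (torus_exp \<sigma>)"
proof -
  have "torus_exp (\<omega> + \<sigma>) $ i = torus_exp \<omega> $ i * torus_exp \<sigma> $ i" for i
    by (simp add: torus_exp_def flip: exp_add) (simp add: algebra_simps)
  then show ?thesis
    by (simp add: laurent_monom_def power_int_mult_distrib prod.distrib)
qed

lemma laurent_eval_shift:
  "laurent_eval (laurent_shift p \<sigma>) (torus_exp \<omega>) = laurent_eval p (torus_exp (\<omega> + \<sigma>))"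
proof -
  have "Poly_Mapping.keys (laurent_shift p \<sigma>) = Poly_Mapping.keys p"
    by (auto simp: laurent_shift_def in_keys_iff lookup_mapp laurent_monom_torus_nz)
  then show ?thesis
    unfolding laurent_eval_def
    by (auto simp: laurent_shift_def lookup_mapp laurent_monom_add intro!: sum.cong)
qed

lemma laurent_eval_star:
  assumes "z \<in> torus"
  shows "laurent_eval (laurent_star p) z = cnj (laurent_eval p z)"
proof -
  have unit: "inverse (z $ i) = cnj (z $ i)" for i
  proof (rule inverse_unique)
    show "z $ i * cnj (z $ i) = 1"
      using assms by (simp add: torus_def flip: complex_norm_square)
  qed
  have m: "laurent_monom (- k) z = cnj (laurent_monom k z)" for k
    by (simp add: laurent_monom_def power_int_minus unit flip: power_int_inverse)
  have k: "Poly_Mapping.keys (laurent_star p) = uminus ` Poly_Mapping.keys p"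
  proof (intro set_eqI iffI)
    fix x assume "x \<in> Poly_Mapping.keys (laurent_star p)"
    then have "- x \<in> Poly_Mapping.keys p"
      by (simp add: in_keys_iff lookup_laurent_star)
    then show "x \<in> uminus ` Poly_Mapping.keys p"
      by (rule rev_image_eqI) simp
  qed (auto simp: in_keys_iff lookup_laurent_star)
  show ?thesis
    unfolding laurent_eval_def k
    by (simp add: sum.reindex lookup_laurent_star m)
qed

lemma laurent_shift_coset_eq:
  "laurent_shift_coset p ({(x, y). x - y \<in> period_lattice} `` {\<sigma>}) = laurent_shift p \<sigma>"
proof -
  have *: "torus_exp y = torus_exp \<sigma>" if y: "\<sigma> - y \<in> period_lattice" for y
  proof -
    have "torus_exp y $ i = torus_exp \<sigma> $ i" for i
    proof -
      from y obtain n where n: "\<sigma> $ i - y $ i = 2 * pi * of_int n"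
        unfolding period_lattice_def
        by (auto simp: vec_eq_iff) (metis Ints_cases)
      have "- \<i> * complex_of_real (y $ i) =
          - \<i> * complex_of_real (\<sigma> $ i) + (of_int (2 * n) * pi) * \<i>"
        using arg_cong[OF n, of complex_of_real] by (simp add: algebra_simps)
      then show ?thesis
        unfolding torus_exp_def by (simp only: vec_lambda_beta exp_eq) blast
    qed
    then show ?thesis by (simp add: vec_eq_iff)
  qed
  have "\<sigma> - \<sigma> \<in> period_lattice"
    by (auto simp: period_lattice_def intro!: exI[of _ 0])
  then have "laurent_shift p ` ({(x, y). x - y \<in> period_lattice} `` {\<sigma>}) = {laurent_shift p \<sigma>}"
    by (auto simp: laurent_shift_def dest!: * intro!: image_eqI[of _ _ \<sigma>])
  then show ?thesis by (simp add: laurent_shift_coset_def)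
qed

end

theory Submission
  imports Defs
begin


text \<open>
  With \<open>z = exp (-\<i> \<omega>)\<close> Laurent polynomials become trigonometric polynomials in \<open>\<omega>\<close>. The proof has two
  independent halves: a nonnegative \<open>f\<close> whose zeros have positive definite Hessians is a sum of
  hermitian squares, and a representation of \<open>f\<close> as such a sum yields the matrix identity.

  For the first half, a zero with positive definite Hessian is isolated, so \<open>f\<close> has only finitely many
  zeros on the torus. They lie on a finite grid, the product of sets \<open>Z i\<close> of possible \<open>i\<close>-th
  coordinates; let \<open>P i\<close> be the product of the factors \<open>z i - a\<close> with \<open>a\<close> in \<open>Z i\<close>. A trigonometric
  polynomial \<open>F\<close> that vanishes to second order on the grid lies in the square of the ideal generated by
  the \<open>P i\<close>, hence is a form \<open>\<Sum>i l. cnj (P i) * A i l * P l\<close>, and at a grid point the matrix \<open>A\<close> is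
  congruent to half the Hessian of \<open>F\<close> (lemma \<open>hermitian_form_on_grid\<close>). The polynomial \<open>f\<close> itself need
  not vanish on the whole grid. Take \<open>q\<close> equal to \<open>0\<close> at the zeros of \<open>f\<close> and to \<open>1\<close> at the other grid
  points, and let \<open>E\<close> be the fourth power of \<open>norm q\<close>. Then \<open>F = (f - E) * (1 - E)^2\<close> vanishes to
  second order on the grid, has the same Hessians as \<open>f\<close> at the zeros of \<open>f\<close>, and satisfies
  \<open>f = E * A0 + F\<close> with \<open>A0 = f * (2 - E) + (1 - E)^2\<close>. So \<open>f\<close> is the value of a matrix \<open>M\<close>, with
  blocks \<open>A0\<close> and \<open>A\<close>, on the vector \<open>v\<close> with entries \<open>q^2\<close> and \<open>P i\<close>. The entries of \<open>v\<close> vanish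
  simultaneously exactly at the zeros of \<open>f\<close>. There \<open>M\<close> is positive definite; at any other point it is
  positive in the direction of \<open>v\<close>, because \<open>f\<close> is positive. The Koszul matrix
  \<open>(norm v)^2 * I - v v*\<close> is positive semidefinite and kills precisely the multiples of \<open>v\<close> when \<open>v\<close>
  is nonzero, so adding a large multiple of it does not change the value \<open>f\<close> on \<open>v\<close> and, by
  compactness, makes the matrix positive definite at every point.

  Such a matrix gives a sum of squares (\<open>sos_positive_definite_form\<close>): averaging over a finite set of
  nodes \<open>y\<close> against the Fejer kernel writes it as a combination of constant positive definite matrices
  with coefficients proportional to \<open>(norm (D (\<omega> - y)))^2\<close>, where \<open>D\<close> is a Dirichlet kernel, and a constant positive
  definite matrix has a Cholesky decomposition.

  For the second half, put \<open>n = \<bar>det M\<bar>\<close>, which annihilates the group \<open>G\<close>. Hence the normalised characters \<open>a k\<close> with exponents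
  \<open>k\<close> in \<open>{0..<n}^d\<close> satisfy \<open>\<Sum>k. cnj (a k \<sigma>) * a k \<tau> = \<delta> \<sigma> \<tau>\<close>, where \<open>a k \<sigma>\<close> denotes the shift of
  \<open>a k\<close> by \<open>\<sigma>\<close>. With the \<open>G\<close>-invariant coefficients
  \<open>c k = \<Sum>\<rho>. a k \<rho> * cnj (p \<rho>)\<close> the polynomials \<open>a k - c k * p\<close> contribute
  \<open>\<delta> \<sigma> \<tau> - cnj (p \<sigma>) * p \<tau> * (1 + f)\<close>. A finite Fourier transform turns a sum of squares for \<open>f\<close> into
  one with \<open>G\<close>-invariant terms \<open>g\<close>, and the products \<open>g * p\<close> contribute the missing
  \<open>f * cnj (p \<sigma>) * p \<tau>\<close>.
\<close>

section \<open>Trigonometric polynomials\<close>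

definition torus_char :: "int ^ 'd \<Rightarrow> real ^ 'd \<Rightarrow> complex" where
  "torus_char k \<omega> = laurent_monom k (torus_exp \<omega>)"

definition on_torus :: "'d::finite laurent \<Rightarrow> real ^ 'd \<Rightarrow> complex" where
  "on_torus p \<omega> = laurent_eval p (torus_exp \<omega>)"

definition trig_poly :: "(real ^ 'd::finite \<Rightarrow> complex) \<Rightarrow> bool" where
  "trig_poly g \<longleftrightarrow> g \<in> range on_torus"

lemma norm_torus_exp [simp]: "norm (torus_exp \<omega> $ i) = 1"
  by (simp add: torus_exp_def)

lemma torus_exp_in_torus [simp]: "torus_exp \<omega> \<in> torus"
  by (simp add: torus_def)

lemma torus_char_add: "torus_char (k + l) \<omega> = torus_char k \<omega> * torus_char l \<omega>"
  by (simp add: torus_char_def laurent_monom_def power_int_add prod.distrib)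

lemma torus_char_0 [simp]: "torus_char 0 \<omega> = 1"
  by (simp add: torus_char_def laurent_monom_def)

lemma torus_char_translate: "torus_char k (\<omega> + \<sigma>) = torus_char k \<omega> * torus_char k \<sigma>"
  by (simp add: torus_char_def laurent_monom_add)

lemma norm_torus_char [simp]: "norm (torus_char k \<omega>) = 1"
  by (simp add: torus_char_def laurent_monom_def norm_power_int flip: prod_norm)

lemma torus_char_minus: "torus_char (- k) \<omega> = cnj (torus_char k \<omega>)"
proof -
  have "torus_char (- k) \<omega> * torus_char k \<omega> = 1"
    by (simp flip: torus_char_add)
  moreover have "cnj (torus_char k \<omega>) * torus_char k \<omega> = 1"
    by (metis complex_norm_square mult.commute norm_torus_char of_real_1 one_power2)
  ultimately show ?thesis
    by (metis mult_cancel_right zero_neq_one mult_zero_right)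
qed

lemma torus_char_axis: "torus_char (axis i 1) \<omega> = torus_exp \<omega> $ i"
proof -
  have "torus_char (axis i 1) \<omega> = (\<Prod>j\<in>UNIV. if j = i then torus_exp \<omega> $ i else 1)"
    unfolding torus_char_def laurent_monom_def by (intro prod.cong) (auto simp: axis_def)
  then show ?thesis by simp
qed

lemma on_torus_superset:
  assumes "finite K" "Poly_Mapping.keys p \<subseteq> K"
  shows "on_torus p \<omega> = (\<Sum>k\<in>K. Poly_Mapping.lookup p k * torus_char k \<omega>)"
  unfolding on_torus_def laurent_eval_def torus_char_def
  using assms by (intro sum.mono_neutral_left) (auto simp: in_keys_iff)

lemma on_torus_add: "on_torus (p + q) \<omega> = on_torus p \<omega> + on_torus q \<omega>"
proof -
  let ?K = "Poly_Mapping.keys p \<union> Poly_Mapping.keys q"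
  have "Poly_Mapping.keys (p + q) \<subseteq> ?K" by (rule Poly_Mapping.keys_add)
  then show ?thesis
    by (simp add: on_torus_superset[of ?K] lookup_add distrib_right sum.distrib)
qed

lemma on_torus_0 [simp]: "on_torus 0 \<omega> = 0"
  by (simp add: on_torus_def laurent_eval_def)

lemma on_torus_single: "on_torus (Poly_Mapping.single k c) \<omega> = c * torus_char k \<omega>"
  by (simp add: on_torus_superset[of "{k}"] lookup_single)

lemma on_torus_1 [simp]: "on_torus 1 \<omega> = 1"
  using on_torus_single[of 0 1 \<omega>] by simp

lemma on_torus_sum: "on_torus (\<Sum>i\<in>S. p i) \<omega> = (\<Sum>i\<in>S. on_torus (p i) \<omega>)"
  by (induction S rule: infinite_finite_induct) (auto simp: on_torus_add)

lemma on_torus_minus: "on_torus (p - q) \<omega> = on_torus p \<omega> - on_torus q \<omega>"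
  using on_torus_add[of "p - q" q \<omega>] by simp

lemma laurent_eq_sum_single:
  "(\<Sum>k\<in>Poly_Mapping.keys p. Poly_Mapping.single k (Poly_Mapping.lookup p k)) = p"
proof (rule poly_mapping_eqI)
  fix l
  have "Poly_Mapping.lookup (\<Sum>k\<in>K. Poly_Mapping.single k (Poly_Mapping.lookup p k)) l =
      (\<Sum>k\<in>K. if k = l then Poly_Mapping.lookup p l else 0)" if "finite K" for K
    using that by (induction K) (auto simp: lookup_add lookup_single when_def)
  then show "Poly_Mapping.lookup (\<Sum>k\<in>Poly_Mapping.keys p. Poly_Mapping.single k (Poly_Mapping.lookup p k)) l
      = Poly_Mapping.lookup p l"
    by (simp add: sum.delta in_keys_iff)
qed

lemma on_torus_mult: "on_torus (p * q) \<omega> = on_torus p \<omega> * on_torus q \<omega>"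
proof -
  let ?s = "Poly_Mapping.single" and ?l = "Poly_Mapping.lookup"
  have "p * q = (\<Sum>k\<in>Poly_Mapping.keys p. ?s k (?l p k)) * (\<Sum>k\<in>Poly_Mapping.keys q. ?s k (?l q k))"
    by (simp add: laurent_eq_sum_single)
  also have "on_torus \<dots> \<omega> = (\<Sum>k\<in>Poly_Mapping.keys p. ?l p k * torus_char k \<omega>) * (\<Sum>k\<in>Poly_Mapping.keys q. ?l q k * torus_char k \<omega>)"
    by (simp add: sum_product mult_single on_torus_sum on_torus_single torus_char_add mult_ac)
  finally show ?thesis by (simp only: on_torus_superset[OF finite_keys subset_refl])
qed

lemma on_torus_star: "on_torus (laurent_star p) \<omega> = cnj (on_torus p \<omega>)"
  by (simp add: on_torus_def laurent_eval_star)

lemma on_torus_shift: "on_torus (laurent_shift p \<sigma>) \<omega> = on_torus p (\<omega> + \<sigma>)"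
  by (simp add: on_torus_def laurent_eval_shift)

lemma trig_poly_on_torus [simp, intro]: "trig_poly (on_torus p)"
  by (simp add: trig_poly_def)

lemma trig_polyE:
  assumes "trig_poly g"
  obtains p where "g = on_torus p"
  using assms by (auto simp: trig_poly_def)

lemma trig_poly_translate: 
  assumes "trig_poly g" shows "trig_poly (\<lambda>\<omega>. g (\<omega> + \<sigma>))"
proof -
  obtain p where "g = on_torus p" using assms by (rule trig_polyE)
  then have "(\<lambda>\<omega>. g (\<omega> + \<sigma>)) = on_torus (laurent_shift p \<sigma>)" by (auto simp: on_torus_shift)
  then show ?thesis by simp
qed

lemma trig_poly_char [simp, intro]: "trig_poly (torus_char k)"
proof -
  have "torus_char k = on_torus (Poly_Mapping.single k 1)" by (auto simp: on_torus_single)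
  then show ?thesis by (metis trig_poly_on_torus)
qed

lemma trig_poly_const [simp, intro]: "trig_poly (\<lambda>\<omega>. c)"
proof -
  have "(\<lambda>\<omega>. c) = on_torus (Poly_Mapping.single 0 c)" by (auto simp: on_torus_single)
  then show ?thesis by (metis trig_poly_on_torus)
qed

lemma trig_poly_add [intro]:
  assumes "trig_poly g" "trig_poly h" shows "trig_poly (\<lambda>\<omega>. g \<omega> + h \<omega>)"
proof -
  obtain p q where "g = on_torus p" "h = on_torus q" using assms by (auto elim!: trig_polyE)
  then have "(\<lambda>\<omega>. g \<omega> + h \<omega>) = on_torus (p + q)" by (auto simp: on_torus_add)
  then show ?thesis by (metis trig_poly_on_torus)
qed

lemma trig_poly_mult [intro]:
  assumes "trig_poly g" "trig_poly h" shows "trig_poly (\<lambda>\<omega>. g \<omega> * h \<omega>)"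
proof -
  obtain p q where "g = on_torus p" "h = on_torus q" using assms by (auto elim!: trig_polyE)
  then have "(\<lambda>\<omega>. g \<omega> * h \<omega>) = on_torus (p * q)" by (auto simp: on_torus_mult)
  then show ?thesis by (metis trig_poly_on_torus)
qed

lemma trig_poly_cnj [intro]:
  assumes "trig_poly g" shows "trig_poly (\<lambda>\<omega>. cnj (g \<omega>))"
proof -
  obtain p where "g = on_torus p" using assms by (auto elim!: trig_polyE)
  then have "(\<lambda>\<omega>. cnj (g \<omega>)) = on_torus (laurent_star p)" by (auto simp: on_torus_star)
  then show ?thesis by (metis trig_poly_on_torus)
qed

lemma trig_poly_minus [intro]: "trig_poly g \<Longrightarrow> trig_poly (\<lambda>\<omega>. - g \<omega>)"
  using trig_poly_mult[OF trig_poly_const[of "-1"], of g] by simp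

lemma trig_poly_diff [intro]:
  "trig_poly g \<Longrightarrow> trig_poly h \<Longrightarrow> trig_poly (\<lambda>\<omega>. g \<omega> - h \<omega>)"
  using trig_poly_add[OF _ trig_poly_minus, of g h] by simp

lemma trig_poly_sum [intro]:
  "(\<And>i. i \<in> S \<Longrightarrow> trig_poly (g i)) \<Longrightarrow> trig_poly (\<lambda>\<omega>. \<Sum>i\<in>S. g i \<omega>)"
  by (induction S rule: infinite_finite_induct) auto

lemma trig_poly_prod [intro]:
  "(\<And>i. i \<in> S \<Longrightarrow> trig_poly (g i)) \<Longrightarrow> trig_poly (\<lambda>\<omega>. \<Prod>i\<in>S. g i \<omega>)"
  by (induction S rule: infinite_finite_induct) auto

lemma trig_poly_power [intro]: "trig_poly g \<Longrightarrow> trig_poly (\<lambda>\<omega>. g \<omega> ^ n)"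
  by (induction n) auto

lemma trig_poly_exp [simp, intro]: "trig_poly (\<lambda>\<omega>. torus_exp \<omega> $ i)"
  using trig_poly_char[of "axis i 1"] by (simp add: torus_char_axis[abs_def])

lemma trig_poly_periodic: "trig_poly g \<Longrightarrow> torus_exp \<omega> = torus_exp \<omega>' \<Longrightarrow> g \<omega> = g \<omega>'"
  by (auto elim!: trig_polyE simp: on_torus_def)

text \<open>
  Trigonometric polynomials are the algebra generated by the constants, the coordinates of
  \<open>torus_exp\<close> and their conjugates. On the torus conjugation inverts the coordinates, so negative exponents
  are covered as well.
\<close>
lemma trig_poly_induct [consumes 1, case_names const exp cnj_exp add mult]:
  assumes "trig_poly g"
    and const: "\<And>c. Q (\<lambda>\<omega>. c)"
    and exp: "\<And>i. Q (\<lambda>\<omega>. torus_exp \<omega> $ i)"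
    and cnj_exp: "\<And>i. Q (\<lambda>\<omega>. cnj (torus_exp \<omega> $ i))"
    and add: "\<And>g h. trig_poly g \<Longrightarrow> Q g \<Longrightarrow> trig_poly h \<Longrightarrow> Q h \<Longrightarrow> Q (\<lambda>\<omega>. g \<omega> + h \<omega>)"
    and mult: "\<And>g h. trig_poly g \<Longrightarrow> Q g \<Longrightarrow> trig_poly h \<Longrightarrow> Q h \<Longrightarrow> Q (\<lambda>\<omega>. g \<omega> * h \<omega>)"
  shows "Q g"
proof -
  have pow: "Q (\<lambda>\<omega>. h \<omega> ^ n)" if "trig_poly h" "Q h" for h n
    using that by (induction n) (auto intro: const mult trig_poly_power)
  have ipow: "trig_poly (\<lambda>\<omega>. (torus_exp \<omega> $ i) powi n) \<and> Q (\<lambda>\<omega>. (torus_exp \<omega> $ i) powi n)" for i n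
  proof (cases "n \<ge> 0")
    case True
    then show ?thesis by (auto simp: power_int_def intro!: pow exp)
  next
    case False
    have "inverse (torus_exp \<omega> $ i) = cnj (torus_exp \<omega> $ i)" for \<omega>
      using complex_div_cnj[of 1 "torus_exp \<omega> $ i"] by (simp add: inverse_eq_divide)
    with False show ?thesis by (auto simp: power_int_def intro!: pow cnj_exp trig_poly_power trig_poly_cnj)
  qed
  have char: "Q (torus_char k)" for k
  proof -
    have "trig_poly (\<lambda>\<omega>. \<Prod>i\<in>S. (torus_exp \<omega> $ i) powi (k $ i)) \<and> Q (\<lambda>\<omega>. \<Prod>i\<in>S. (torus_exp \<omega> $ i) powi (k $ i))" if "finite S" for S
      using that ipow by (induction S) (auto intro!: const mult)
    from this[of UNIV] show ?thesis
      unfolding torus_char_def laurent_monom_def[abs_def] by simp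
  qed
  obtain p where p: "g = on_torus p" using assms(1) by (rule trig_polyE)
  have "Q (\<lambda>\<omega>. \<Sum>k\<in>K. Poly_Mapping.lookup p k * torus_char k \<omega>)" if "finite K" for K
    using that by (induction K) (auto intro!: const add mult char trig_poly_sum trig_poly_mult)
  from this[of "Poly_Mapping.keys p"] show ?thesis
    by (simp add: p on_torus_superset[OF finite_keys subset_refl, abs_def])
qed

lemma trig_poly_continuous: 
  assumes "trig_poly g" shows "continuous_on S g"
  using assms
  by (induction rule: trig_poly_induct)
     (auto intro!: continuous_intros simp: torus_exp_def)

lemma torus_exp_surj:
  assumes "\<And>i. norm (\<xi> $ i) = 1"
  obtains \<omega> where "torus_exp \<omega> = \<xi>"
proof -
  have "\<forall>i. \<exists>t. \<xi> $ i = exp (- \<i> * complex_of_real t)"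
  proof
    fix i
    have "\<xi> $ i = cis (Arg (\<xi> $ i))"
      using assms[of i] by (metis cis_Arg norm_zero sgn_eq zero_neq_one of_real_1 div_by_1)
    then show "\<exists>t. \<xi> $ i = exp (- \<i> * complex_of_real t)"
      by (intro exI[of _ "- Arg (\<xi> $ i)"]) (simp add: cis_conv_exp)
  qed
  then obtain t where "\<And>i. \<xi> $ i = exp (- \<i> * complex_of_real (t i))" by metis
  then have "torus_exp (\<chi> i. t i) = \<xi>" by (simp add: torus_exp_def vec_eq_iff)
  then show ?thesis by (rule that)
qed

subsection \<open>Discrete orthogonality of characters\<close>

definition exp_box :: "nat \<Rightarrow> (int ^ 'd) set" where
  "exp_box n = {k. \<forall>i. 0 \<le> k $ i \<and> k $ i < int n}"

lemma exp_box_eq_image: "exp_box n = vec_lambda ` (UNIV \<rightarrow>\<^sub>E {0..<int n})"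
proof (intro set_eqI iffI)
  fix k :: "int ^ 'd" assume "k \<in> exp_box n"
  then have "vec_nth k \<in> UNIV \<rightarrow>\<^sub>E {0..<int n}" by (auto simp: exp_box_def)
  then show "k \<in> vec_lambda ` (UNIV \<rightarrow>\<^sub>E {0..<int n})"
    by (metis image_eqI vec_nth_inverse)
qed (auto simp: exp_box_def)

lemma inj_on_vec_lambda: "inj_on vec_lambda S"
  by (auto simp: inj_on_def vec_lambda_inject)

lemma finite_exp_box [simp]: "finite (exp_box n :: (int ^ 'd::finite) set)"
  by (auto simp: exp_box_eq_image intro!: finite_imageI finite_PiE)

lemma card_exp_box: "card (exp_box n :: (int ^ 'd::finite) set) = n ^ CARD('d)"
  by (simp add: exp_box_eq_image card_image inj_on_vec_lambda card_PiE)

text \<open>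
  The sum over the box is a product of geometric sums in the coordinates, which are roots of unity.
\<close>
lemma sum_exp_box_char:
  fixes \<sigma> :: "real ^ 'd::finite"
  assumes "\<And>i. (torus_exp \<sigma> $ i) ^ n = 1"
  shows "(\<Sum>k\<in>exp_box n. torus_char k \<sigma>) = (if torus_exp \<sigma> = 1 then of_nat (n ^ CARD('d)) else 0)"
proof -
  have "(\<Sum>k\<in>exp_box n. torus_char k \<sigma>) = (\<Sum>k\<in>UNIV \<rightarrow>\<^sub>E {0..<int n}. \<Prod>i\<in>UNIV. (torus_exp \<sigma> $ i) powi (k i))"
    unfolding exp_box_eq_image by (subst sum.reindex) (auto simp: inj_on_vec_lambda torus_char_def laurent_monom_def)
  also have "\<dots> = (\<Prod>i\<in>UNIV. \<Sum>t\<in>{0..<int n}. (torus_exp \<sigma> $ i) powi t)"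
    by (rule prod_sum_PiE[symmetric]) auto
  also have "\<dots> = (\<Prod>i\<in>UNIV. if torus_exp \<sigma> $ i = 1 then of_nat n else 0)"
  proof (rule prod.cong)
    fix i
    have "(\<Sum>t\<in>{0..<int n}. (torus_exp \<sigma> $ i) powi t) = (\<Sum>t<n. (torus_exp \<sigma> $ i) ^ t)"
      by (rule sum.reindex_bij_witness[of _ int nat]) (auto simp: power_int_def)
    also have "\<dots> = (if torus_exp \<sigma> $ i = 1 then of_nat n else 0)"
      using assms[of i] by (simp add: geometric_sum)
    finally show "(\<Sum>t\<in>{0..<int n}. (torus_exp \<sigma> $ i) powi t) = (if torus_exp \<sigma> $ i = 1 then of_nat n else 0)" .
  qed simp
  also have "\<dots> = (if torus_exp \<sigma> = 1 then of_nat (n ^ CARD('d)) else 0)"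
    by (auto simp: vec_eq_iff) 
  finally show ?thesis .
qed

definition node :: "nat \<Rightarrow> int ^ 'd \<Rightarrow> real ^ 'd" where
  "node N t = (\<chi> i. 2 * pi * of_int (t $ i) / of_nat N)"

lemma torus_exp_node: "torus_exp (node N t) $ i = cis (- (2 * pi * of_int (t $ i) / of_nat N))"
  by (simp add: torus_exp_def node_def cis_conv_exp)

lemma cis_powi: "cis x powi k = cis (of_int k * x)"
  by (auto simp: power_int_def Complex.DeMoivre cis_inverse)

text \<open>
  The pairing of exponents with nodes is symmetric, so that a sum of one character over all nodes
  becomes a sum of all characters of a box at one node.
\<close>
lemma torus_char_node_commute: "torus_char k (node N t) = torus_char t (node N k)"
  unfolding torus_char_def laurent_monom_def torus_exp_node cis_powi
  by (intro prod.cong arg_cong[where f = cis]) (auto simp: field_simps)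

lemma torus_exp_node_power: "N > 0 \<Longrightarrow> (torus_exp (node N t) $ i) ^ N = 1"
  using cis_multiple_2pi[of "of_int (- t $ i)"] by (simp add: torus_exp_node Complex.DeMoivre)

lemma torus_exp_node_eq_1:
  assumes "N > 0" shows "torus_exp (node N t) = 1 \<longleftrightarrow> (\<forall>i. int N dvd t $ i)"
proof -
  have "cis (- (2 * pi * of_int m / of_nat N)) = 1 \<longleftrightarrow> int N dvd m" for m
  proof
    assume "cis (- (2 * pi * of_int m / of_nat N)) = 1"
    then have "cos (2 * pi * of_int m / of_nat N) = 1" by (auto simp: complex_eq_iff)
    then obtain x :: int where "2 * pi * of_int m / of_nat N = of_int x * 2 * pi"
      by (auto simp: cos_one_2pi_int)
    then have "of_int m = (of_int (x * int N) :: real)" using assms by (simp add: field_simps)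
    then have "m = x * int N" by (subst (asm) of_int_eq_iff)
    then show "int N dvd m" by simp
  next
    assume "int N dvd m"
    then obtain x where "m = int N * x" by blast
    then have "- (2 * pi * of_int m / of_nat N) = 2 * pi * of_int (- x)" using assms by simp
    then show "cis (- (2 * pi * of_int m / of_nat N)) = 1"
      by (metis cis_multiple_2pi Ints_of_int)
  qed
  then show ?thesis by (simp add: vec_eq_iff torus_exp_node)
qed

lemma sum_nodes_char:
  fixes k :: "int ^ 'd::finite"
  assumes "N > 0"
  shows "(\<Sum>t\<in>exp_box N. torus_char k (node N t)) = (if \<forall>i. int N dvd k $ i then of_nat (N ^ CARD('d)) else 0)"
  using sum_exp_box_char[of "node N k" N] assms
  by (simp add: torus_char_node_commute[of k] torus_exp_node_power torus_exp_node_eq_1)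

lemma sum_nodes_char_small:
  fixes k :: "int ^ 'd::finite"
  assumes "\<And>i. \<bar>k $ i\<bar> < int N"
  shows "(\<Sum>t\<in>exp_box N. torus_char k (node N t)) = (if k = 0 then of_nat (N ^ CARD('d)) else 0)"
proof -
  have "N > 0" using assms[of undefined] by (cases N) auto
  moreover have "(\<forall>i. int N dvd k $ i) \<longleftrightarrow> k = 0"
    using assms by (auto simp: vec_eq_iff dest!: zdvd_not_zless[rotated]) (metis dvd_abs_iff zdvd_not_zless abs_of_nonneg abs_ge_zero dvd_imp_le_int linorder_not_less abs_of_nat)
  ultimately show ?thesis by (simp only: sum_nodes_char)
qed

lemma finite_exponents_bounded:
  assumes "finite (K :: (int ^ 'd::finite) set)"
  obtains D :: nat where "\<And>k i. k \<in> K \<Longrightarrow> \<bar>k $ i\<bar> \<le> int D"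
proof -
  let ?S = "(\<lambda>(k, i). nat \<bar>k $ i\<bar>) ` (K \<times> UNIV)"
  have "finite ?S" using assms by simp
  then have "\<And>k i. k \<in> K \<Longrightarrow> nat \<bar>k $ i\<bar> \<le> Max ?S"
    by (intro Max_ge) (auto intro!: image_eqI)
  then show ?thesis by (intro that[of "Max ?S"]) (metis nat_le_iff)
qed

text \<open>
  By orthogonality over sufficiently many nodes the values determine each coefficient.
\<close>
lemma on_torus_inject:
  assumes "\<And>\<omega>. on_torus p \<omega> = on_torus q \<omega>"
  shows "p = q"
proof (rule poly_mapping_eqI)
  fix k
  let ?r = "p - q"
  let ?K = "insert k (Poly_Mapping.keys ?r)"
  obtain D where D: "\<And>l i. l \<in> ?K \<Longrightarrow> \<bar>l $ i\<bar> \<le> int D"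
    using finite_exponents_bounded[of ?K] by auto
  \<comment> \<open>Differences of two exponents are bounded by \<open>2 * D\<close>, hence distinct modulo \<open>N\<close>.\<close>
  define N where "N = 2 * D + 1"
  have small: "\<bar>(l - k) $ i\<bar> < int N" if "l \<in> ?K" for l i
    using D[OF that, of i] D[of k i] by (auto simp: N_def)
  have "0 = (\<Sum>t\<in>exp_box N. on_torus ?r (node N t) * torus_char (- k) (node N t))"
    using assms by (simp add: on_torus_minus)
  also have "\<dots> = (\<Sum>t\<in>exp_box N. \<Sum>l\<in>?K. Poly_Mapping.lookup ?r l * torus_char (l - k) (node N t))"
    by (subst on_torus_superset[of ?K])
       (auto simp: sum_distrib_right torus_char_add[of _ "- k", simplified] mult.assoc)
  also have "\<dots> = (\<Sum>l\<in>?K. Poly_Mapping.lookup ?r l * (\<Sum>t\<in>exp_box N. torus_char (l - k) (node N t)))"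
    by (subst sum.swap) (simp add: sum_distrib_left)
  also have "\<dots> = (\<Sum>l\<in>?K. if l = k then Poly_Mapping.lookup ?r k * of_nat (N ^ CARD('a)) else 0)"
    using small by (intro sum.cong) (auto simp: sum_nodes_char_small)
  also have "\<dots> = Poly_Mapping.lookup ?r k * of_nat (N ^ CARD('a))" by (simp add: sum.delta)
  finally show "Poly_Mapping.lookup p k = Poly_Mapping.lookup q k"
    by (simp add: N_def lookup_minus del: of_nat_add of_nat_mult of_nat_Suc)
qed


section \<open>Partial derivatives of trigonometric polynomials\<close>

text \<open>
  The counterpart for complex-valued functions of \<open>partial_deriv\<close>, with which it is
  compared in \<open>partial_deriv_Re\<close>. On trigonometric polynomials it is a derivation that commutes with conjugation.
\<close>
definition pd :: "'d \<Rightarrow> (real ^ 'd::finite \<Rightarrow> complex) \<Rightarrow> real ^ 'd \<Rightarrow> complex" where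
  "pd j g \<omega> = vector_derivative (\<lambda>t. g (\<omega> + t *\<^sub>R axis j 1)) (at 0)"

lemma pd_unique:
  assumes "\<And>\<omega>. ((\<lambda>t. g (\<omega> + t *\<^sub>R axis j 1)) has_vector_derivative g' \<omega>) (at 0)"
  shows "pd j g = g'"
  using assms by (intro ext) (auto simp: pd_def intro!: vector_derivative_at)

lemma torus_exp_has_pd:
  "((\<lambda>t. torus_exp (\<omega> + t *\<^sub>R axis j 1) $ i) has_vector_derivative
     (if i = j then - \<i> * torus_exp \<omega> $ i else 0)) (at 0)"
proof (cases "i = j")
  case True
  have "((\<lambda>z. exp (- \<i> * (complex_of_real (\<omega> $ j) + z))) has_field_derivative
          - \<i> * exp (- \<i> * complex_of_real (\<omega> $ j))) (at (of_real 0))"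
    by (auto intro!: derivative_eq_intros)
  then have "((\<lambda>t. exp (- \<i> * (complex_of_real (\<omega> $ j) + of_real t))) has_vector_derivative
          - \<i> * exp (- \<i> * complex_of_real (\<omega> $ j))) (at 0)"
    by (rule has_vector_derivative_real_field)
  then show ?thesis using True by (simp add: torus_exp_def)
qed (simp add: torus_exp_def axis_def)

lemma trig_poly_has_pd_aux:
  assumes "trig_poly g"
  shows "\<exists>g'. trig_poly g' \<and>
    (\<forall>\<omega>. ((\<lambda>t. g (\<omega> + t *\<^sub>R axis j 1)) has_vector_derivative g' \<omega>) (at 0))"
  using assms
proof (induction rule: trig_poly_induct)
  case (const c)
  show ?case by (rule exI[of _ "\<lambda>_. 0"]) auto
next
  case (exp i)
  show ?case using torus_exp_has_pd[of _ j i]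
    by (intro exI[of _ "\<lambda>\<omega>. if i = j then - \<i> * torus_exp \<omega> $ i else 0"])
       (cases "i = j"; auto intro!: trig_poly_minus trig_poly_mult)
next
  case (cnj_exp i)
  show ?case using bounded_linear.has_vector_derivative[OF bounded_linear_cnj torus_exp_has_pd[of _ j i]]
    by (intro exI[of _ "\<lambda>\<omega>. cnj (if i = j then - \<i> * torus_exp \<omega> $ i else 0)"])
       (cases "i = j"; auto intro!: trig_poly_minus trig_poly_mult)
next
  case (add g h)
  then obtain g' h' where *: "trig_poly g'" "trig_poly h'"
     "\<And>\<omega>. ((\<lambda>t. g (\<omega> + t *\<^sub>R axis j 1)) has_vector_derivative g' \<omega>) (at 0)"
     "\<And>\<omega>. ((\<lambda>t. h (\<omega> + t *\<^sub>R axis j 1)) has_vector_derivative h' \<omega>) (at 0)" by blast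
  show ?case
    by (rule exI[of _ "\<lambda>\<omega>. g' \<omega> + h' \<omega>"]) (auto intro!: * has_vector_derivative_add)
next
  case (mult g h)
  then obtain g' h' where *: "trig_poly g'" "trig_poly h'"
     "\<And>\<omega>. ((\<lambda>t. g (\<omega> + t *\<^sub>R axis j 1)) has_vector_derivative g' \<omega>) (at 0)"
     "\<And>\<omega>. ((\<lambda>t. h (\<omega> + t *\<^sub>R axis j 1)) has_vector_derivative h' \<omega>) (at 0)" by blast
  have "((\<lambda>t. g (\<omega> + t *\<^sub>R axis j 1) * h (\<omega> + t *\<^sub>R axis j 1)) has_vector_derivative g \<omega> * h' \<omega> + g' \<omega> * h \<omega>) (at 0)" for \<omega>
    using has_vector_derivative_mult[OF *(3,4)[of \<omega>]] by simp
  then show ?case using * mult.hyps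
    by (intro exI[of _ "\<lambda>\<omega>. g \<omega> * h' \<omega> + g' \<omega> * h \<omega>"]) auto
qed

lemma trig_poly_has_pd:
  assumes "trig_poly g"
  shows "((\<lambda>t. g (\<omega> + t *\<^sub>R axis j 1)) has_vector_derivative pd j g \<omega>) (at 0)"
  using trig_poly_has_pd_aux[OF assms, of j] pd_unique by metis

lemma trig_poly_pd [intro]:
  assumes "trig_poly g" shows "trig_poly (pd j g)"
  using trig_poly_has_pd_aux[OF assms, of j] pd_unique by metis

lemma pd_const [simp]: "pd j (\<lambda>\<omega>. c) = (\<lambda>\<omega>. 0)"
  by (intro pd_unique) auto

lemma pd_exp: "pd j (\<lambda>\<omega>. torus_exp \<omega> $ i) = (\<lambda>\<omega>. if i = j then - \<i> * torus_exp \<omega> $ i else 0)"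
  by (intro pd_unique torus_exp_has_pd)

lemma pd_add:
  assumes "trig_poly g" "trig_poly h"
  shows "pd j (\<lambda>\<omega>. g \<omega> + h \<omega>) = (\<lambda>\<omega>. pd j g \<omega> + pd j h \<omega>)"
  by (intro pd_unique has_vector_derivative_add trig_poly_has_pd assms)

lemma pd_diff:
  assumes "trig_poly g" "trig_poly h"
  shows "pd j (\<lambda>\<omega>. g \<omega> - h \<omega>) = (\<lambda>\<omega>. pd j g \<omega> - pd j h \<omega>)"
  by (intro pd_unique has_vector_derivative_diff trig_poly_has_pd assms)

lemma pd_mult:
  assumes "trig_poly g" "trig_poly h"
  shows "pd j (\<lambda>\<omega>. g \<omega> * h \<omega>) = (\<lambda>\<omega>. pd j g \<omega> * h \<omega> + g \<omega> * pd j h \<omega>)"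
proof (rule pd_unique)
  fix \<omega>
  show "((\<lambda>t. g (\<omega> + t *\<^sub>R axis j 1) * h (\<omega> + t *\<^sub>R axis j 1)) has_vector_derivative
      pd j g \<omega> * h \<omega> + g \<omega> * pd j h \<omega>) (at 0)"
    using has_vector_derivative_mult[OF trig_poly_has_pd[OF assms(1)] trig_poly_has_pd[OF assms(2)], of \<omega> j \<omega> j]
    by (simp add: add.commute)
qed

lemma pd_cnj:
  assumes "trig_poly g"
  shows "pd j (\<lambda>\<omega>. cnj (g \<omega>)) = (\<lambda>\<omega>. cnj (pd j g \<omega>))"
  by (intro pd_unique bounded_linear.has_vector_derivative[OF bounded_linear_cnj] trig_poly_has_pd assms)

lemma pd_sum:
  assumes "\<And>k. k \<in> S \<Longrightarrow> trig_poly (g k)"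
  shows "pd j (\<lambda>\<omega>. \<Sum>k\<in>S. g k \<omega>) = (\<lambda>\<omega>. \<Sum>k\<in>S. pd j (g k) \<omega>)"
  using assms by (induction S rule: infinite_finite_induct) (auto simp: pd_add trig_poly_sum)

lemma pd_pd_mult:
  assumes "trig_poly g" "trig_poly h"
  shows "pd i (pd j (\<lambda>\<omega>. g \<omega> * h \<omega>)) = (\<lambda>\<omega>. pd i (pd j g) \<omega> * h \<omega> + pd j g \<omega> * pd i h \<omega>
    + pd i g \<omega> * pd j h \<omega> + g \<omega> * pd i (pd j h) \<omega>)"
  using assms by (simp add: pd_mult pd_add trig_poly_pd trig_poly_mult add.assoc)

lemma pd_real:
  assumes "trig_poly g" "\<And>\<omega>. g \<omega> \<in> \<real>"
  shows "pd j g \<omega> \<in> \<real>"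
proof -
  have "(\<lambda>\<omega>. cnj (g \<omega>)) = g" using assms(2) by (simp add: Reals_cnj_iff)
  then have "cnj (pd j g \<omega>) = pd j g \<omega>" using pd_cnj[OF assms(1), of j] by metis
  then show ?thesis by (simp add: Reals_cnj_iff)
qed

lemma Re_has_derivative:
  assumes "trig_poly g"
  shows "((\<lambda>t. Re (g (\<omega> + t *\<^sub>R axis j 1))) has_real_derivative Re (pd j g \<omega>)) (at 0)"
  using bounded_linear.has_vector_derivative[OF bounded_linear_Re trig_poly_has_pd[OF assms]]
  by (simp add: has_real_derivative_iff_has_vector_derivative)

lemma partial_deriv_Re:
  assumes "trig_poly g"
  shows "partial_deriv j (\<lambda>\<omega>. Re (g \<omega>)) = (\<lambda>\<omega>. Re (pd j g \<omega>))"
  unfolding partial_deriv_def using DERIV_imp_deriv[OF Re_has_derivative[OF assms]] by auto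

lemma hessian_Re:
  assumes "trig_poly g"
  shows "hessian (\<lambda>\<omega>. Re (g \<omega>)) \<omega> $ i $ j = Re (pd i (pd j g) \<omega>)"
  using assms by (simp add: hessian_def partial_deriv_Re trig_poly_pd)

lemma pd_zero_at_minimum:
  assumes "trig_poly g" "\<And>\<omega>. g \<omega> \<in> \<real>\<^sub>\<ge>\<^sub>0" "g \<omega>0 = 0"
  shows "pd j g \<omega>0 = 0"
proof -
  have "Re (pd j g \<omega>0) = 0"
    by (rule DERIV_local_min[OF Re_has_derivative[OF assms(1)], of 1])
       (use assms in \<open>auto simp: complex_nonneg_Reals_iff\<close>)
  moreover have "pd j g \<omega>0 \<in> \<real>"
    using assms nonneg_Reals_subset_Reals by (intro pd_real) auto
  ultimately show ?thesis by (simp add: complex_is_Real_iff complex_eq_iff)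
qed


section \<open>Ideals of finite grids\<close>

definition grid_poly :: "complex set \<Rightarrow> 'd \<Rightarrow> real ^ 'd::finite \<Rightarrow> complex" where
  "grid_poly A i \<omega> = (\<Prod>a\<in>A. torus_exp \<omega> $ i - a)"

definition in_grid_ideal :: "('d \<Rightarrow> complex set) \<Rightarrow> (real ^ 'd::finite \<Rightarrow> complex) \<Rightarrow> bool" where
  "in_grid_ideal Z h \<longleftrightarrow> (\<exists>B. (\<forall>i. trig_poly (B i)) \<and> (\<forall>\<omega>. h \<omega> = (\<Sum>i\<in>UNIV. B i \<omega> * grid_poly (Z i) i \<omega>)))"

lemma trig_poly_grid_poly [intro]: "trig_poly (grid_poly A i)"
  unfolding grid_poly_def[abs_def] by (intro trig_poly_prod trig_poly_diff trig_poly_exp trig_poly_const)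

lemma grid_poly_insert:
  "finite A \<Longrightarrow> a \<notin> A \<Longrightarrow> grid_poly (insert a A) i \<omega> = (torus_exp \<omega> $ i - a) * grid_poly A i \<omega>"
  by (simp add: grid_poly_def)

lemma grid_poly_remove:
  "finite A \<Longrightarrow> a \<in> A \<Longrightarrow> grid_poly A i \<omega> = (torus_exp \<omega> $ i - a) * grid_poly (A - {a}) i \<omega>"
  by (simp add: grid_poly_def prod.remove)

lemma grid_poly_eq_0_iff: "finite A \<Longrightarrow> grid_poly A i \<omega> = 0 \<longleftrightarrow> torus_exp \<omega> $ i \<in> A"
  by (auto simp: grid_poly_def)

lemma in_grid_ideal_add:
  assumes "in_grid_ideal Z g" "in_grid_ideal Z h"
  shows "in_grid_ideal Z (\<lambda>\<omega>. g \<omega> + h \<omega>)"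
proof -
  obtain B C where "\<And>i. trig_poly (B i)" "\<And>\<omega>. g \<omega> = (\<Sum>i\<in>UNIV. B i \<omega> * grid_poly (Z i) i \<omega>)"
    "\<And>i. trig_poly (C i)" "\<And>\<omega>. h \<omega> = (\<Sum>i\<in>UNIV. C i \<omega> * grid_poly (Z i) i \<omega>)"
    using assms unfolding in_grid_ideal_def by blast
  then show ?thesis unfolding in_grid_ideal_def
    by (intro exI[of _ "\<lambda>i \<omega>. B i \<omega> + C i \<omega>"]) (auto simp: distrib_right sum.distrib)
qed

lemma in_grid_ideal_mult:
  assumes "trig_poly c" "in_grid_ideal Z g"
  shows "in_grid_ideal Z (\<lambda>\<omega>. c \<omega> * g \<omega>)"
proof -
  obtain B where "\<And>i. trig_poly (B i)" "\<And>\<omega>. g \<omega> = (\<Sum>i\<in>UNIV. B i \<omega> * grid_poly (Z i) i \<omega>)"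
    using assms unfolding in_grid_ideal_def by blast
  then show ?thesis unfolding in_grid_ideal_def using assms(1)
    by (intro exI[of _ "\<lambda>i \<omega>. c \<omega> * B i \<omega>"]) (auto simp: sum_distrib_left mult.assoc)
qed

text \<open>
  The ideal of a torus point is generated by the linear polynomials \<open>z i - \<xi> i\<close>; it is enough to
  check the generators of the algebra and to use \<open>g h - g0 h0 = h0 (g - g0) + g (h - h0)\<close>.
\<close>
lemma trig_poly_vanishing_at_point:
  assumes "trig_poly g"
  shows "\<exists>C. (\<forall>i. trig_poly (C i)) \<and>
    (\<forall>\<omega>. g \<omega> = g \<omega>0 + (\<Sum>i\<in>UNIV. C i \<omega> * (torus_exp \<omega> $ i - torus_exp \<omega>0 $ i)))"
  using assms
proof (induction rule: trig_poly_induct)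
  case (const c)
  show ?case by (rule exI[of _ "\<lambda>i \<omega>. 0"]) auto
next
  case (exp j)
  have "trig_poly (\<lambda>\<omega>. if i = j then 1 else 0)" for i by (cases "i = j") auto
  then show ?case
    by (intro exI[of _ "\<lambda>i \<omega>. if i = j then 1 else 0"]) (auto simp: if_distrib[of "\<lambda>x. x * _"] cong: if_cong)
next
  case (cnj_exp j)
  let ?c = "\<lambda>i \<omega>. if i = j then - cnj (torus_exp \<omega> $ j) * cnj (torus_exp \<omega>0 $ j) else 0"
  have "trig_poly (?c i)" for i
    by (cases "i = j") (auto intro!: trig_poly_minus trig_poly_mult trig_poly_cnj)
  moreover have "cnj (torus_exp \<omega> $ j) = cnj (torus_exp \<omega>0 $ j)
      - cnj (torus_exp \<omega> $ j) * cnj (torus_exp \<omega>0 $ j) * (torus_exp \<omega> $ j - torus_exp \<omega>0 $ j)" for \<omega>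
  proof -
    have "torus_exp \<omega> $ j * cnj (torus_exp \<omega> $ j) = 1" for \<omega>
      by (simp flip: complex_norm_square)
    from this[of \<omega>] this[of \<omega>0] show ?thesis by algebra
  qed
  ultimately show ?case
    by (intro exI[of _ ?c]) (auto simp: if_distrib[of "\<lambda>x. x * _"] cong: if_cong)
next
  case (add g h)
  then obtain C E where *: "\<And>i. trig_poly (C i)" "\<And>i. trig_poly (E i)"
    "\<And>\<omega>. g \<omega> = g \<omega>0 + (\<Sum>i\<in>UNIV. C i \<omega> * (torus_exp \<omega> $ i - torus_exp \<omega>0 $ i))"
    "\<And>\<omega>. h \<omega> = h \<omega>0 + (\<Sum>i\<in>UNIV. E i \<omega> * (torus_exp \<omega> $ i - torus_exp \<omega>0 $ i))" by blast
  show ?case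
  proof (intro exI[of _ "\<lambda>i \<omega>. C i \<omega> + E i \<omega>"] conjI allI)
    fix \<omega>
    show "g \<omega> + h \<omega> = g \<omega>0 + h \<omega>0 + (\<Sum>i\<in>UNIV. (C i \<omega> + E i \<omega>) * (torus_exp \<omega> $ i - torus_exp \<omega>0 $ i))"
      using *(3)[of \<omega>] *(4)[of \<omega>] by (simp add: distrib_right sum.distrib)
  qed (use *(1,2) in auto)
next
  case (mult g h)
  then obtain C E where *: "\<And>i. trig_poly (C i)" "\<And>i. trig_poly (E i)"
    "\<And>\<omega>. g \<omega> = g \<omega>0 + (\<Sum>i\<in>UNIV. C i \<omega> * (torus_exp \<omega> $ i - torus_exp \<omega>0 $ i))"
    "\<And>\<omega>. h \<omega> = h \<omega>0 + (\<Sum>i\<in>UNIV. E i \<omega> * (torus_exp \<omega> $ i - torus_exp \<omega>0 $ i))" by blast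
  show ?case
  proof (intro exI[of _ "\<lambda>i \<omega>. h \<omega>0 * C i \<omega> + g \<omega> * E i \<omega>"] conjI allI)
    fix \<omega>
    have "g \<omega> * h \<omega> = g \<omega>0 * h \<omega>0 + (h \<omega>0 * (g \<omega> - g \<omega>0) + g \<omega> * (h \<omega> - h \<omega>0))" by algebra
    also have "g \<omega> - g \<omega>0 = (\<Sum>i\<in>UNIV. C i \<omega> * (torus_exp \<omega> $ i - torus_exp \<omega>0 $ i))"
      using *(3)[of \<omega>] by simp
    also have "h \<omega> - h \<omega>0 = (\<Sum>i\<in>UNIV. E i \<omega> * (torus_exp \<omega> $ i - torus_exp \<omega>0 $ i))"
      using *(4)[of \<omega>] by simp
    finally show "g \<omega> * h \<omega> = g \<omega>0 * h \<omega>0 + (\<Sum>i\<in>UNIV. (h \<omega>0 * C i \<omega> + g \<omega> * E i \<omega>) * (torus_exp \<omega> $ i - torus_exp \<omega>0 $ i))"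
      by (simp add: sum_distrib_left distrib_right sum.distrib mult.assoc)
  qed (use *(1,2) mult.hyps in \<open>auto intro!: trig_poly_add trig_poly_mult\<close>)
qed

locale torus_grid =
  fixes Z :: "'d::finite \<Rightarrow> complex set"
  assumes finite_Z [simp]: "finite (Z i)"
    and Z_nonempty: "Z i \<noteq> {}"
    and norm_Z: "a \<in> Z i \<Longrightarrow> norm a = 1"
begin

definition on_grid :: "real ^ 'd \<Rightarrow> bool" where
  "on_grid \<omega> \<longleftrightarrow> (\<forall>i. torus_exp \<omega> $ i \<in> Z i)"

abbreviation P :: "'d \<Rightarrow> real ^ 'd \<Rightarrow> complex" where
  "P i \<equiv> grid_poly (Z i) i"

lemma P_on_grid: "on_grid \<omega> \<Longrightarrow> P i \<omega> = 0"
  by (simp add: on_grid_def grid_poly_eq_0_iff)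

text \<open>
  The induction removes points from the sets \<open>S i\<close>. When all \<open>S i\<close> are singletons, the
  product kills all grid points but one, and \<open>F\<close> lies in the ideal of that point. When some \<open>S i\<close> contains two points
  \<open>a\<close> and \<open>b\<close>, the products for \<open>S i - {a}\<close> and \<open>S i - {b}\<close> are the product for \<open>S i\<close> times
  \<open>z i - a\<close> and \<open>z i - b\<close>, whose difference is a nonzero constant. For \<open>S = Z\<close> all factors are \<open>1\<close>, which gives the membership of \<open>F\<close> itself.
\<close>
lemma vanishing_in_grid_ideal_aux:
  assumes F: "trig_poly F" "\<And>\<omega>. on_grid \<omega> \<Longrightarrow> F \<omega> = 0"
    and S: "\<And>i. S i \<subseteq> Z i" "\<And>i. S i \<noteq> {}"
  shows "in_grid_ideal Z (\<lambda>\<omega>. F \<omega> * (\<Prod>i\<in>UNIV. grid_poly (Z i - S i) i \<omega>))"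
  using S
proof (induction "\<Sum>i\<in>UNIV. card (S i)" arbitrary: S rule: less_induct)
  case less
  have fin: "finite (S i)" for i by (rule finite_subset[OF less.prems(1) finite_Z])
  let ?Q = "\<lambda>S \<omega>. \<Prod>i\<in>UNIV. grid_poly (Z i - S i) i \<omega>"
  show ?case
  proof (cases "\<exists>i a b. a \<in> S i \<and> b \<in> S i \<and> a \<noteq> b")
    case True
    then obtain i a b where ab: "a \<in> S i" "b \<in> S i" "a \<noteq> b" by blast
    have step: "in_grid_ideal Z (\<lambda>\<omega>. F \<omega> * ((torus_exp \<omega> $ i - c) * ?Q S \<omega>))"
      if c: "c \<in> S i" "c' \<in> S i" "c' \<noteq> c" for c c'
    proof -
      let ?S = "S(i := S i - {c})"
      have "in_grid_ideal Z (\<lambda>\<omega>. F \<omega> * ?Q ?S \<omega>)"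
      proof (rule less.hyps)
        show "(\<Sum>k\<in>UNIV. card (?S k)) < (\<Sum>k\<in>UNIV. card (S k))"
        proof (rule sum_strict_mono_ex1)
          show "\<forall>k\<in>UNIV. card (?S k) \<le> card (S k)" by (auto simp: fin intro: card_mono)
          show "\<exists>k\<in>UNIV. card (?S k) < card (S k)"
            by (rule bexI[of _ i]) (use card_Diff1_less[OF fin c(1)] in simp_all)
        qed simp
        show "?S k \<subseteq> Z k" for k using less.prems(1)[of k] less.prems(1)[of i] by auto
        show "?S k \<noteq> {}" for k using less.prems(2)[of k] c by auto
      qed
      moreover have "?Q ?S \<omega> = (torus_exp \<omega> $ i - c) * ?Q S \<omega>" for \<omega>
      proof -
        have eq: "Z i - (S i - {c}) = insert c (Z i - S i)" using c less.prems(1)[of i] by auto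
        have "?Q ?S \<omega> = grid_poly (Z i - (S i - {c})) i \<omega> * (\<Prod>k\<in>UNIV - {i}. grid_poly (Z k - ?S k) k \<omega>)"
          by (subst prod.remove[of _ i]) auto
        also have "(\<Prod>k\<in>UNIV - {i}. grid_poly (Z k - ?S k) k \<omega>) = (\<Prod>k\<in>UNIV - {i}. grid_poly (Z k - S k) k \<omega>)"
          by (rule prod.cong) auto
        also have "grid_poly (Z i - (S i - {c})) i \<omega> = (torus_exp \<omega> $ i - c) * grid_poly (Z i - S i) i \<omega>"
          unfolding eq using c by (subst grid_poly_insert) auto
        finally show ?thesis
          by (simp add: prod.remove[of UNIV i "\<lambda>k. grid_poly (Z k - S k) k \<omega>"])
      qed
      ultimately show ?thesis by simp
    qed
    have eq: "inverse (b - a) * (F \<omega> * ((torus_exp \<omega> $ i - a) * ?Q S \<omega>)) +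
        (- inverse (b - a)) * (F \<omega> * ((torus_exp \<omega> $ i - b) * ?Q S \<omega>)) = F \<omega> * ?Q S \<omega>" for \<omega>
    proof -
      have "r * (f * ((x - a) * q)) + (- r) * (f * ((x - b) * q)) = (r * (b - a)) * (f * q)" for r f x q :: complex
        by (simp add: algebra_simps)
      then show ?thesis using ab(3) by simp
    qed
    have "in_grid_ideal Z (\<lambda>\<omega>. inverse (b - a) * (F \<omega> * ((torus_exp \<omega> $ i - a) * ?Q S \<omega>)) +
        (- inverse (b - a)) * (F \<omega> * ((torus_exp \<omega> $ i - b) * ?Q S \<omega>)))"
      using ab by (intro in_grid_ideal_add in_grid_ideal_mult trig_poly_const step[of a b] step[of b a]) auto
    then show ?thesis unfolding eq .
  next
    case False
    then have "\<exists>a. S i = {a}" for i using less.prems(2)[of i] by blast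
    then obtain \<xi> where \<xi>: "\<And>i. S i = {\<xi> i}" by metis
    then have \<xi>Z: "\<xi> i \<in> Z i" for i using less.prems(1)[of i] by auto
    obtain \<omega>0 where \<omega>0: "torus_exp \<omega>0 = (\<chi> i. \<xi> i)"
      using torus_exp_surj[of "\<chi> i. \<xi> i"] norm_Z[OF \<xi>Z] by auto
    have "F \<omega>0 = 0" by (rule F(2)) (simp add: on_grid_def \<omega>0 \<xi>Z)
    then obtain C where C: "\<And>i. trig_poly (C i)" "\<And>\<omega>. F \<omega> = (\<Sum>i\<in>UNIV. C i \<omega> * (torus_exp \<omega> $ i - \<xi> i))"
      using trig_poly_vanishing_at_point[OF F(1), of \<omega>0] \<omega>0 by auto
    have F_eq: "F \<omega> * ?Q S \<omega> = (\<Sum>i\<in>UNIV. C i \<omega> * (\<Prod>k\<in>UNIV - {i}. grid_poly (Z k - S k) k \<omega>) * P i \<omega>)" for \<omega>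
    proof -
      have "(torus_exp \<omega> $ i - \<xi> i) * ?Q S \<omega> = (\<Prod>k\<in>UNIV - {i}. grid_poly (Z k - S k) k \<omega>) * P i \<omega>" for i
        using \<xi>Z[of i] by (simp add: prod.remove[of UNIV i] grid_poly_remove[of "Z i" "\<xi> i"] \<xi>)
      then have eq: "C i \<omega> * (torus_exp \<omega> $ i - \<xi> i) * ?Q S \<omega> = C i \<omega> * (\<Prod>k\<in>UNIV - {i}. grid_poly (Z k - S k) k \<omega>) * P i \<omega>" for i
        by (simp add: mult.assoc)
      show ?thesis unfolding C(2)[of \<omega>] sum_distrib_right by (intro sum.cong refl eq)
    qed
    show ?thesis unfolding in_grid_ideal_def
      by (rule exI[of _ "\<lambda>i \<omega>. C i \<omega> * (\<Prod>k\<in>UNIV - {i}. grid_poly (Z k - S k) k \<omega>)"],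
          intro conjI allI F_eq trig_poly_mult trig_poly_prod trig_poly_grid_poly C(1))
  qed
qed

lemma vanishing_in_grid_ideal:
  assumes "trig_poly F" "\<And>\<omega>. on_grid \<omega> \<Longrightarrow> F \<omega> = 0"
  shows "in_grid_ideal Z F"
  using vanishing_in_grid_ideal_aux[OF assms, of Z] Z_nonempty
  by (simp add: grid_poly_def)

lemma pd_P_other: 
  assumes "i \<noteq> j" shows "pd j (P i) \<omega> = 0"
proof -
  have "pd j (grid_poly A i) \<omega> = 0" if "finite A" for A
    using that
  proof (induction A)
    case empty
    show ?case unfolding grid_poly_def[abs_def] by simp
  next
    case (insert a A)
    have "grid_poly (insert a A) i = (\<lambda>\<omega>. (torus_exp \<omega> $ i - a) * grid_poly A i \<omega>)"
      using insert by (auto simp: grid_poly_insert)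
    then show ?case using insert assms
      by (simp add: pd_mult pd_diff pd_exp trig_poly_diff trig_poly_grid_poly)
  qed
  then show ?thesis by simp
qed

lemma pd_P_nonzero:
  assumes "on_grid \<omega>" shows "pd i (P i) \<omega> \<noteq> 0"
proof -
  define a where "a = torus_exp \<omega> $ i"
  have a: "a \<in> Z i" using assms by (simp add: a_def on_grid_def)
  have "P i = (\<lambda>\<omega>. (torus_exp \<omega> $ i - a) * grid_poly (Z i - {a}) i \<omega>)"
    using a by (auto simp: grid_poly_remove)
  then have "pd i (P i) \<omega> = - \<i> * a * grid_poly (Z i - {a}) i \<omega>"
    by (simp add: pd_mult pd_diff pd_exp trig_poly_diff trig_poly_grid_poly a_def)
  moreover have "grid_poly (Z i - {a}) i \<omega> \<noteq> 0"
    by (subst grid_poly_eq_0_iff) (auto simp: a_def)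
  moreover have "a \<noteq> 0" using norm_Z[OF a] by auto
  ultimately show ?thesis by simp
qed

text \<open>
  Write \<open>F = \<Sum>i. B i * P i\<close>. At a grid point the \<open>j\<close>-th derivative of \<open>F\<close> is
  \<open>B j\<close> times the nonzero derivative of \<open>P j\<close>, so \<open>B j\<close> vanishes on the grid and the
  vanishing lemma applies again. Averaging with the transpose makes the coefficients symmetric.
\<close>
lemma double_vanishing_in_grid_ideal_square:
  assumes F: "trig_poly F" "\<And>\<omega>. on_grid \<omega> \<Longrightarrow> F \<omega> = 0" "\<And>\<omega> j. on_grid \<omega> \<Longrightarrow> pd j F \<omega> = 0"
  obtains B where "\<And>i l. trig_poly (B i l)" "\<And>i l. B i l = B l i"
    "\<And>\<omega>. F \<omega> = (\<Sum>i\<in>UNIV. \<Sum>l\<in>UNIV. B i l \<omega> * (P i \<omega> * P l \<omega>))"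
proof -
  obtain B where B: "\<And>i. trig_poly (B i)" "\<And>\<omega>. F \<omega> = (\<Sum>i\<in>UNIV. B i \<omega> * P i \<omega>)"
    using vanishing_in_grid_ideal[OF F(1,2)] unfolding in_grid_ideal_def by blast
  have "B j \<omega> = 0" if "on_grid \<omega>" for j \<omega>
  proof -
    have "F = (\<lambda>\<omega>. \<Sum>i\<in>UNIV. B i \<omega> * P i \<omega>)" using B(2) by auto
    then have "pd j F \<omega> = (\<Sum>i\<in>UNIV. pd j (B i) \<omega> * P i \<omega> + B i \<omega> * pd j (P i) \<omega>)"
      using B(1) by (simp add: pd_sum pd_mult trig_poly_mult trig_poly_grid_poly)
    also have "\<dots> = (\<Sum>i\<in>UNIV. if i = j then B j \<omega> * pd j (P j) \<omega> else 0)"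
      using that by (intro sum.cong) (auto simp: P_on_grid pd_P_other)
    also have "\<dots> = B j \<omega> * pd j (P j) \<omega>" by simp
    finally show ?thesis using F(3)[OF that] pd_P_nonzero[OF that] by simp
  qed
  then have "\<forall>j. \<exists>C. (\<forall>l. trig_poly (C l)) \<and> (\<forall>\<omega>. B j \<omega> = (\<Sum>l\<in>UNIV. C l \<omega> * P l \<omega>))"
    using vanishing_in_grid_ideal[OF B(1)] by (simp add: in_grid_ideal_def)
  from choice[OF this] obtain C where C: "\<And>j l. trig_poly (C j l)"
    "\<And>j \<omega>. B j \<omega> = (\<Sum>l\<in>UNIV. C j l \<omega> * P l \<omega>)" by blast
  show ?thesis
  proof (rule that[of "\<lambda>i l \<omega>. 1/2 * (C i l \<omega> + C l i \<omega>)"])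
    fix \<omega>
    have 1: "F \<omega> = (\<Sum>i\<in>UNIV. \<Sum>l\<in>UNIV. C i l \<omega> * (P i \<omega> * P l \<omega>))"
      unfolding B(2) C(2) sum_distrib_right by (intro sum.cong refl) (simp add: mult_ac)
    then have 2: "F \<omega> = (\<Sum>i\<in>UNIV. \<Sum>l\<in>UNIV. C l i \<omega> * (P i \<omega> * P l \<omega>))"
      by (subst sum.swap) (simp add: mult_ac)
    have "F \<omega> = 1/2 * (F \<omega> + F \<omega>)" by simp
    also have "\<dots> = (\<Sum>i\<in>UNIV. \<Sum>l\<in>UNIV. 1/2 * (C i l \<omega> + C l i \<omega>) * (P i \<omega> * P l \<omega>))"
      unfolding sum_distrib_left[of "1/2"] distrib_right mult.assoc
      by (subst 1, subst 2) (simp add: sum.distrib sum_distrib_left distrib_left sum_divide_distrib)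
    finally show "F \<omega> = (\<Sum>i\<in>UNIV. \<Sum>l\<in>UNIV. 1/2 * (C i l \<omega> + C l i \<omega>) * (P i \<omega> * P l \<omega>))" .
  next
    show "trig_poly (\<lambda>\<omega>. 1/2 * (C i l \<omega> + C l i \<omega>))" for i l
      by (intro trig_poly_mult trig_poly_add trig_poly_const C(1))
  qed (simp add: add.commute)
qed

lemma hessian_on_grid:
  assumes B: "\<And>i l. trig_poly (B i l)" "\<And>i l. B i l = B l i"
    and F: "\<And>\<omega>. F \<omega> = (\<Sum>i\<in>UNIV. \<Sum>l\<in>UNIV. B i l \<omega> * (P i \<omega> * P l \<omega>))"
    and \<omega>: "on_grid \<omega>"
  shows "pd i (pd j F) \<omega> = 2 * (pd i (P i) \<omega> * B i j \<omega> * pd j (P j) \<omega>)"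
proof -
  have F': "F = (\<lambda>\<omega>. \<Sum>i\<in>UNIV. \<Sum>l\<in>UNIV. B i l \<omega> * (P i \<omega> * P l \<omega>))" using F by auto
  define D where "D k = pd k (P k) \<omega>" for k
  have D: "pd j (P k) \<omega> = (if k = j then D j else 0)" for j k by (auto simp: pd_P_other D_def)
  note tp = trig_poly_mult trig_poly_grid_poly trig_poly_pd B(1)
  have "pd i (pd j F) \<omega> = (\<Sum>k\<in>UNIV. \<Sum>l\<in>UNIV. pd i (pd j (\<lambda>\<omega>. B k l \<omega> * (P k \<omega> * P l \<omega>))) \<omega>)"
    unfolding F' by (simp add: pd_sum trig_poly_sum tp)
  also have "\<dots> = (\<Sum>k\<in>UNIV. \<Sum>l\<in>UNIV. B k l \<omega> * (pd j (P k) \<omega> * pd i (P l) \<omega> + pd i (P k) \<omega> * pd j (P l) \<omega>))"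
  proof (intro sum.cong refl)
    fix k l
    have "pd i (pd j (\<lambda>\<omega>. B k l \<omega> * (P k \<omega> * P l \<omega>))) \<omega> = B k l \<omega> * pd i (pd j (\<lambda>\<omega>. P k \<omega> * P l \<omega>)) \<omega>"
      using \<omega> by (subst pd_pd_mult) (simp_all add: pd_mult tp P_on_grid)
    also have "pd i (pd j (\<lambda>\<omega>. P k \<omega> * P l \<omega>)) \<omega> = pd j (P k) \<omega> * pd i (P l) \<omega> + pd i (P k) \<omega> * pd j (P l) \<omega>"
      using \<omega> by (subst pd_pd_mult) (simp_all add: tp P_on_grid)
    finally show "pd i (pd j (\<lambda>\<omega>. B k l \<omega> * (P k \<omega> * P l \<omega>))) \<omega> =
      B k l \<omega> * (pd j (P k) \<omega> * pd i (P l) \<omega> + pd i (P k) \<omega> * pd j (P l) \<omega>)" .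
  qed
  also have "\<dots> = (\<Sum>k\<in>UNIV. \<Sum>l\<in>UNIV. if k = j then if l = i then B j i \<omega> * D j * D i else 0 else 0)
      + (\<Sum>k\<in>UNIV. \<Sum>l\<in>UNIV. if k = i then if l = j then B i j \<omega> * D i * D j else 0 else 0)"
    unfolding sum.distrib[symmetric] D by (intro sum.cong) auto
  also have "\<dots> = B j i \<omega> * D j * D i + B i j \<omega> * D i * D j"
  proof -
    have "(\<Sum>k\<in>UNIV. \<Sum>l\<in>UNIV. if k = x then if l = y then c else 0 else 0) = c" for x y :: 'd and c :: complex
    proof -
      have "(\<Sum>l\<in>UNIV. if k = x then if l = y then c else 0 else 0) = (if k = x then c else 0)" for k
        by (cases "k = x") auto
      then show ?thesis by simp
    qed
    then show ?thesis by simp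
  qed
  finally show ?thesis using B(2)[of i j] by (simp add: D_def)
qed

text \<open>
  On the torus \<open>cnj (z - a) = - cnj z * cnj a * (z - a)\<close> whenever \<open>norm a = 1\<close>.
\<close>
lemma cnj_P:
  obtains u where "\<And>i. trig_poly (u i)" "\<And>i \<omega>. cnj (P i \<omega>) = u i \<omega> * P i \<omega>" "\<And>i \<omega>. u i \<omega> * cnj (u i \<omega>) = 1"
proof (rule that[of "\<lambda>i \<omega>. \<Prod>a\<in>Z i. - cnj (torus_exp \<omega> $ i) * cnj a"])
  fix i \<omega>
  have "cnj (torus_exp \<omega> $ i - a) = - cnj (torus_exp \<omega> $ i) * cnj a * (torus_exp \<omega> $ i - a)" if "a \<in> Z i" for a
  proof -
    have "torus_exp \<omega> $ i * cnj (torus_exp \<omega> $ i) = 1" by (simp flip: complex_norm_square)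
    moreover have "a * cnj a = 1" using norm_Z[OF that] by (simp flip: complex_norm_square)
    ultimately show ?thesis by (simp only: complex_cnj_diff) algebra
  qed
  then show "cnj (P i \<omega>) = (\<Prod>a\<in>Z i. - cnj (torus_exp \<omega> $ i) * cnj a) * P i \<omega>"
    unfolding grid_poly_def prod.distrib[symmetric] cnj_prod by (intro prod.cong) auto
  have "norm (\<Prod>a\<in>Z i. - cnj (torus_exp \<omega> $ i) * cnj a) = 1"
    by (simp add: norm_Z norm_mult flip: prod_norm)
  then show "(\<Prod>a\<in>Z i. - cnj (torus_exp \<omega> $ i) * cnj a) * cnj (\<Prod>a\<in>Z i. - cnj (torus_exp \<omega> $ i) * cnj a) = 1"
    by (simp del: cnj_prod flip: complex_norm_square)
qed (intro trig_poly_prod trig_poly_mult trig_poly_minus trig_poly_cnj trig_poly_exp trig_poly_const)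

text \<open>
  From \<open>F = \<Sum>i l. B i l * P i * P l\<close> and \<open>cnj (P i) = u i * P i\<close> with \<open>u i\<close> unimodular one gets the
  coefficients \<open>A i l = B i l * cnj (u i)\<close>. At a grid point let \<open>D i\<close> be the derivative of \<open>P i\<close>. Then
  \<open>2 * D i * B i l * D l\<close> is the Hessian, and \<open>cnj (D i) = u i * D i\<close>, so that in the coordinates
  \<open>w i = D i * y i\<close> the form of \<open>A\<close> is half the Hessian form of \<open>y\<close>. The values of \<open>y\<close> are complex, but the Hessian is real,
  so the form splits into those of the real and the imaginary part.
\<close>
lemma hermitian_form_on_grid:
  assumes F: "trig_poly F" "\<And>\<omega>. F \<omega> \<in> \<real>" "\<forall>\<omega>. on_grid \<omega> \<longrightarrow> F \<omega> = 0" "\<forall>\<omega> j. on_grid \<omega> \<longrightarrow> pd j F \<omega> = 0"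
  shows "\<exists>A. (\<forall>i l. trig_poly (A i l)) \<and>
    (\<forall>\<omega>. F \<omega> = (\<Sum>i\<in>UNIV. \<Sum>l\<in>UNIV. cnj (P i \<omega>) * A i l \<omega> * P l \<omega>)) \<and>
    (\<forall>\<omega> w. on_grid \<omega> \<longrightarrow> positive_definite (hessian (\<lambda>\<omega>. Re (F \<omega>)) \<omega>) \<longrightarrow> (\<exists>i. w i \<noteq> 0) \<longrightarrow>
       Re (\<Sum>i\<in>UNIV. \<Sum>l\<in>UNIV. cnj (w i) * A i l \<omega> * w l) > 0)"
proof -
  obtain B where B: "\<And>i l. trig_poly (B i l)" "\<And>i l. B i l = B l i"
    "\<And>\<omega>. F \<omega> = (\<Sum>i\<in>UNIV. \<Sum>l\<in>UNIV. B i l \<omega> * (P i \<omega> * P l \<omega>))"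
    using double_vanishing_in_grid_ideal_square[OF F(1) F(3)[rule_format] F(4)[rule_format]] by blast
  obtain u where u: "\<And>i. trig_poly (u i)" "\<And>i \<omega>. cnj (P i \<omega>) = u i \<omega> * P i \<omega>" "\<And>i \<omega>. u i \<omega> * cnj (u i \<omega>) = 1"
    using cnj_P by blast
  show ?thesis
  proof (rule exI[of _ "\<lambda>i l \<omega>. B i l \<omega> * cnj (u i \<omega>)"], intro conjI allI impI)
    fix \<omega>
    have eq: "cnj (P i \<omega>) * (B i l \<omega> * cnj (u i \<omega>)) * P l \<omega> = B i l \<omega> * (P i \<omega> * P l \<omega>)" for i l
    proof -
      have "cnj (P i \<omega>) * (B i l \<omega> * cnj (u i \<omega>)) * P l \<omega> = (u i \<omega> * cnj (u i \<omega>)) * (B i l \<omega> * (P i \<omega> * P l \<omega>))"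
        unfolding u(2) by (simp only: mult_ac)
      then show ?thesis by (simp add: u(3))
    qed
    show "F \<omega> = (\<Sum>i\<in>UNIV. \<Sum>l\<in>UNIV. cnj (P i \<omega>) * (B i l \<omega> * cnj (u i \<omega>)) * P l \<omega>)"
      unfolding eq by (rule B(3))
  next
    fix \<omega> and w :: "'d \<Rightarrow> complex"
    assume \<omega>: "on_grid \<omega>" and pd: "positive_definite (hessian (\<lambda>\<omega>. Re (F \<omega>)) \<omega>)" and w: "\<exists>i. w i \<noteq> 0"
    define H where "H = hessian (\<lambda>\<omega>. Re (F \<omega>)) \<omega>"
    define D where "D i = pd i (P i) \<omega>" for i
    define y where "y i = w i / D i" for i
    have D0: "D i \<noteq> 0" for i unfolding D_def by (rule pd_P_nonzero[OF \<omega>])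
    have w_eq: "w i = D i * y i" for i by (simp add: y_def D0)
    have cD: "cnj (D i) * cnj (u i \<omega>) = D i" for i
    proof -
      have "(\<lambda>\<omega>. cnj (P i \<omega>)) = (\<lambda>\<omega>. u i \<omega> * P i \<omega>)" using u(2) by auto
      from arg_cong[OF this, of "\<lambda>g. pd i g \<omega>"] have "cnj (D i) = u i \<omega> * D i"
        using u(1) \<omega> by (simp add: pd_cnj pd_mult trig_poly_grid_poly P_on_grid D_def)
      then have "cnj (D i) * cnj (u i \<omega>) = (u i \<omega> * cnj (u i \<omega>)) * D i" by (simp only: mult_ac)
      then show ?thesis by (simp add: u(3))
    qed
    have H: "D i * B i j \<omega> * D j = of_real (H $ i $ j / 2)" for i j
    proof -
      have "pd i (pd j F) \<omega> \<in> \<real>" by (intro pd_real trig_poly_pd F(1,2))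
      then have "pd i (pd j F) \<omega> = of_real (H $ i $ j)"
        unfolding H_def hessian_Re[OF F(1)] by simp
      then show ?thesis
        unfolding hessian_on_grid[OF B(1,2,3) \<omega>] D_def
        by (metis of_real_divide of_real_numeral nonzero_mult_div_cancel_left zero_neq_numeral)
    qed
    define a b where "a = (\<chi> i. Re (y i))" and "b = (\<chi> i. Im (y i))"
    have form: "Re (cnj (w i) * (B i l \<omega> * cnj (u i \<omega>)) * w l) = (a $ i * H $ i $ l * a $ l + b $ i * H $ i $ l * b $ l) / 2" for i l
    proof -
      have "cnj (w i) * (B i l \<omega> * cnj (u i \<omega>)) * w l = cnj (y i) * ((cnj (D i) * cnj (u i \<omega>)) * B i l \<omega> * D l) * y l"
        by (simp add: w_eq mult_ac)
      also have "\<dots> = cnj (y i) * of_real (H $ i $ l / 2) * y l" by (simp only: cD H)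
      also have "Re \<dots> = (Re (y i) * Re (y l) + Im (y i) * Im (y l)) * (H $ i $ l / 2)"
        by (simp add: distrib_left distrib_right)
      also have "\<dots> = (a $ i * H $ i $ l * a $ l + b $ i * H $ i $ l * b $ l) / 2"
        by (simp add: a_def b_def) (simp add: algebra_simps)
      finally show ?thesis .
    qed
    have quad: "v \<bullet> (H *v v) = (\<Sum>i\<in>UNIV. \<Sum>l\<in>UNIV. v $ i * H $ i $ l * v $ l)" for v
      by (simp add: inner_vec_def matrix_vector_mult_def sum_distrib_left mult.assoc)
    have "Re (\<Sum>i\<in>UNIV. \<Sum>l\<in>UNIV. cnj (w i) * (B i l \<omega> * cnj (u i \<omega>)) * w l) = (a \<bullet> (H *v a) + b \<bullet> (H *v b)) / 2"
      unfolding Re_sum form quad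
      by (simp add: sum.distrib add_divide_distrib sum_divide_distrib)
    moreover have pos: "v \<bullet> (H *v v) > 0" if "v \<noteq> 0" for v
      using pd that unfolding positive_definite_def H_def[symmetric] by blast
    moreover have "v \<bullet> (H *v v) \<ge> 0" for v
      using pos[of v] by (cases "v = 0") auto
    moreover have "a \<noteq> 0 \<or> b \<noteq> 0"
      using w by (auto simp: w_eq D0 a_def b_def vec_eq_iff complex_eq_iff)
    ultimately show "Re (\<Sum>i\<in>UNIV. \<Sum>l\<in>UNIV. cnj (w i) * (B i l \<omega> * cnj (u i \<omega>)) * w l) > 0"
      by (smt (verit) divide_pos_pos)
  qed (intro trig_poly_mult trig_poly_cnj B(1) u(1))
qed

end


section \<open>Sums of squares from positive definite matrices\<close>

inductive sos :: "(real ^ 'd::finite \<Rightarrow> real) \<Rightarrow> bool" where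
  sos_0: "sos (\<lambda>\<omega>. 0)"
| sos_add_square: "sos g \<Longrightarrow> trig_poly h \<Longrightarrow> sos (\<lambda>\<omega>. g \<omega> + (norm (h \<omega>))\<^sup>2)"

lemma sos_add: "sos h \<Longrightarrow> sos g \<Longrightarrow> sos (\<lambda>\<omega>. g \<omega> + h \<omega>)"
  by (induction rule: sos.induct) (auto simp flip: add.assoc intro: sos_add_square)

lemma sos_sum: "(\<And>i. i \<in> S \<Longrightarrow> sos (g i)) \<Longrightarrow> sos (\<lambda>\<omega>. \<Sum>i\<in>S. g i \<omega>)"
  by (induction S rule: infinite_finite_induct) (auto intro: sos_0 sos_add)

lemma sos_imp_sum_of_squares:
  "sos g \<Longrightarrow> \<exists>(m::nat) h. (\<forall>j. trig_poly (h j)) \<and> (\<forall>\<omega>. g \<omega> = (\<Sum>j<m. (norm (h j \<omega>))\<^sup>2))"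
proof (induction rule: sos.induct)
  case sos_0
  show ?case by (intro exI[of _ 0] exI[of _ "\<lambda>j \<omega>. 0"]) auto
next
  case (sos_add_square g h)
  from sos_add_square.IH obtain m :: nat and f where f: "\<forall>j. trig_poly (f j)"
    "\<forall>\<omega>. g \<omega> = (\<Sum>j<m. (norm (f j \<omega>))\<^sup>2)" by (elim exE conjE) (rule that)
  show ?case
  proof (rule exI[of _ "Suc m"], rule exI[of _ "f(m := h)"], intro conjI allI)
    show "trig_poly ((f(m := h)) j)" for j using f(1) sos_add_square.hyps(2) by simp
    show "g \<omega> + (norm (h \<omega>))\<^sup>2 = (\<Sum>j<Suc m. (norm ((f(m := h)) j \<omega>))\<^sup>2)" for \<omega>
      using f(2) by simp
  qed
qed

definition herm_form :: "('n::finite \<Rightarrow> 'n \<Rightarrow> complex) \<Rightarrow> ('n \<Rightarrow> complex) \<Rightarrow> real" where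
  "herm_form A w = Re (\<Sum>k\<in>UNIV. \<Sum>l\<in>UNIV. cnj (w k) * A k l * w l)"

lemma herm_form_scale: "herm_form A (\<lambda>k. c * w k) = (norm c)\<^sup>2 * herm_form A w"
proof -
  have eq: "cnj (c * w k) * A k l * (c * w l) = of_real ((norm c)\<^sup>2) * (cnj (w k) * A k l * w l)" for k l
    unfolding complex_norm_square by (simp add: mult_ac)
  have "herm_form A (\<lambda>k. c * w k) =
      Re (of_real ((norm c)\<^sup>2) * (\<Sum>k\<in>UNIV. \<Sum>l\<in>UNIV. cnj (w k) * A k l * w l))"
    unfolding herm_form_def eq sum_distrib_left ..
  then show ?thesis by (simp only: herm_form_def Re_complex_of_real times_complex.sel Im_complex_of_real)
qed

lemma herm_form_add:
  "herm_form (\<lambda>k l. A k l + B k l) w = herm_form A w + herm_form B w"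
proof -
  have "(\<Sum>k\<in>UNIV. \<Sum>l\<in>UNIV. cnj (w k) * (A k l + B k l) * w l) =
      (\<Sum>k\<in>UNIV. \<Sum>l\<in>UNIV. cnj (w k) * A k l * w l) + (\<Sum>k\<in>UNIV. \<Sum>l\<in>UNIV. cnj (w k) * B k l * w l)"
    unfolding sum.distrib[symmetric] by (intro sum.cong refl) (simp only: distrib_left distrib_right)
  then show ?thesis by (simp only: herm_form_def plus_complex.sel)
qed

lemma herm_form_scaled_matrix: "herm_form (\<lambda>k l. of_real c * A k l) w = c * herm_form A w"
proof -
  have "(\<Sum>k\<in>UNIV. \<Sum>l\<in>UNIV. cnj (w k) * (of_real c * A k l) * w l) =
      of_real c * (\<Sum>k\<in>UNIV. \<Sum>l\<in>UNIV. cnj (w k) * A k l * w l)"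
    unfolding sum_distrib_left by (intro sum.cong refl) (simp only: mult_ac)
  then show ?thesis
    by (simp only: herm_form_def times_complex.sel Re_complex_of_real Im_complex_of_real)
qed

lemma herm_form_sum: "herm_form (\<lambda>k l. \<Sum>t\<in>S. B t k l) w = (\<Sum>t\<in>S. herm_form (B t) w)"
proof (induction S rule: infinite_finite_induct)
  case (insert t S)
  then show ?case by (simp add: herm_form_add)
qed (simp_all add: herm_form_def)

subsection \<open>Cholesky decomposition\<close>

text \<open>
  Cholesky elimination: splitting off the square that involves the pivot \<open>s\<close> leaves the form of the
  Schur complement \<open>H'\<close>, which is again positive definite, as one sees by choosing the coordinate at \<open>s\<close> so
  that the split-off square vanishes. Stating the lemma for the form at \<open>v\<close> instead of for matrices keeps the
  factors out of the statement.
\<close>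
lemma sos_constant_form_aux:
  assumes "finite S" and v: "\<And>k. trig_poly (v k)"
    and "\<And>k l. H l k = cnj (H k l)"
    and "\<And>w. \<exists>k\<in>S. w k \<noteq> 0 \<Longrightarrow> Re (\<Sum>k\<in>S. \<Sum>l\<in>S. cnj (w k) * H k l * w l) > 0"
  shows "sos (\<lambda>\<omega>. Re (\<Sum>k\<in>S. \<Sum>l\<in>S. cnj (v k \<omega>) * H k l * v l \<omega>))"
  using assms(1,3,4)
proof (induction S arbitrary: H)
  case empty
  show ?case using sos_0 by simp
next
  case (insert s S)
  note herm = insert.prems(1) and pos = insert.prems(2)
  define h where "h = Re (H s s)"
  have Hss: "H s s = of_real h"
    using herm[of s s] unfolding h_def by (simp add: complex_eq_iff)
  have "h > 0"
  proof -
    let ?d = "\<lambda>k. if k = s then 1 else 0 :: complex"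
    have "(\<Sum>k\<in>insert s S. \<Sum>l\<in>insert s S. cnj (?d k) * H k l * ?d l) = (\<Sum>k\<in>insert s S. if k = s then H s s else 0)"
    proof (intro sum.cong refl)
      fix k
      have "(\<Sum>l\<in>insert s S. cnj (?d k) * H k l * ?d l) = (\<Sum>l\<in>insert s S. if l = s then cnj (?d k) * H k s else 0)"
        by (intro sum.cong) auto
      then show "(\<Sum>l\<in>insert s S. cnj (?d k) * H k l * ?d l) = (if k = s then H s s else 0)"
        using insert.hyps by (simp only: sum.delta finite.insertI) simp
    qed
    also have "\<dots> = H s s" using insert.hyps by (simp only: sum.delta finite.insertI) simp
    finally show ?thesis using pos[of ?d] by (simp only: h_def) simp
  qed
  define L where "L w = (\<Sum>l\<in>S. H s l * w l)" for w
  \<comment> \<open>The Schur complement of the pivot.\<close>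
  define H' where "H' k l = H k l - H k s * H s l / of_real h" for k l
  have split: "Re (\<Sum>k\<in>insert s S. \<Sum>l\<in>insert s S. cnj (w k) * H k l * w l)
      = (norm (of_real (sqrt h) * (w s + L w / of_real h)))\<^sup>2 + Re (\<Sum>k\<in>S. \<Sum>l\<in>S. cnj (w k) * H' k l * w l)" for w
  proof -
    have cL: "cnj (L w) = (\<Sum>k\<in>S. cnj (w k) * H k s)"
      unfolding L_def by (simp add: herm[of s] mult.commute)
    have "(\<Sum>k\<in>S. \<Sum>l\<in>S. cnj (w k) * H' k l * w l)
        = (\<Sum>k\<in>S. \<Sum>l\<in>S. cnj (w k) * H k l * w l) - (\<Sum>k\<in>S. \<Sum>l\<in>S. (cnj (w k) * H k s) * (H s l * w l)) / of_real h"
      unfolding H'_def sum_divide_distrib sum_subtractf[symmetric]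
      by (intro sum.cong refl) (simp add: field_simps)
    also have "(\<Sum>k\<in>S. \<Sum>l\<in>S. (cnj (w k) * H k s) * (H s l * w l)) = cnj (L w) * L w"
      unfolding cL by (simp only: L_def sum_product)
    finally have 1: "(\<Sum>k\<in>S. \<Sum>l\<in>S. cnj (w k) * H' k l * w l)
        = (\<Sum>k\<in>S. \<Sum>l\<in>S. cnj (w k) * H k l * w l) - cnj (L w) * L w / of_real h" .
    have "(\<Sum>k\<in>insert s S. \<Sum>l\<in>insert s S. cnj (w k) * H k l * w l)
        = cnj (w s) * H s s * w s + cnj (w s) * L w + cnj (L w) * w s + (\<Sum>k\<in>S. \<Sum>l\<in>S. cnj (w k) * H k l * w l)"
      unfolding cL using insert.hyps
      by (simp add: sum.distrib L_def sum_distrib_left sum_distrib_right mult.assoc)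
    also have "\<dots> = of_real ((norm (of_real (sqrt h) * (w s + L w / of_real h)))\<^sup>2) + (\<Sum>k\<in>S. \<Sum>l\<in>S. cnj (w k) * H' k l * w l)"
    proof -
      have "of_real ((norm (of_real (sqrt h) * (w s + L w / of_real h)))\<^sup>2) = of_real h * ((w s + L w / of_real h) * cnj (w s + L w / of_real h))"
      proof -
        have "(norm (of_real (sqrt h) * z))\<^sup>2 = h * (norm z)\<^sup>2" for z :: complex
          using \<open>h > 0\<close> by (simp add: norm_mult power_mult_distrib)
        then show ?thesis by (simp only: of_real_mult complex_norm_square)
      qed
      also have "\<dots> = cnj (w s) * of_real h * w s + cnj (w s) * L w + cnj (L w) * w s + cnj (L w) * L w / of_real h"
        using \<open>h > 0\<close> by (simp add: field_simps)
      finally show ?thesis unfolding 1 Hss by simp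
    qed
    finally show ?thesis by (simp only: plus_complex.sel Re_complex_of_real)
  qed
  have "sos (\<lambda>\<omega>. Re (\<Sum>k\<in>S. \<Sum>l\<in>S. cnj (v k \<omega>) * H' k l * v l \<omega>))"
  proof (rule insert.IH)
    show "H' l k = cnj (H' k l)" for k l
      unfolding H'_def by (simp add: herm[of k l] herm[of s l] herm[of k s] mult.commute)
  next
    fix w :: "'a \<Rightarrow> complex" assume w: "\<exists>k\<in>S. w k \<noteq> 0"
    let ?w = "w(s := - L w / of_real h)"
    have L: "L ?w = L w" unfolding L_def using insert.hyps by (intro sum.cong) auto
    have eq: "(\<Sum>k\<in>S. \<Sum>l\<in>S. cnj (?w k) * H' k l * ?w l) = (\<Sum>k\<in>S. \<Sum>l\<in>S. cnj (w k) * H' k l * w l)"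
      using insert.hyps by (intro sum.cong) auto
    have zero: "of_real (sqrt h) * (?w s + L ?w / of_real h) = 0" unfolding L by simp
    have "\<exists>k\<in>insert s S. ?w k \<noteq> 0" using w insert.hyps by auto
    then have "0 < Re (\<Sum>k\<in>insert s S. \<Sum>l\<in>insert s S. cnj (?w k) * H k l * ?w l)" by (rule pos)
    then show "Re (\<Sum>k\<in>S. \<Sum>l\<in>S. cnj (w k) * H' k l * w l) > 0"
      unfolding split zero eq by simp
  qed
  then have "sos (\<lambda>\<omega>. Re (\<Sum>k\<in>S. \<Sum>l\<in>S. cnj (v k \<omega>) * H' k l * v l \<omega>) +
      (norm (of_real (sqrt h) * (v s \<omega> + L (\<lambda>k. v k \<omega>) / of_real h)))\<^sup>2)"
    unfolding L_def divide_inverse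
    by (intro sos_add_square trig_poly_mult trig_poly_add trig_poly_const trig_poly_sum v) auto
  then show ?case unfolding split by (simp only: add.commute)
qed

text \<open>
  Only the hermitian part of \<open>H\<close> enters the real part of the form.
\<close>
lemma sos_constant_form:
  assumes v: "\<And>k. trig_poly (v k)" and pos: "\<And>w. \<exists>k. w k \<noteq> 0 \<Longrightarrow> herm_form H w > 0"
  shows "sos (\<lambda>\<omega>. herm_form H (\<lambda>k. v k \<omega>))"
proof -
  define H' where "H' k l = (H k l + cnj (H l k)) / 2" for k l
  have eq: "herm_form H w = Re (\<Sum>k\<in>UNIV. \<Sum>l\<in>UNIV. cnj (w k) * H' k l * w l)" for w
  proof -
    have "herm_form H w = Re (\<Sum>k\<in>UNIV. \<Sum>l\<in>UNIV. cnj (w l) * H l k * w k)"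
      unfolding herm_form_def by (subst sum.swap) simp
    also have "\<dots> = (\<Sum>k\<in>UNIV. \<Sum>l\<in>UNIV. Re (cnj (w k) * cnj (H l k) * w l))"
      unfolding Re_sum by (intro sum.cong refl) (simp add: algebra_simps)
    finally have 1: "herm_form H w = (\<Sum>k\<in>UNIV. \<Sum>l\<in>UNIV. Re (cnj (w k) * cnj (H l k) * w l))" .
    have "2 * herm_form H w = (\<Sum>k\<in>UNIV. \<Sum>l\<in>UNIV. Re (cnj (w k) * H k l * w l)) + (\<Sum>k\<in>UNIV. \<Sum>l\<in>UNIV. Re (cnj (w k) * cnj (H l k) * w l))"
      using 1 by (simp add: herm_form_def)
    also have "\<dots> = (\<Sum>k\<in>UNIV. \<Sum>l\<in>UNIV. 2 * Re (cnj (w k) * H' k l * w l))"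
      unfolding sum.distrib[symmetric] H'_def by (intro sum.cong refl) (simp add: field_simps)
    also have "\<dots> = 2 * Re (\<Sum>k\<in>UNIV. \<Sum>l\<in>UNIV. cnj (w k) * H' k l * w l)"
      by (simp add: sum_distrib_left)
    finally show ?thesis by simp
  qed
  show ?thesis unfolding eq
    by (rule sos_constant_form_aux) (use pos in \<open>auto simp: v eq H'_def\<close>)
qed

subsection \<open>Compactness\<close>

lemma torus_exp_fundamental_cube:
  obtains \<omega>' where "\<omega>' \<in> cbox 0 (\<chi> i. 2 * pi)" "torus_exp \<omega>' = torus_exp \<omega>"
proof (rule that[of "\<chi> i. 2 * pi * frac (\<omega> $ i / (2 * pi))"])
  have "0 \<le> frac x" "frac x \<le> 1" for x :: real using frac_lt_1[of x] by (auto simp: less_imp_le)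
  then show "(\<chi> i. 2 * pi * frac (\<omega> $ i / (2 * pi))) \<in> cbox 0 (\<chi> i. 2 * pi)"
    by (auto simp: mem_box_cart mult_left_le)
  have "exp (- \<i> * complex_of_real (2 * pi * frac (\<omega> $ i / (2 * pi)))) = exp (- \<i> * complex_of_real (\<omega> $ i))" for i
  proof -
    have "2 * pi * frac (\<omega> $ i / (2 * pi)) = \<omega> $ i - 2 * pi * \<lfloor>\<omega> $ i / (2 * pi)\<rfloor>"
      by (simp add: frac_def field_simps)
    then have "- \<i> * complex_of_real (2 * pi * frac (\<omega> $ i / (2 * pi))) =
        - \<i> * complex_of_real (\<omega> $ i) + (of_int (2 * \<lfloor>\<omega> $ i / (2 * pi)\<rfloor>) * pi) * \<i>"
      by (simp only: of_real_diff) (simp add: algebra_simps)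
    then show ?thesis by (simp only: exp_eq) blast
  qed
  then show "torus_exp (\<chi> i. 2 * pi * frac (\<omega> $ i / (2 * pi))) = torus_exp \<omega>"
    by (simp add: torus_exp_def)
qed

lemma continuous_on_herm_form:
  assumes "\<And>k l. continuous_on S (A k l)" "\<And>k. continuous_on S (v k)"
  shows "continuous_on S (\<lambda>x. herm_form (\<lambda>k l. A k l x) (\<lambda>k. v k x))"
  unfolding herm_form_def by (intro continuous_intros assms)

lemma herm_form_perturb:
  assumes "\<And>k l. norm (B k l - A k l) \<le> d k l" "norm w = 1"
  shows "herm_form B (vec_nth w) \<ge> herm_form A (vec_nth w) - (\<Sum>k\<in>UNIV. \<Sum>l\<in>UNIV. d k l)"
proof -
  have "herm_form A (vec_nth w) - herm_form B (vec_nth w) = Re (\<Sum>k\<in>UNIV. \<Sum>l\<in>UNIV. cnj (w $ k) * (A k l - B k l) * w $ l)"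
    unfolding herm_form_def by (simp only: minus_complex.sel(1)[symmetric] sum_subtractf[symmetric])
      (simp only: algebra_simps)
  also have "\<dots> \<le> norm (\<Sum>k\<in>UNIV. \<Sum>l\<in>UNIV. cnj (w $ k) * (A k l - B k l) * w $ l)" by (rule complex_Re_le_cmod)
  also have "\<dots> \<le> (\<Sum>k\<in>UNIV. \<Sum>l\<in>UNIV. d k l)"
  proof (intro sum_norm_le)
    fix k l
    have w: "norm (w $ k) \<le> 1" for k using Finite_Cartesian_Product.norm_nth_le[of w k] assms(2) by simp
    have "norm (cnj (w $ k) * (A k l - B k l) * w $ l) = norm (w $ k) * norm (w $ l) * norm (B k l - A k l)"
      by (simp add: norm_mult norm_minus_commute)
    also have "\<dots> \<le> 1 * 1 * d k l" by (intro mult_mono w assms(1)) auto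
    finally show "norm (cnj (w $ k) * (A k l - B k l) * w $ l) \<le> d k l" by simp
  qed
  finally show ?thesis by simp
qed

lemma herm_form_pos_if_pos_on_sphere:
  assumes B: "\<And>u. norm u = 1 \<Longrightarrow> herm_form B (vec_nth u) > 0" and w: "\<exists>k. w k \<noteq> 0"
  shows "herm_form B w > 0"
proof -
  define W where "W = (\<chi> k. w k)"
  have W: "norm W > 0" using w by (auto simp: W_def vec_eq_iff)
  define u where "u = (1 / norm W) *\<^sub>R W"
  have u: "norm u = 1" using W by (simp add: u_def)
  have w_eq: "w = (\<lambda>k. of_real (norm W) * u $ k)"
  proof
    fix k
    have "norm W *\<^sub>R u = W" using W by (simp add: u_def)
    then have "norm W *\<^sub>R (u $ k) = w k" by (metis W_def vec_lambda_beta vector_scaleR_component)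
    then show "w k = of_real (norm W) * u $ k" by (simp only: scaleR_conv_of_real)
  qed
  show ?thesis unfolding w_eq herm_form_scale using W B[OF u] by simp
qed

text \<open>
  On the compact part of \<open>K\<close> where \<open>a\<close> is not positive, \<open>b\<close> has a positive minimum and \<open>a\<close> is
  bounded below.
\<close>
lemma compact_penalty:
  fixes a b :: "'x::heine_borel \<Rightarrow> real"
  assumes K: "compact K" and cont: "continuous_on K a" "continuous_on K b"
    and b: "\<And>x. x \<in> K \<Longrightarrow> b x \<ge> 0" and ab: "\<And>x. x \<in> K \<Longrightarrow> b x = 0 \<Longrightarrow> a x > 0"
  shows "\<exists>c. \<forall>x\<in>K. a x + c * b x > 0"
proof (cases "{x \<in> K. a x \<le> 0} = {}")
  case True
  then show ?thesis by (intro exI[of _ 0]) auto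
next
  case False
  let ?L = "{x \<in> K. a x \<le> 0}"
  have "closed ?L" using continuous_closed_preimage[OF cont(1) compact_imp_closed[OF K], of "{..0}"]
    by (simp add: vimage_def Int_def)
  then have "compact (K \<inter> ?L)" by (rule compact_Int_closed[OF K])
  moreover have "K \<inter> ?L = ?L" by auto
  ultimately have L: "compact ?L" by simp
  obtain x0 where x0: "x0 \<in> ?L" "\<And>x. x \<in> ?L \<Longrightarrow> b x0 \<le> b x"
    using continuous_attains_inf[OF L False continuous_on_subset[OF cont(2)]] by auto
  obtain x1 where x1: "x1 \<in> ?L" "\<And>x. x \<in> ?L \<Longrightarrow> a x1 \<le> a x"
    using continuous_attains_inf[OF L False continuous_on_subset[OF cont(1)]] by auto
  have pos: "b x0 > 0" using b[of x0] ab[of x0] x0(1) by (cases "b x0 = 0") auto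
  \<comment> \<open>The numerator \<open>1\<close> leaves a margin above the minimum of \<open>a\<close>.\<close>
  define c where "c = (1 - a x1) / b x0"
  have "c \<ge> 0" using pos x1(1) by (simp add: c_def)
  have "a x + c * b x > 0" if "x \<in> K" for x
  proof (cases "a x \<le> 0")
    case True
    then have "c * b x \<ge> c * b x0" using that x0(2)[of x] \<open>c \<ge> 0\<close> by (intro mult_left_mono) auto
    moreover have "c * b x0 = 1 - a x1" using pos by (simp add: c_def)
    ultimately show ?thesis using x1(2)[of x] True that by auto
  next
    case False
    then show ?thesis using b[OF that] \<open>c \<ge> 0\<close> by (simp add: add_pos_nonneg)
  qed
  then show ?thesis by blast
qed

lemma herm_form_uniformly_positive:
  fixes A :: "'n::finite \<Rightarrow> 'n \<Rightarrow> real ^ 'd::finite \<Rightarrow> complex"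
  assumes A: "\<And>k l. trig_poly (A k l)"
    and pos: "\<And>\<omega> w. \<exists>k. w k \<noteq> 0 \<Longrightarrow> herm_form (\<lambda>k l. A k l \<omega>) w > 0"
  shows "\<exists>e>0. \<forall>\<omega> w. norm w = 1 \<longrightarrow> herm_form (\<lambda>k l. A k l \<omega>) (vec_nth w) \<ge> e"
proof -
  let ?K = "cbox 0 (\<chi> i. 2 * pi) \<times> sphere 0 1 :: ((real ^ 'd) \<times> (complex ^ 'n)) set"
  let ?g = "\<lambda>x :: (real ^ 'd) \<times> (complex ^ 'n). herm_form (\<lambda>k l. A k l (fst x)) (\<lambda>k. snd x $ k)"
  have K: "compact ?K" by (intro compact_Times) auto
  have "axis undefined 1 \<in> sphere (0::complex ^ 'n) 1" by (simp add: norm_axis_1)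
  moreover have "(0 :: real ^ 'd) \<in> cbox 0 (\<chi> i. 2 * pi)" by (simp add: mem_box_cart)
  ultimately have ne: "?K \<noteq> {}" by blast
  have cont: "continuous_on ?K ?g"
    by (intro continuous_on_herm_form continuous_on_compose2[OF trig_poly_continuous[OF A, of UNIV]] continuous_intros) auto
  obtain x0 where x0: "x0 \<in> ?K" "\<And>x. x \<in> ?K \<Longrightarrow> ?g x0 \<le> ?g x"
    using continuous_attains_inf[OF K ne cont] by auto
  define m where "m = ?g x0"
  have "snd x0 \<noteq> 0" using x0(1) by auto
  then have "\<exists>k. snd x0 $ k \<noteq> 0" by (simp add: vec_eq_iff)
  then have "m > 0" unfolding m_def by (rule pos)
  have lower: "m \<le> herm_form (\<lambda>k l. A k l \<omega>) (\<lambda>k. w $ k)" if "norm w = 1" for w :: "complex ^ 'n" and \<omega>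
  proof -
    obtain \<omega>' where \<omega>': "\<omega>' \<in> cbox 0 (\<chi> i. 2 * pi)" "torus_exp \<omega>' = torus_exp \<omega>"
      by (rule torus_exp_fundamental_cube)
    have "A k l \<omega> = A k l \<omega>'" for k l by (intro trig_poly_periodic A) (simp add: \<omega>')
    then show ?thesis using x0(2)[of "(\<omega>', w)"] \<omega>' that unfolding m_def by simp
  qed
  show ?thesis
  proof (intro exI conjI allI impI)
    show "m > 0" by fact
    show "m \<le> herm_form (\<lambda>k l. A k l \<omega>) (\<lambda>k. w $ k)" if "norm w = 1" for w :: "complex ^ 'n" and \<omega>
      using that by (rule lower)
  qed
qed


subsection \<open>Averaging against the Fejer kernel\<close>

definition dirichlet :: "nat \<Rightarrow> real ^ 'd::finite \<Rightarrow> complex" where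
  "dirichlet n \<omega> = (\<Sum>j\<in>exp_box n. torus_char j \<omega>)"

text \<open>
  The coefficient of the character \<open>x\<close> in \<open>(norm (dirichlet n))^2\<close>, the unnormalised Fejer kernel.
\<close>
definition fejer_weight :: "nat \<Rightarrow> int ^ 'd::finite \<Rightarrow> nat" where
  "fejer_weight n x = card {(j, j'). j \<in> exp_box n \<and> j' \<in> exp_box n \<and> j - j' = x}"

lemma finite_fejer_pairs: "finite {(j, j'). j \<in> exp_box n \<and> j' \<in> exp_box n \<and> j - j' = (x :: int ^ 'd::finite)}"
  by (rule finite_subset[of _ "exp_box n \<times> exp_box n"]) auto

lemma fejer_weight_le: "fejer_weight n (x :: int ^ 'd::finite) \<le> n ^ CARD('d)"
proof -
  have "fejer_weight n x \<le> card (exp_box n :: (int ^ 'd) set)"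
    unfolding fejer_weight_def by (rule card_inj_on_le[of snd]) (auto simp: inj_on_def algebra_simps)
  then show ?thesis by (simp add: card_exp_box)
qed

text \<open>
  The pairs \<open>(j + D, j + D - x)\<close> with \<open>j\<close> in the smaller box are among those counted; adding \<open>D\<close>
  keeps both components inside the larger box.
\<close>
lemma fejer_weight_ge:
  fixes x :: "int ^ 'd::finite"
  assumes x: "\<And>i. \<bar>x $ i\<bar> \<le> int D"
  shows "n ^ CARD('d) \<le> fejer_weight (n + 2 * D) x"
proof -
  let ?f = "\<lambda>j :: int ^ 'd. (j + (\<chi> i. int D), j + (\<chi> i. int D) - x)"
  have "card (exp_box n :: (int ^ 'd) set) \<le> fejer_weight (n + 2 * D) x"
    unfolding fejer_weight_def
  proof (rule card_inj_on_le[of ?f])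
    show "?f ` exp_box n \<subseteq> {(j, j'). j \<in> exp_box (n + 2 * D) \<and> j' \<in> exp_box (n + 2 * D) \<and> j - j' = x}"
    proof clarsimp
      fix j :: "int ^ 'd" assume j: "j \<in> exp_box n"
      have "0 \<le> j $ i + int D" "j $ i + int D < int n + 2 * int D"
           "0 \<le> j $ i + int D - x $ i" "j $ i + int D - x $ i < int n + 2 * int D" for i
      proof -
        have "0 \<le> j $ i" "j $ i < int n" using j by (auto simp: exp_box_def)
        with x[of i] show "0 \<le> j $ i + int D" "j $ i + int D < int n + 2 * int D"
           "0 \<le> j $ i + int D - x $ i" "j $ i + int D - x $ i < int n + 2 * int D" by linarith+
      qed
      then show "j + (\<chi> i. int D) \<in> exp_box (n + 2 * D) \<and> j + (\<chi> i. int D) - x \<in> exp_box (n + 2 * D)"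
        by (simp add: exp_box_def)
    qed
  qed (auto simp: inj_on_def finite_fejer_pairs)
  then show ?thesis by (simp add: card_exp_box)
qed

text \<open>
  Convolution with the Fejer kernel multiplies a character by its weight. All frequencies of the product
  are below the number \<open>n + D\<close> of nodes per coordinate, so the integral over the torus may be replaced by
  the sum over the nodes.
\<close>
lemma fejer_quadrature:
  fixes x :: "int ^ 'd::finite"
  assumes x: "\<And>i. \<bar>x $ i\<bar> \<le> int D"
  shows "(\<Sum>t\<in>exp_box (n + D). torus_char x (node (n + D) t) * of_real ((norm (dirichlet n (\<omega> - node (n + D) t)))\<^sup>2))
       = of_nat ((n + D) ^ CARD('d)) * of_nat (fejer_weight n x) * torus_char x \<omega>"
proof -
  let ?N = "n + D"
  let ?B = "exp_box n :: (int ^ 'd) set"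
  have char_diff: "torus_char j (\<omega> - y) = torus_char j \<omega> * torus_char (- j) y" for j and y :: "real ^ 'd"
  proof -
    have "torus_char j (\<omega> - y) * torus_char j y * torus_char (- j) y = torus_char j \<omega> * torus_char (- j) y"
      using torus_char_translate[of j "\<omega> - y" y] by simp
    then show ?thesis by (simp add: mult.assoc flip: torus_char_add)
  qed
  have sq: "of_real ((norm (dirichlet n (\<omega> - y)))\<^sup>2) = (\<Sum>(j, j')\<in>?B \<times> ?B. torus_char (j - j') \<omega> * torus_char (- (j - j')) y)" for y
  proof -
    have "of_real ((norm (dirichlet n (\<omega> - y)))\<^sup>2) = (\<Sum>(j, j')\<in>?B \<times> ?B. torus_char (j - j') (\<omega> - y))"
      unfolding complex_norm_square dirichlet_def cnj_sum sum_product
      by (simp add: sum.cartesian_product torus_char_add[of _ "- _", simplified] torus_char_minus)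
    then show ?thesis by (simp only: char_diff)
  qed
  have "(\<Sum>t\<in>exp_box ?N. torus_char x (node ?N t) * of_real ((norm (dirichlet n (\<omega> - node ?N t)))\<^sup>2))
     = (\<Sum>t\<in>exp_box ?N. \<Sum>(j, j')\<in>?B \<times> ?B. torus_char (j - j') \<omega> * torus_char (x - (j - j')) (node ?N t))"
    unfolding sq sum_distrib_left
    by (intro sum.cong refl) (auto simp: torus_char_add[of x "- _", simplified] mult_ac)
  also have "\<dots> = (\<Sum>(j, j')\<in>?B \<times> ?B. torus_char (j - j') \<omega> * (\<Sum>t\<in>exp_box ?N. torus_char (x - (j - j')) (node ?N t)))"
    unfolding sum_distrib_left by (subst sum.swap) (simp add: case_prod_unfold)
  also have "\<dots> = (\<Sum>(j, j')\<in>?B \<times> ?B. if j - j' = x then of_nat (?N ^ CARD('d)) * torus_char x \<omega> else 0)"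
  proof (intro sum.cong refl, clarify)
    fix j j' :: "int ^ 'd" assume j: "j \<in> ?B" "j' \<in> ?B"
    have "\<bar>(x - (j - j')) $ i\<bar> < int ?N" for i
    proof -
      have "0 \<le> j $ i" "j $ i < int n" "0 \<le> j' $ i" "j' $ i < int n" using j by (auto simp: exp_box_def)
      with x[of i] show ?thesis by simp
    qed
    then have "(\<Sum>t\<in>exp_box ?N. torus_char (x - (j - j')) (node ?N t)) = (if x - (j - j') = 0 then of_nat (?N ^ CARD('d)) else 0)"
      by (rule sum_nodes_char_small)
    then show "torus_char (j - j') \<omega> * (\<Sum>t\<in>exp_box ?N. torus_char (x - (j - j')) (node ?N t))
        = (if j - j' = x then of_nat (?N ^ CARD('d)) * torus_char x \<omega> else 0)"
      by (cases "j - j' = x") auto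
  qed
  also have "\<dots> = (\<Sum>a\<in>{(j, j'). j \<in> ?B \<and> j' \<in> ?B \<and> j - j' = x}. of_nat (?N ^ CARD('d)) * torus_char x \<omega>)"
    by (rule sum.mono_neutral_cong_right) (auto split: if_splits)
  finally show ?thesis by (simp add: fejer_weight_def)
qed

lemma fejer_weight_ratio:
  fixes K :: "(int ^ 'd::finite) set"
  assumes K: "\<And>k i. k \<in> K \<Longrightarrow> \<bar>k $ i\<bar> \<le> int D" and e: "(e::real) > 0"
  shows "\<exists>n>0. \<forall>x\<in>K. fejer_weight n x > 0 \<and> \<bar>real (n ^ CARD('d)) / real (fejer_weight n x) - 1\<bar> < e"
proof -
  have "(\<lambda>t. (1 + real (2 * D) / real t) ^ CARD('d)) \<longlonglongrightarrow> (1 + 0) ^ CARD('d)"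
    by (intro tendsto_intros lim_const_over_n)
  then have "eventually (\<lambda>t. dist ((1 + real (2 * D) / real t) ^ CARD('d)) ((1 + 0) ^ CARD('d)) < e) sequentially"
    using e by (rule tendstoD)
  then have "eventually (\<lambda>t. t > 0 \<and> dist ((1 + real (2 * D) / real t) ^ CARD('d)) ((1 + 0) ^ CARD('d)) < e) sequentially"
    using eventually_gt_at_top[of 0] by eventually_elim auto
  then obtain t where t: "t > 0" "\<bar>(1 + real (2 * D) / real t) ^ CARD('d) - 1\<bar> < e"
    by (auto simp: eventually_sequentially dist_real_def)
  define n where "n = t + 2 * D"
  show ?thesis
  proof (intro exI[of _ n] conjI ballI)
    show "n > 0" using t by (simp add: n_def)
    fix x assume x: "x \<in> K"
    have ge: "t ^ CARD('d) \<le> fejer_weight n x" unfolding n_def by (intro fejer_weight_ge K x)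
    moreover have "t ^ CARD('d) > 0" using t by simp
    ultimately show pos: "fejer_weight n x > 0" by linarith
    have "1 \<le> real (n ^ CARD('d)) / real (fejer_weight n x)"
      using pos fejer_weight_le[of n x] by (simp add: le_divide_eq del: of_nat_power)
    moreover have "real (n ^ CARD('d)) / real (fejer_weight n x) \<le> real (n ^ CARD('d)) / real (t ^ CARD('d))"
      using ge t pos by (intro divide_left_mono) (auto simp del: of_nat_power)
    moreover have "real (n ^ CARD('d)) / real (t ^ CARD('d)) = (1 + real (2 * D) / real t) ^ CARD('d)"
    proof -
      have "1 + real (2 * D) / real t = real n / real t" using t by (simp add: n_def field_simps)
      then show ?thesis by (simp add: power_divide)
    qed
    ultimately show "\<bar>real (n ^ CARD('d)) / real (fejer_weight n x) - 1\<bar> < e" using t(2) by linarith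
  qed
qed

text \<open>
  Dividing the coefficients of \<open>A\<close> by the normalised Fejer weights gives a matrix \<open>A'\<close> whose Fejer average is
  \<open>A\<close>. The weights tend to \<open>1\<close> on the finitely many frequencies of \<open>A\<close>, so \<open>A'\<close> is close to
  \<open>A\<close> and still positive definite. The quadrature formula then expresses \<open>A\<close> through the constant
  matrices \<open>A'\<close> at the nodes, each multiplied by the square of a Dirichlet kernel.
\<close>
theorem sos_positive_definite_form:
  fixes A :: "'n::finite \<Rightarrow> 'n \<Rightarrow> real ^ 'd::finite \<Rightarrow> complex"
  assumes A: "\<And>k l. trig_poly (A k l)"
    and pos: "\<And>\<omega> w. \<exists>k. w k \<noteq> 0 \<Longrightarrow> herm_form (\<lambda>k l. A k l \<omega>) w > 0"
    and v: "\<And>k. trig_poly (v k)"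
  shows "sos (\<lambda>\<omega>. herm_form (\<lambda>k l. A k l \<omega>) (\<lambda>k. v k \<omega>))"
proof -
  obtain e where e: "e > 0" "\<And>\<omega> w. norm w = 1 \<Longrightarrow> e \<le> herm_form (\<lambda>k l. A k l \<omega>) (vec_nth w)"
    using herm_form_uniformly_positive[OF A pos] by blast
  have "\<forall>k. \<forall>l. \<exists>p. A k l = on_torus p" using A by (auto simp: trig_poly_def)
  then obtain p where p: "\<And>k l. A k l = on_torus (p k l)" by metis
  define K where "K = (\<Union>k. \<Union>l. Poly_Mapping.keys (p k l))"
  define c where "c k l x = Poly_Mapping.lookup (p k l) x" for k l x
  have finK: "finite K" by (simp add: K_def)
  have A_eq: "A k l \<omega> = (\<Sum>x\<in>K. c k l x * torus_char x \<omega>)" for k l \<omega>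
    unfolding p c_def by (rule on_torus_superset[OF finK]) (auto simp: K_def)
  obtain D where D: "\<And>k i. k \<in> K \<Longrightarrow> \<bar>k $ i\<bar> \<le> int D"
    using finite_exponents_bounded[OF finK] by auto
  define T where "T = (\<Sum>k\<in>UNIV. \<Sum>l\<in>UNIV. \<Sum>x\<in>K. norm (c k l x))"
  have T: "T \<ge> 0" unfolding T_def by (intro sum_nonneg) auto
  \<comment> \<open>Relative errors below \<open>\<delta>\<close> in the coefficients change the form on unit vectors by at most \<open>T * \<delta> < e\<close>.\<close>
  define \<delta> where "\<delta> = e / (2 * (T + 1))"
  have \<delta>: "\<delta> > 0" using e(1) T by (simp add: \<delta>_def)
  obtain n where n: "n > 0" "\<And>x. x \<in> K \<Longrightarrow> fejer_weight n x > 0"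
     "\<And>x. x \<in> K \<Longrightarrow> \<bar>real (n ^ CARD('d)) / real (fejer_weight n x) - 1\<bar> < \<delta>"
    using fejer_weight_ratio[of K D \<delta>, OF D \<delta>] by blast
  define r where "r x = real (n ^ CARD('d)) / real (fejer_weight n x)" for x :: "int ^ 'd"
  define A' where "A' k l \<omega> = (\<Sum>x\<in>K. c k l x * of_real (r x) * torus_char x \<omega>)" for k l \<omega>
  have diff: "norm (A' k l \<omega> - A k l \<omega>) \<le> (\<Sum>x\<in>K. norm (c k l x)) * \<delta>" for k l \<omega>
  proof -
    have "A' k l \<omega> - A k l \<omega> = (\<Sum>x\<in>K. c k l x * of_real (r x - 1) * torus_char x \<omega>)"
      unfolding A'_def A_eq by (simp add: sum_subtractf[symmetric] algebra_simps)
    also have "norm \<dots> \<le> (\<Sum>x\<in>K. norm (c k l x) * \<delta>)"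
    proof (intro sum_norm_le)
      fix x assume "x \<in> K"
      then have "\<bar>r x - 1\<bar> \<le> \<delta>" using n(3)[of x] by (simp add: r_def)
      then show "norm (c k l x * of_real (r x - 1) * torus_char x \<omega>) \<le> norm (c k l x) * \<delta>"
        by (simp only: norm_mult norm_torus_char norm_of_real mult_1_right) (intro mult_left_mono, auto)
    qed
    finally show ?thesis by (simp add: sum_distrib_right)
  qed
  have pos_sphere: "herm_form (\<lambda>k l. A' k l \<omega>) (vec_nth u) > 0" if u: "norm u = 1" for \<omega> u
  proof -
    have "herm_form (\<lambda>k l. A' k l \<omega>) (vec_nth u) \<ge> herm_form (\<lambda>k l. A k l \<omega>) (vec_nth u) - (\<Sum>k\<in>UNIV. \<Sum>l\<in>UNIV. (\<Sum>x\<in>K. norm (c k l x)) * \<delta>)"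
      by (intro herm_form_perturb diff u)
    also have "(\<Sum>k\<in>UNIV. \<Sum>l\<in>UNIV. (\<Sum>x\<in>K. norm (c k l x)) * \<delta>) = T * \<delta>"
      by (simp add: T_def sum_distrib_right)
    finally have "herm_form (\<lambda>k l. A' k l \<omega>) (vec_nth u) \<ge> e - T * \<delta>" using e(2)[OF u, of \<omega>] by linarith
    moreover have "T * \<delta> < e"
    proof -
      have "T * e < e * (2 * (T + 1))" using mult_nonneg_nonneg[OF T less_imp_le[OF e(1)]] e(1) by (simp add: algebra_simps)
      then show ?thesis using T by (simp add: \<delta>_def divide_less_eq)
    qed
    ultimately show ?thesis by linarith
  qed
  have pos': "herm_form (\<lambda>k l. A' k l \<omega>) w > 0" if "\<exists>k. w k \<noteq> 0" for \<omega> w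
    using herm_form_pos_if_pos_on_sphere[OF pos_sphere that] .
  define N where "N = n + D"
  define s where "s = real (N ^ CARD('d)) * real (n ^ CARD('d))"
  have s: "s > 0" using n(1) by (simp add: s_def N_def)
  let ?w = "\<lambda>t \<omega>. dirichlet n (\<omega> - node N t) / of_real (sqrt s)"
  have quad: "of_real s * A k l \<omega> = (\<Sum>t\<in>exp_box N. A' k l (node N t) * of_real ((norm (dirichlet n (\<omega> - node N t)))\<^sup>2))" for k l \<omega>
  proof -
    have "(\<Sum>t\<in>exp_box N. A' k l (node N t) * of_real ((norm (dirichlet n (\<omega> - node N t)))\<^sup>2))
       = (\<Sum>x\<in>K. c k l x * of_real (r x) * (\<Sum>t\<in>exp_box N. torus_char x (node N t) * of_real ((norm (dirichlet n (\<omega> - node N t)))\<^sup>2)))"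
      unfolding A'_def sum_distrib_left sum_distrib_right by (subst sum.swap) (simp only: mult.assoc)
    also have "\<dots> = (\<Sum>x\<in>K. of_real s * (c k l x * torus_char x \<omega>))"
    proof (intro sum.cong refl)
      fix x assume x: "x \<in> K"
      have rw: "(of_real (r x) :: complex) * of_nat (fejer_weight n x) = of_nat (n ^ CARD('d))"
        using n(2)[OF x] by (simp add: r_def)
      show "c k l x * of_real (r x) * (\<Sum>t\<in>exp_box N. torus_char x (node N t) * of_real ((norm (dirichlet n (\<omega> - node N t)))\<^sup>2))
        = of_real s * (c k l x * torus_char x \<omega>)"
        unfolding N_def fejer_quadrature[OF D[OF x]] s_def of_real_mult of_real_of_nat_eq rw[symmetric]
        by (simp only: mult_ac)
    qed
    finally show ?thesis by (simp add: A_eq sum_distrib_left)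
  qed
  have main: "herm_form (\<lambda>k l. A k l \<omega>) (\<lambda>k. v k \<omega>) = (\<Sum>t\<in>exp_box N. herm_form (\<lambda>k l. A' k l (node N t)) (\<lambda>k. ?w t \<omega> * v k \<omega>))" for \<omega>
  proof -
    have "s * herm_form (\<lambda>k l. A k l \<omega>) (\<lambda>k. v k \<omega>)
      = herm_form (\<lambda>k l. \<Sum>t\<in>exp_box N. of_real ((norm (dirichlet n (\<omega> - node N t)))\<^sup>2) * A' k l (node N t)) (\<lambda>k. v k \<omega>)"
      unfolding herm_form_scaled_matrix[symmetric] quad by (simp only: mult.commute)
    also have "\<dots> = (\<Sum>t\<in>exp_box N. (norm (dirichlet n (\<omega> - node N t)))\<^sup>2 * herm_form (\<lambda>k l. A' k l (node N t)) (\<lambda>k. v k \<omega>))"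
      unfolding herm_form_sum herm_form_scaled_matrix ..
    also have "\<dots> = s * (\<Sum>t\<in>exp_box N. herm_form (\<lambda>k l. A' k l (node N t)) (\<lambda>k. ?w t \<omega> * v k \<omega>))"
    proof -
      have "(norm (?w t \<omega>))\<^sup>2 = (norm (dirichlet n (\<omega> - node N t)))\<^sup>2 / s" for t
        using s by (simp add: norm_divide power_divide)
      then show ?thesis
        unfolding herm_form_scale sum_distrib_left using s by (intro sum.cong refl) simp
    qed
    finally show ?thesis using s by (simp only: mult_cancel_left) simp
  qed
  have "trig_poly (dirichlet n)" unfolding dirichlet_def[abs_def] by (intro trig_poly_sum trig_poly_char)
  then have "trig_poly (\<lambda>\<omega>. dirichlet n (\<omega> - y))" for y
    using trig_poly_translate[of "dirichlet n" "- y"] by simp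
  then have "trig_poly (?w t)" for t
    unfolding divide_inverse by (intro trig_poly_mult trig_poly_const)
  then show ?thesis
    unfolding main by (intro sos_sum sos_constant_form trig_poly_mult v pos') auto
qed


section \<open>Nonnegative trigonometric polynomials with nondegenerate zeros\<close>

text \<open>
  The matrix \<open>(norm v)^2 * I - v v*\<close>. It is half the sum of the rank one
  matrices given by the Koszul relations \<open>v k * v l - v l * v k = 0\<close> between the entries of \<open>v\<close>.
\<close>
definition koszul_matrix :: "('n::finite \<Rightarrow> complex) \<Rightarrow> 'n \<Rightarrow> 'n \<Rightarrow> complex" where
  "koszul_matrix v k l = (if k = l then (\<Sum>j\<in>UNIV. v j * cnj (v j)) else 0) - v k * cnj (v l)"

lemma herm_form_koszul:
  "2 * herm_form (koszul_matrix v) w = (\<Sum>k\<in>UNIV. \<Sum>l\<in>UNIV. (norm (v k * w l - v l * w k))\<^sup>2)"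
proof -
  define V where "V = (\<Sum>j\<in>UNIV. v j * cnj (v j))"
  define W where "W = (\<Sum>j\<in>UNIV. w j * cnj (w j))"
  define X where "X = (\<Sum>j\<in>UNIV. v j * cnj (w j))"
  have cX: "cnj X = (\<Sum>j\<in>UNIV. cnj (v j) * w j)" by (simp add: X_def)
  have form: "(\<Sum>k\<in>UNIV. \<Sum>l\<in>UNIV. cnj (w k) * koszul_matrix v k l * w l) = V * W - X * cnj X"
  proof -
    have "(\<Sum>k\<in>UNIV. \<Sum>l\<in>UNIV. cnj (w k) * koszul_matrix v k l * w l)
      = (\<Sum>k\<in>UNIV. \<Sum>l\<in>UNIV. (if l = k then V * (w k * cnj (w k)) else 0)) - (\<Sum>k\<in>UNIV. \<Sum>l\<in>UNIV. (v k * cnj (w k)) * (cnj (v l) * w l))"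
      unfolding sum_subtractf[symmetric] koszul_matrix_def V_def[symmetric]
      by (intro sum.cong refl) (auto simp: algebra_simps)
    also have "(\<Sum>k\<in>UNIV. \<Sum>l\<in>UNIV. (v k * cnj (w k)) * (cnj (v l) * w l)) = X * cnj X"
      unfolding cX by (simp only: X_def sum_product)
    finally show ?thesis by (simp add: W_def sum_distrib_left)
  qed
  have "of_real (\<Sum>k\<in>UNIV. \<Sum>l\<in>UNIV. (norm (v k * w l - v l * w k))\<^sup>2)
      = (\<Sum>k\<in>UNIV. \<Sum>l\<in>UNIV. (v k * cnj (v k)) * (w l * cnj (w l))) + (\<Sum>k\<in>UNIV. \<Sum>l\<in>UNIV. (w k * cnj (w k)) * (v l * cnj (v l)))
        - (\<Sum>k\<in>UNIV. \<Sum>l\<in>UNIV. (v k * cnj (w k)) * (cnj (v l) * w l)) - (\<Sum>k\<in>UNIV. \<Sum>l\<in>UNIV. (cnj (v k) * w k) * (v l * cnj (w l)))"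
    unfolding of_real_sum complex_norm_square sum.distrib[symmetric] sum_subtractf[symmetric]
    by (intro sum.cong refl) (simp add: algebra_simps)
  also have "\<dots> = V * W + W * V - X * cnj X - cnj X * X"
    unfolding cX by (simp only: V_def W_def X_def sum_product)
  also have "\<dots> = 2 * (V * W - X * cnj X)" by simp
  also have "V * W - X * cnj X = of_real (Re (V * W - X * cnj X))"
  proof -
    have "V \<in> \<real>" "W \<in> \<real>" "X * cnj X \<in> \<real>"
      unfolding V_def W_def by (auto intro!: sum_in_Reals simp flip: complex_norm_square)
    then have "V * W - X * cnj X \<in> \<real>" by (intro Reals_diff Reals_mult[of V W])
    then show ?thesis by (simp only: of_real_Re)
  qed
  finally have "complex_of_real (\<Sum>k\<in>UNIV. \<Sum>l\<in>UNIV. (norm (v k * w l - v l * w k))\<^sup>2) = of_real (2 * Re (V * W - X * cnj X))"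
    by (simp only: of_real_mult of_real_numeral)
  then show ?thesis unfolding of_real_eq_iff herm_form_def form by simp
qed

lemma herm_form_koszul_nonneg: "herm_form (koszul_matrix v) w \<ge> 0"
  using herm_form_koszul[of v w] by (smt (verit) sum_nonneg zero_le_power2)

lemma herm_form_koszul_self: "herm_form (koszul_matrix v) v = 0"
  using herm_form_koszul[of v v] by simp

lemma herm_form_koszul_zero:
  assumes "herm_form (koszul_matrix v) w = 0"
  shows "v k * w l = v l * w k"
proof -
  have "(\<Sum>k\<in>UNIV. \<Sum>l\<in>UNIV. (norm (v k * w l - v l * w k))\<^sup>2) = 0" using herm_form_koszul[of v w] assms by simp
  then have "(norm (v k * w l - v l * w k))\<^sup>2 = 0"
    by (simp add: sum_nonneg_eq_0_iff sum_nonneg)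
  then show ?thesis by simp
qed

lemma sum_option: "(\<Sum>k\<in>UNIV. g k) = g None + (\<Sum>i\<in>UNIV. g (Some i))" for g :: "'a::finite option \<Rightarrow> 'b::comm_monoid_add"
  by (simp add: UNIV_option_conv sum.reindex)

text \<open>
  For each point \<open>s\<close> of \<open>S\<close> the product \<open>e s\<close> is \<open>1\<close> at \<open>s\<close> and \<open>0\<close> at the other points; each
  factor uses one coordinate in which \<open>s\<close> differs from the other point.
\<close>
lemma interpolation_01:
  fixes S T :: "(complex ^ 'd::finite) set"
  assumes "finite S" "finite T" "S \<inter> T = {}"
  shows "\<exists>q. trig_poly q \<and> (\<forall>\<omega>. torus_exp \<omega> \<in> T \<longrightarrow> q \<omega> = 0) \<and> (\<forall>\<omega>. torus_exp \<omega> \<in> S \<longrightarrow> q \<omega> = 1)"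
proof -
  have "\<exists>i. s $ i \<noteq> t $ i" if "s \<noteq> t" for s t :: "complex ^ 'd" using that by (simp add: vec_eq_iff)
  then obtain i :: "complex ^ 'd \<Rightarrow> complex ^ 'd \<Rightarrow> 'd" where i: "\<And>s t. s \<noteq> t \<Longrightarrow> s $ i s t \<noteq> t $ i s t" by metis
  define e where "e s \<omega> = (\<Prod>t\<in>(S \<union> T) - {s}. (torus_exp \<omega> $ i s t - t $ i s t) * inverse (s $ i s t - t $ i s t))" for s \<omega>
  have e1: "e s \<omega> = 1" if "torus_exp \<omega> = s" for s \<omega>
  proof -
    have "s $ i s t - t $ i s t \<noteq> 0" if "t \<noteq> s" for t using i[of s t] that by auto
    then show ?thesis unfolding e_def that by (intro prod.neutral ballI) simp
  qed
  have e0: "e s \<omega> = 0" if "torus_exp \<omega> \<in> S \<union> T" "torus_exp \<omega> \<noteq> s" for s \<omega>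
    unfolding e_def using assms(1,2) that by (intro prod_zero) auto
  show ?thesis
  proof (rule exI[of _ "\<lambda>\<omega>. \<Sum>s\<in>S. e s \<omega>"], intro conjI allI impI)
    show "trig_poly (\<lambda>\<omega>. \<Sum>s\<in>S. e s \<omega>)"
      unfolding e_def by (intro trig_poly_sum trig_poly_prod trig_poly_mult trig_poly_diff trig_poly_exp trig_poly_const)
    show "(\<Sum>s\<in>S. e s \<omega>) = 0" if "torus_exp \<omega> \<in> T" for \<omega>
      using that assms(3) by (intro sum.neutral ballI e0) auto
    show "(\<Sum>s\<in>S. e s \<omega>) = 1" if "torus_exp \<omega> \<in> S" for \<omega>
    proof -
      have "(\<Sum>s\<in>S. e s \<omega>) = (\<Sum>s\<in>S. if s = torus_exp \<omega> then 1 else 0)"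
        using that by (intro sum.cong refl) (auto simp: e0 e1)
      then show ?thesis using that assms(1) by simp
    qed
  qed
qed

text \<open>
  At a zero apply the grid construction to the grid consisting of that single point: \<open>f\<close> is a form in the
  differences \<open>z i - \<xi> i\<close> whose matrix is positive definite at \<open>\<xi>\<close>, hence also nearby, so \<open>f\<close> is
  positive wherever some difference is nonzero. This takes the place of a Taylor expansion.
\<close>
lemma nondegenerate_zero_isolated:
  fixes f :: "real ^ 'd::finite \<Rightarrow> complex"
  assumes f: "trig_poly f" "\<And>\<omega>. f \<omega> \<in> \<real>\<^sub>\<ge>\<^sub>0"
    and hess: "\<And>\<omega>. f \<omega> = 0 \<Longrightarrow> positive_definite (hessian (\<lambda>\<omega>. Re (f \<omega>)) \<omega>)"
  shows "\<exists>U. open U \<and> \<omega>0 \<in> U \<and> (\<forall>\<omega>\<in>U. f \<omega> = 0 \<longrightarrow> torus_exp \<omega> = torus_exp \<omega>0)"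
proof (cases "f \<omega>0 = 0")
  case False
  have "open {\<omega>. f \<omega> \<noteq> 0}"
    by (intro open_Collect_neq trig_poly_continuous f continuous_on_const)
  then show ?thesis using False by (intro exI[of _ "{\<omega>. f \<omega> \<noteq> 0}"]) auto
next
  case True
  interpret torus_grid "\<lambda>i. {torus_exp \<omega>0 $ i}" by unfold_locales auto
  have grid: "on_grid \<omega> \<longleftrightarrow> torus_exp \<omega> = torus_exp \<omega>0" for \<omega> by (auto simp: on_grid_def vec_eq_iff)
  have real: "f \<omega> \<in> \<real>" for \<omega> using f(2) nonneg_Reals_subset_Reals by blast
  have f0: "f \<omega> = 0" if "on_grid \<omega>" for \<omega>
    using trig_poly_periodic[OF f(1), of \<omega> \<omega>0] that True by (simp add: grid)
  have f_grid: "\<forall>\<omega>. on_grid \<omega> \<longrightarrow> f \<omega> = 0" "\<forall>\<omega> j. on_grid \<omega> \<longrightarrow> pd j f \<omega> = 0"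
    using f0 pd_zero_at_minimum[OF f] by simp_all
  obtain A where "\<forall>i l. trig_poly (A i l)"
    and "\<forall>\<omega>. f \<omega> = (\<Sum>i\<in>UNIV. \<Sum>l\<in>UNIV. cnj (P i \<omega>) * A i l \<omega> * P l \<omega>)"
    and "\<forall>\<omega> w. on_grid \<omega> \<longrightarrow> positive_definite (hessian (\<lambda>\<omega>. Re (f \<omega>)) \<omega>) \<longrightarrow> (\<exists>i. w i \<noteq> 0) \<longrightarrow>
       Re (\<Sum>i\<in>UNIV. \<Sum>l\<in>UNIV. cnj (w i) * A i l \<omega> * w l) > 0"
    using hermitian_form_on_grid[OF f(1) real f_grid]
    by (elim exE conjE) (rule that)
  note A = this[rule_format]
  have pos0: "herm_form (\<lambda>k l. A k l \<omega>0) w > 0" if "\<exists>i. w i \<noteq> 0" for w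
    unfolding herm_form_def by (rule A(3)[OF _ hess[OF True] that]) (simp add: grid)
  obtain e where e: "e > 0" "\<And>w. norm w = 1 \<Longrightarrow> e \<le> herm_form (\<lambda>k l. A k l \<omega>0) (vec_nth w)"
    using herm_form_uniformly_positive[of "\<lambda>k l \<omega>. A k l \<omega>0", OF trig_poly_const pos0] by blast
  define D where "D \<omega> = (\<Sum>k\<in>UNIV. \<Sum>l\<in>UNIV. norm (A k l \<omega> - A k l \<omega>0))" for \<omega>
  show ?thesis
  proof (intro exI[of _ "{\<omega>. D \<omega> < e}"] conjI ballI impI)
    show "open {\<omega>. D \<omega> < e}"
      unfolding D_def by (intro open_Collect_less continuous_intros trig_poly_continuous A(1))
    show "\<omega>0 \<in> {\<omega>. D \<omega> < e}" using e(1) by (simp add: D_def)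
    fix \<omega> assume \<omega>: "\<omega> \<in> {\<omega>. D \<omega> < e}" and "f \<omega> = 0"
    have "herm_form (\<lambda>k l. A k l \<omega>) (vec_nth u) > 0" if u: "norm u = 1" for u
    proof -
      have "herm_form (\<lambda>k l. A k l \<omega>) (vec_nth u) \<ge> herm_form (\<lambda>k l. A k l \<omega>0) (vec_nth u) - D \<omega>"
        unfolding D_def by (intro herm_form_perturb u) auto
      then show ?thesis using e(2)[OF u] \<omega> by simp
    qed
    note pos\<omega> = herm_form_pos_if_pos_on_sphere[OF this, of "\<lambda>k. P k \<omega>"]
    have "P i \<omega> = 0" for i
    proof (rule ccontr)
      assume "P i \<omega> \<noteq> 0"
      then have "herm_form (\<lambda>k l. A k l \<omega>) (\<lambda>k. P k \<omega>) > 0" using pos\<omega> by blast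
      moreover have "herm_form (\<lambda>k l. A k l \<omega>) (\<lambda>k. P k \<omega>) = Re (f \<omega>)"
        unfolding herm_form_def A(2)[of \<omega>, symmetric] ..
      ultimately show False using \<open>f \<omega> = 0\<close> by simp
    qed
    then show "torus_exp \<omega> = torus_exp \<omega>0" by (simp add: grid_poly_eq_0_iff vec_eq_iff)
  qed
qed

lemma finite_nondegenerate_zeros:
  fixes f :: "real ^ 'd::finite \<Rightarrow> complex"
  assumes f: "trig_poly f" "\<And>\<omega>. f \<omega> \<in> \<real>\<^sub>\<ge>\<^sub>0"
    and hess: "\<And>\<omega>. f \<omega> = 0 \<Longrightarrow> positive_definite (hessian (\<lambda>\<omega>. Re (f \<omega>)) \<omega>)"
  shows "finite (torus_exp ` {\<omega>. f \<omega> = 0})"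
proof -
  let ?C = "cbox 0 (\<chi> i. 2 * pi) :: (real ^ 'd) set"
  have "\<forall>\<omega>0. \<exists>U. open U \<and> \<omega>0 \<in> U \<and> (\<forall>\<omega>\<in>U. f \<omega> = 0 \<longrightarrow> torus_exp \<omega> = torus_exp \<omega>0)"
    using nondegenerate_zero_isolated[OF assms] by blast
  from choice[OF this] obtain U where U: "\<And>\<omega>0. open (U \<omega>0)" "\<And>\<omega>0. \<omega>0 \<in> U \<omega>0"
    "\<And>\<omega>0 \<omega>. \<omega> \<in> U \<omega>0 \<Longrightarrow> f \<omega> = 0 \<Longrightarrow> torus_exp \<omega> = torus_exp \<omega>0" by blast
  have "compact ?C" by simp
  moreover have "\<And>\<omega>0. \<omega>0 \<in> ?C \<Longrightarrow> open (U \<omega>0)" "?C \<subseteq> (\<Union>\<omega>0\<in>?C. U \<omega>0)" using U by blast+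
  ultimately obtain D where D: "D \<subseteq> ?C" "finite D" "?C \<subseteq> (\<Union>\<omega>0\<in>D. U \<omega>0)" by (rule compactE_image)
  have "torus_exp ` {\<omega>. f \<omega> = 0} \<subseteq> torus_exp ` D"
  proof clarify
    fix \<omega> assume "f \<omega> = 0"
    obtain \<omega>' where \<omega>': "\<omega>' \<in> ?C" "torus_exp \<omega>' = torus_exp \<omega>" by (rule torus_exp_fundamental_cube)
    have "f \<omega>' = 0" using trig_poly_periodic[OF f(1) \<omega>'(2)] \<open>f \<omega> = 0\<close> by simp
    moreover obtain \<omega>0 where "\<omega>0 \<in> D" "\<omega>' \<in> U \<omega>0" using D(3) \<omega>'(1) by blast
    ultimately show "torus_exp \<omega> \<in> torus_exp ` D" using U(3) \<omega>'(2) by (metis imageI)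
  qed
  then show ?thesis by (rule finite_subset[OF _ finite_imageI[OF D(2)]])
qed

text \<open>
  The set \<open>Z i\<close> also contains \<open>1\<close>, so that the grid is nonempty even if \<open>f\<close> has no zeros. The
  entries of \<open>v\<close> and \<open>M\<close> are indexed by an option type: \<open>None\<close> stands for the correction \<open>q^2\<close> and
  \<open>Some i\<close> for \<open>P i\<close>.
\<close>
theorem sos_of_nondegenerate_zeros:
  fixes f :: "real ^ 'd::finite \<Rightarrow> complex"
  assumes f: "trig_poly f" "\<And>\<omega>. f \<omega> \<in> \<real>\<^sub>\<ge>\<^sub>0"
    and hess: "\<And>\<omega>. f \<omega> = 0 \<Longrightarrow> positive_definite (hessian (\<lambda>\<omega>. Re (f \<omega>)) \<omega>)"
  shows "sos (\<lambda>\<omega>. Re (f \<omega>))"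
proof -
  let ?Z0 = "torus_exp ` {\<omega>. f \<omega> = 0}"
  define Z where "Z i = insert 1 ((\<lambda>\<xi>. \<xi> $ i) ` ?Z0)" for i
  have finZ0: "finite ?Z0" by (rule finite_nondegenerate_zeros[OF assms])
  interpret torus_grid Z
    by unfold_locales (use finZ0 in \<open>auto simp: Z_def\<close>)
  have real: "f \<omega> \<in> \<real>" for \<omega> using f(2) nonneg_Reals_subset_Reals by blast
  have zero_on_grid: "on_grid \<omega>" if "f \<omega> = 0" for \<omega>
    using that by (auto simp: on_grid_def Z_def)
  note tp = trig_poly_add trig_poly_diff trig_poly_mult trig_poly_cnj trig_poly_const trig_poly_pd

  define S where "S = torus_exp ` {\<omega>. on_grid \<omega> \<and> f \<omega> \<noteq> 0}"
  have "S \<subseteq> vec_lambda ` (UNIV \<rightarrow>\<^sub>E (\<Union>i. Z i))"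
  proof
    fix \<xi> assume "\<xi> \<in> S"
    then have "vec_nth \<xi> \<in> UNIV \<rightarrow>\<^sub>E (\<Union>i. Z i)" by (auto simp: S_def on_grid_def)
    then show "\<xi> \<in> vec_lambda ` (UNIV \<rightarrow>\<^sub>E (\<Union>i. Z i))" by (metis image_eqI vec_nth_inverse)
  qed
  moreover have "finite (vec_lambda ` (UNIV \<rightarrow>\<^sub>E (\<Union>i. Z i)) :: (complex ^ 'd) set)"
    by (intro finite_imageI finite_PiE) auto
  ultimately have "finite S" by (rule finite_subset)
  moreover have "S \<inter> ?Z0 = {}"
  proof (rule ccontr)
    assume "S \<inter> ?Z0 \<noteq> {}"
    then obtain \<omega> \<omega>' where "f \<omega> \<noteq> 0" "f \<omega>' = 0" "torus_exp \<omega> = torus_exp \<omega>'" unfolding S_def by blast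
    then show False using trig_poly_periodic[OF f(1), of \<omega> \<omega>'] by simp
  qed
  ultimately have "\<exists>q. trig_poly q \<and> (\<forall>\<omega>. torus_exp \<omega> \<in> ?Z0 \<longrightarrow> q \<omega> = 0) \<and> (\<forall>\<omega>. torus_exp \<omega> \<in> S \<longrightarrow> q \<omega> = 1)"
    using finZ0 by (intro interpolation_01)
  then obtain q where "trig_poly q" "\<forall>\<omega>. torus_exp \<omega> \<in> ?Z0 \<longrightarrow> q \<omega> = 0" "\<forall>\<omega>. torus_exp \<omega> \<in> S \<longrightarrow> q \<omega> = 1"
    by (elim exE conjE) (rule that)
  note q = this[rule_format]
  have q0: "q \<omega> = 0" if "f \<omega> = 0" for \<omega> using q(2) that by blast
  have q1: "q \<omega> = 1" if "on_grid \<omega>" "f \<omega> \<noteq> 0" for \<omega> using q(3) that by (auto simp: S_def)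

  define a where "a \<omega> = q \<omega> * cnj (q \<omega>)" for \<omega>
  define E where "E \<omega> = a \<omega> * a \<omega>" for \<omega>
  define g where "g \<omega> = f \<omega> - E \<omega>" for \<omega>
  define h where "h \<omega> = (1 - E \<omega>) * (1 - E \<omega>)" for \<omega>
  define F where "F \<omega> = g \<omega> * h \<omega>" for \<omega>
  define A0 where "A0 \<omega> = f \<omega> * (2 - E \<omega>) + h \<omega>" for \<omega>
  have a: "trig_poly a" unfolding a_def[abs_def] by (intro tp q)
  have E: "trig_poly E" unfolding E_def[abs_def] by (intro tp a)
  have g: "trig_poly g" unfolding g_def[abs_def] by (intro tp f E)
  have h: "trig_poly h" unfolding h_def[abs_def] by (intro tp E)
  have F: "trig_poly F" unfolding F_def[abs_def] by (intro tp g h)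
  have A0: "trig_poly A0" unfolding A0_def[abs_def] by (intro tp f E h)
  \<comment> \<open>Polynomial identity: \<open>E * (2 - E) + (1 - E)^2 = 1\<close>.\<close>
  have split: "f \<omega> = E \<omega> * A0 \<omega> + F \<omega>" for \<omega>
    unfolding A0_def F_def g_def h_def by algebra
  have Ereal: "E \<omega> \<in> \<real>" for \<omega>
    unfolding E_def a_def by (auto simp flip: complex_norm_square)
  have Freal: "F \<omega> \<in> \<real>" for \<omega>
    unfolding F_def g_def h_def by (intro Reals_mult Reals_diff Reals_1 real Ereal)

  have fz: "pd j f \<omega> = 0" if "f \<omega> = 0" for \<omega> j using pd_zero_at_minimum[OF f that] .
  \<comment> \<open>At a zero of \<open>f\<close> the square \<open>a\<close> of \<open>norm q\<close> vanishes to second order, so \<open>E = a * a\<close> does not affect second derivatives.\<close>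
  have az: "a \<omega> = 0" "pd j a \<omega> = 0" if "f \<omega> = 0" for \<omega> j
    using q0[OF that] q(1) by (simp_all add: a_def[abs_def] pd_mult trig_poly_cnj pd_cnj)
  have Ez: "E \<omega> = 0" "pd j E \<omega> = 0" if "f \<omega> = 0" for \<omega> j
    using az[OF that] a by (simp_all add: E_def[abs_def] pd_mult)
  have Ezz: "pd i (pd j E) \<omega> = 0" if "f \<omega> = 0" for \<omega> i j
    unfolding E_def[abs_def] pd_pd_mult[OF a a] using az[OF that] by simp
  have hz: "h \<omega> = 1" if "f \<omega> = 0" for \<omega> using Ez(1)[OF that] by (simp add: h_def)
  have gz: "g \<omega> = 0" "pd j g \<omega> = 0" if "f \<omega> = 0" for \<omega> j
    using Ez(1,2)[OF that] fz[OF that] that f(1) E by (simp_all add: g_def[abs_def] pd_diff)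
  have E1: "E \<omega> = 1" if "on_grid \<omega>" "f \<omega> \<noteq> 0" for \<omega>
    using q1[OF that] by (simp add: E_def a_def)
  \<comment> \<open>At the other grid points the factor \<open>(1 - E)^2\<close> makes \<open>F\<close> vanish to second order.\<close>
  have h1: "h \<omega> = 0" "pd j h \<omega> = 0" if "on_grid \<omega>" "f \<omega> \<noteq> 0" for \<omega> j
    using E1[OF that] E by (simp_all add: h_def[abs_def] pd_mult trig_poly_diff pd_diff)
  have F0: "F \<omega> = 0" "pd j F \<omega> = 0" if "on_grid \<omega>" for \<omega> j
    using gz[of \<omega>] h1[OF that] g h by (cases "f \<omega> = 0"; simp add: F_def[abs_def] pd_mult)+
  have F_grid: "\<forall>\<omega>. on_grid \<omega> \<longrightarrow> F \<omega> = 0" "\<forall>\<omega> j. on_grid \<omega> \<longrightarrow> pd j F \<omega> = 0"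
    using F0 by simp_all
  have Fhess: "positive_definite (hessian (\<lambda>\<omega>. Re (F \<omega>)) \<omega>)" if \<omega>: "f \<omega> = 0" for \<omega>
  proof -
    have "pd i (pd j F) \<omega> = pd i (pd j f) \<omega>" for i j
    proof -
      have "pd i (pd j F) \<omega> = pd i (pd j g) \<omega>"
        using gz[OF \<omega>] hz[OF \<omega>] g h by (simp add: F_def[abs_def] pd_pd_mult)
      also have "\<dots> = pd i (pd j f) \<omega> - pd i (pd j E) \<omega>"
        using f(1) E by (simp add: g_def[abs_def] pd_diff trig_poly_pd)
      finally show ?thesis using Ezz[OF \<omega>] by simp
    qed
    then have "hessian (\<lambda>\<omega>. Re (F \<omega>)) \<omega> = hessian (\<lambda>\<omega>. Re (f \<omega>)) \<omega>"
      using F f(1) by (simp add: vec_eq_iff hessian_Re)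
    then show ?thesis using hess[OF \<omega>] by simp
  qed
  obtain A where "\<forall>i l. trig_poly (A i l)"
    and "\<forall>\<omega>. F \<omega> = (\<Sum>i\<in>UNIV. \<Sum>l\<in>UNIV. cnj (P i \<omega>) * A i l \<omega> * P l \<omega>)"
    and "\<forall>\<omega> w. on_grid \<omega> \<longrightarrow> positive_definite (hessian (\<lambda>\<omega>. Re (F \<omega>)) \<omega>) \<longrightarrow> (\<exists>i. w i \<noteq> 0) \<longrightarrow>
       Re (\<Sum>i\<in>UNIV. \<Sum>l\<in>UNIV. cnj (w i) * A i l \<omega> * w l) > 0"
    using hermitian_form_on_grid[OF F Freal F_grid]
    by (elim exE conjE) (rule that)
  note A = this[rule_format]

  define v where "v k \<omega> = (case k of None \<Rightarrow> q \<omega> * q \<omega> | Some i \<Rightarrow> P i \<omega>)" for k \<omega>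
  define M where "M k l \<omega> = (case (k, l) of (None, None) \<Rightarrow> A0 \<omega> | (Some i, Some j) \<Rightarrow> A i j \<omega> | _ \<Rightarrow> 0)" for k l \<omega>
  have v: "trig_poly (v k)" for k
    unfolding v_def[abs_def] by (cases k) (simp_all add: trig_poly_mult q trig_poly_grid_poly)
  have M: "trig_poly (M k l)" for k l
    unfolding M_def[abs_def] by (cases k; cases l) (simp_all add: A0 A)
  have formM: "herm_form (\<lambda>k l. M k l \<omega>) w = Re (cnj (w None) * A0 \<omega> * w None) +
      Re (\<Sum>i\<in>UNIV. \<Sum>l\<in>UNIV. cnj (w (Some i)) * A i l \<omega> * w (Some l))" for \<omega> w
    unfolding herm_form_def sum_option by (simp add: M_def)
  have formMv: "herm_form (\<lambda>k l. M k l \<omega>) (\<lambda>k. v k \<omega>) = Re (f \<omega>)" for \<omega>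
  proof -
    have eq: "cnj (q \<omega> * q \<omega>) * A0 \<omega> * (q \<omega> * q \<omega>) = E \<omega> * A0 \<omega>" unfolding E_def a_def by (simp add: mult_ac)
    show ?thesis unfolding formM v_def option.case A(2)[symmetric] eq by (simp only: split[of \<omega>] plus_complex.sel)
  qed
  define K where "K k l \<omega> = koszul_matrix (\<lambda>k. v k \<omega>) k l" for k l \<omega>
  have K: "trig_poly (K k l)" for k l
    unfolding K_def[abs_def] koszul_matrix_def by (cases "k = l") (auto intro!: tp trig_poly_sum v trig_poly_minus)

  \<comment> \<open>On the kernel of the Koszul matrix \<open>M\<close> is already positive: at points with \<open>v\<close> nonzero the kernel is spanned by \<open>v\<close>, where \<open>M\<close> takes the value \<open>f\<close>; otherwise the point is a zero of \<open>f\<close> and \<open>M\<close> is positive definite.\<close>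
  have pos: "herm_form (\<lambda>k l. M k l \<omega>) w > 0"
    if w: "\<exists>k. w k \<noteq> 0" and Kw: "herm_form (\<lambda>k l. K k l \<omega>) w = 0" for \<omega> w
  proof (cases "\<exists>k. v k \<omega> \<noteq> 0")
    case True
    then obtain k where k: "v k \<omega> \<noteq> 0" by blast
    define c where "c = w k / v k \<omega>"
    have "v k \<omega> * w l = v l \<omega> * w k" for l
      using herm_form_koszul_zero[of "\<lambda>k. v k \<omega>" w] Kw by (simp add: K_def)
    then have w_eq: "w = (\<lambda>l. c * v l \<omega>)" using k by (auto simp: c_def field_simps)
    have "f \<omega> \<noteq> 0"
    proof
      assume "f \<omega> = 0"
      then have "v l \<omega> = 0" for l
        using q0 P_on_grid[OF zero_on_grid] by (cases l) (auto simp: v_def)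
      with k show False by simp
    qed
    then have "Re (f \<omega>) > 0" using f(2)[of \<omega>]
      by (auto simp: complex_nonneg_Reals_iff complex_eq_iff less_le)
    moreover have "c \<noteq> 0" using w w_eq by auto
    ultimately show ?thesis unfolding w_eq herm_form_scale formMv by simp
  next
    case False
    then have v0: "v k \<omega> = 0" for k by blast
    have "P i \<omega> = 0" for i using v0[of "Some i"] by (simp add: v_def)
    then have grid: "on_grid \<omega>" by (simp add: on_grid_def grid_poly_eq_0_iff)
    have "q \<omega> = 0" using v0[of None] by (simp add: v_def)
    then have f0: "f \<omega> = 0" using q1[OF grid] by auto
    have "A0 \<omega> = 1" by (simp add: A0_def f0 hz)
    then have none: "Re (cnj (w None) * A0 \<omega> * w None) = (norm (w None))\<^sup>2"
      unfolding cmod_power2 by (simp add: power2_eq_square)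
    show ?thesis
    proof (cases "\<exists>i. w (Some i) \<noteq> 0")
      case True
      then show ?thesis unfolding formM none
        using A(3)[OF grid Fhess[OF f0], of "\<lambda>i. w (Some i)"] by (simp add: add_nonneg_pos)
    next
      case False
      then have "w None \<noteq> 0" using w by (metis option.exhaust)
      then show ?thesis unfolding formM none using False by simp
    qed
  qed

  let ?C = "cbox 0 (\<chi> i. 2 * pi) \<times> sphere 0 1 :: ((real ^ 'd) \<times> (complex ^ 'd option)) set"
  let ?a = "\<lambda>x :: (real ^ 'd) \<times> (complex ^ 'd option). herm_form (\<lambda>k l. M k l (fst x)) (\<lambda>k. snd x $ k)"
  let ?b = "\<lambda>x :: (real ^ 'd) \<times> (complex ^ 'd option). herm_form (\<lambda>k l. K k l (fst x)) (\<lambda>k. snd x $ k)"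
  have "compact ?C" by (intro compact_Times) auto
  moreover have "continuous_on ?C ?a"
    by (intro continuous_on_herm_form continuous_on_compose2[OF trig_poly_continuous[OF M, of UNIV]] continuous_intros) auto
  moreover have "continuous_on ?C ?b"
    by (intro continuous_on_herm_form continuous_on_compose2[OF trig_poly_continuous[OF K, of UNIV]] continuous_intros) auto
  moreover have "?b x \<ge> 0" for x unfolding K_def by (rule herm_form_koszul_nonneg)
  moreover have "?a x > 0" if "x \<in> ?C" "?b x = 0" for x
  proof (rule pos)
    have "snd x \<noteq> 0" using that(1) by auto
    then show "\<exists>k. snd x $ k \<noteq> 0" by (simp add: vec_eq_iff)
  qed (rule that(2))
  ultimately have "\<exists>c. \<forall>x\<in>?C. ?a x + c * ?b x > 0" by (intro compact_penalty)
  then obtain c where c: "\<And>x. x \<in> ?C \<Longrightarrow> ?a x + c * ?b x > 0" by (elim exE) (rule that, rule bspec)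
  define B where "B k l \<omega> = M k l \<omega> + of_real c * K k l \<omega>" for k l \<omega>
  have B: "trig_poly (B k l)" for k l unfolding B_def[abs_def] by (intro tp M K)
  have formB: "herm_form (\<lambda>k l. B k l \<omega>) w = herm_form (\<lambda>k l. M k l \<omega>) w + c * herm_form (\<lambda>k l. K k l \<omega>) w" for \<omega> w
    unfolding B_def herm_form_add herm_form_scaled_matrix ..
  have sphereB: "herm_form (\<lambda>k l. B k l \<omega>) (vec_nth u) > 0" if u: "norm u = 1" for \<omega> u
  proof -
    obtain \<omega>' where \<omega>': "\<omega>' \<in> cbox 0 (\<chi> i. 2 * pi)" "torus_exp \<omega>' = torus_exp \<omega>" by (rule torus_exp_fundamental_cube)
    have "B k l \<omega> = B k l \<omega>'" for k l by (intro trig_poly_periodic B) (simp add: \<omega>')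
    moreover have "herm_form (\<lambda>k l. B k l \<omega>') (vec_nth u) > 0"
      using c[of "(\<omega>', u)"] \<omega>' u by (simp add: formB)
    ultimately show ?thesis by simp
  qed
  have "sos (\<lambda>\<omega>. herm_form (\<lambda>k l. B k l \<omega>) (\<lambda>k. v k \<omega>))"
  proof (rule sos_positive_definite_form)
    show "herm_form (\<lambda>k l. B k l \<omega>) w > 0" if "\<exists>k. w k \<noteq> 0" for \<omega> w
      by (rule herm_form_pos_if_pos_on_sphere[OF sphereB that])
  qed (rule B, rule v)
  moreover have "herm_form (\<lambda>k l. K k l \<omega>) (\<lambda>k. v k \<omega>) = 0" for \<omega>
    unfolding K_def by (rule herm_form_koszul_self)
  ultimately show ?thesis by (simp add: formB formMv)
qed


section \<open>From sums of squares to the matrix identity\<close>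

lemma torus_exp_add: "torus_exp (a + b) $ i = torus_exp a $ i * torus_exp b $ i"
  by (simp add: torus_exp_def flip: exp_add) (simp add: algebra_simps)

lemma torus_exp_minus: "torus_exp (- a) $ i = inverse (torus_exp a $ i)"
  by (simp add: torus_exp_def flip: exp_minus)

lemma torus_exp_diff_eq_1: "torus_exp (a - b) = 1 \<longleftrightarrow> torus_exp a = torus_exp b"
proof -
  have "torus_exp (a - b) $ i = 1 \<longleftrightarrow> torus_exp a $ i = torus_exp b $ i" for i
    using torus_exp_add[of "a - b" b i] by auto
  then show ?thesis by (simp add: vec_eq_iff)
qed

text \<open>
  A finite subgroup of the torus, given by representatives \<open>\<rho> S\<close> of its elements in frequency space. The elements are distinct, and
  \<open>n\<close> is a multiple of the order of each of them. A nonempty finite set closed under addition is a group,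
  since translations are injective and hence surjective.
\<close>
locale torus_subgroup =
  fixes G :: "'s set" and \<rho> :: "'s \<Rightarrow> real ^ 'd::finite" and n :: nat
  assumes finite_G: "finite G" and G_nonempty: "G \<noteq> {}" and n_pos: "n > 0"
    and order: "S \<in> G \<Longrightarrow> (torus_exp (\<rho> S) $ i) ^ n = 1"
    and inj: "S \<in> G \<Longrightarrow> T \<in> G \<Longrightarrow> torus_exp (\<rho> S) = torus_exp (\<rho> T) \<Longrightarrow> S = T"
    and closed: "S \<in> G \<Longrightarrow> T \<in> G \<Longrightarrow> \<exists>U\<in>G. torus_exp (\<rho> U) = torus_exp (\<rho> S + \<rho> T)"
begin

lemma sum_translate:
  assumes \<phi>: "trig_poly \<phi>" and T: "T \<in> G"
  shows "(\<Sum>S\<in>G. \<phi> (\<omega> + \<rho> T + \<rho> S)) = (\<Sum>S\<in>G. \<phi> (\<omega> + \<rho> S))"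
proof -
  have "\<forall>S\<in>G. \<exists>U. U \<in> G \<and> torus_exp (\<rho> U) = torus_exp (\<rho> T + \<rho> S)" using closed[OF T] by blast
  from bchoice[OF this] obtain u where u: "\<And>S. S \<in> G \<Longrightarrow> u S \<in> G"
    "\<And>S. S \<in> G \<Longrightarrow> torus_exp (\<rho> (u S)) = torus_exp (\<rho> T + \<rho> S)" by blast
  have inj_u: "inj_on u G"
  proof (rule inj_onI)
    fix S S' assume S: "S \<in> G" "S' \<in> G" "u S = u S'"
    then have "torus_exp (\<rho> T + \<rho> S) = torus_exp (\<rho> T + \<rho> S')" using u(2) by metis
    then have "torus_exp (\<rho> S) = torus_exp (\<rho> S')" by (simp add: vec_eq_iff torus_exp_add)
    then show "S = S'" using S inj by blast
  qed
  have "u ` G = G" using u(1) by (intro endo_inj_surj finite_G inj_u) auto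
  then have "(\<Sum>S\<in>G. \<phi> (\<omega> + \<rho> S)) = (\<Sum>S\<in>G. \<phi> (\<omega> + \<rho> (u S)))"
    using sum.reindex[OF inj_u, of "\<lambda>S. \<phi> (\<omega> + \<rho> S)"] by simp
  also have "\<dots> = (\<Sum>S\<in>G. \<phi> (\<omega> + \<rho> T + \<rho> S))"
  proof (intro sum.cong refl trig_poly_periodic[OF \<phi>])
    fix S assume "S \<in> G"
    then show "torus_exp (\<omega> + \<rho> (u S)) = torus_exp (\<omega> + \<rho> T + \<rho> S)"
      using u(2)[of S] by (simp add: vec_eq_iff torus_exp_add mult.assoc)
  qed
  finally show ?thesis ..
qed

definition ortho_char :: "int ^ 'd \<Rightarrow> real ^ 'd \<Rightarrow> complex" where
  "ortho_char k \<omega> = of_real (1 / sqrt (real (n ^ CARD('d)))) * torus_char k \<omega>"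

lemma trig_poly_ortho_char: "trig_poly (ortho_char k)"
  unfolding ortho_char_def[abs_def] by (intro trig_poly_mult trig_poly_const trig_poly_char)

text \<open>
  Up to normalisation this is the character sum over the box at the point \<open>\<rho> T - \<rho> S\<close>.
\<close>
lemma ortho_char_orthonormal:
  assumes "S \<in> G" "T \<in> G"
  shows "(\<Sum>k\<in>exp_box n. cnj (ortho_char k (\<omega> + \<rho> S)) * ortho_char k (\<omega> + \<rho> T)) = (if S = T then 1 else 0)"
proof -
  let ?c = "1 / real (n ^ CARD('d))"
  have char: "cnj (torus_char k (\<omega> + \<rho> S)) * torus_char k (\<omega> + \<rho> T) = torus_char k (\<rho> T - \<rho> S)" for k
  proof -
    have "torus_char k (\<omega> + \<rho> T) = torus_char k (\<omega> + \<rho> S) * torus_char k (\<rho> T - \<rho> S)"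
      by (simp flip: torus_char_translate)
    moreover have "cnj (torus_char k (\<omega> + \<rho> S)) * torus_char k (\<omega> + \<rho> S) = 1"
      by (metis complex_norm_square mult.commute norm_torus_char of_real_1 one_power2)
    ultimately show ?thesis by (metis mult.assoc mult_1)
  qed
  have c: "of_real (1 / sqrt (real (n ^ CARD('d)))) * of_real (1 / sqrt (real (n ^ CARD('d)))) = (of_real ?c :: complex)"
    unfolding of_real_mult[symmetric] by (simp del: of_nat_power of_real_mult)
  have "cnj (ortho_char k (\<omega> + \<rho> S)) * ortho_char k (\<omega> + \<rho> T) = of_real ?c * torus_char k (\<rho> T - \<rho> S)" for k
    unfolding ortho_char_def complex_cnj_mult complex_cnj_complex_of_real c[symmetric] char[symmetric]
    by (simp only: mult_ac)
  then have "(\<Sum>k\<in>exp_box n. cnj (ortho_char k (\<omega> + \<rho> S)) * ortho_char k (\<omega> + \<rho> T)) = of_real ?c * (\<Sum>k\<in>exp_box n. torus_char k (\<rho> T - \<rho> S))"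
    by (simp only: sum_distrib_left)
  also have "(\<Sum>k\<in>exp_box n. torus_char k (\<rho> T - \<rho> S)) = (if torus_exp (\<rho> T - \<rho> S) = 1 then of_nat (n ^ CARD('d)) else 0)"
  proof (rule sum_exp_box_char)
    show "(torus_exp (\<rho> T - \<rho> S) $ i) ^ n = 1" for i
      using torus_exp_add[of "\<rho> T" "- \<rho> S" i] torus_exp_minus[of "\<rho> S" i] order assms
      by (simp add: power_mult_distrib power_inverse)
  qed
  also have "torus_exp (\<rho> T - \<rho> S) = 1 \<longleftrightarrow> S = T"
    using inj[OF assms] by (auto simp: torus_exp_diff_eq_1)
  finally show ?thesis using n_pos by (simp add: of_real_divide)
qed

text \<open>
  The coefficients of the function \<open>b\<close> on the subgroup with respect to the functions
  \<open>\<lambda>S. ortho_char k (\<omega> + \<rho> S)\<close>. There may be more characters than group elements, so these functions form a Parseval frame and the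
  coefficients need not be unique; inversion and the Parseval identity hold all the same.
\<close>
definition fourier :: "int ^ 'd \<Rightarrow> real ^ 'd \<Rightarrow> ('s \<Rightarrow> complex) \<Rightarrow> complex" where
  "fourier k \<omega> b = (\<Sum>S\<in>G. cnj (ortho_char k (\<omega> + \<rho> S)) * b S)"

lemma fourier_inversion:
  assumes "T \<in> G"
  shows "(\<Sum>k\<in>exp_box n. fourier k \<omega> b * ortho_char k (\<omega> + \<rho> T)) = b T"
proof -
  have "(\<Sum>k\<in>exp_box n. fourier k \<omega> b * ortho_char k (\<omega> + \<rho> T)) = (\<Sum>k\<in>exp_box n. \<Sum>S\<in>G. b S * (cnj (ortho_char k (\<omega> + \<rho> S)) * ortho_char k (\<omega> + \<rho> T)))"
    unfolding fourier_def sum_distrib_right by (intro sum.cong refl) (simp only: mult_ac)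
  also have "\<dots> = (\<Sum>S\<in>G. b S * (\<Sum>k\<in>exp_box n. cnj (ortho_char k (\<omega> + \<rho> S)) * ortho_char k (\<omega> + \<rho> T)))"
    by (subst sum.swap) (simp only: sum_distrib_left)
  also have "\<dots> = (\<Sum>S\<in>G. if S = T then b T else 0)"
    using assms by (intro sum.cong refl) (simp add: ortho_char_orthonormal)
  finally show ?thesis using assms finite_G by simp
qed

lemma fourier_parseval:
  "(\<Sum>k\<in>exp_box n. fourier k \<omega> b * cnj (fourier k \<omega> b)) = (\<Sum>S\<in>G. b S * cnj (b S))"
proof -
  have "(\<Sum>k\<in>exp_box n. fourier k \<omega> b * cnj (fourier k \<omega> b)) = (\<Sum>k\<in>exp_box n. \<Sum>S\<in>G. cnj (b S) * (fourier k \<omega> b * ortho_char k (\<omega> + \<rho> S)))"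
    unfolding fourier_def[of _ _ b, THEN arg_cong[of _ _ cnj]] cnj_sum sum_distrib_left
    by (intro sum.cong refl) (simp add: mult_ac)
  also have "\<dots> = (\<Sum>S\<in>G. cnj (b S) * (\<Sum>k\<in>exp_box n. fourier k \<omega> b * ortho_char k (\<omega> + \<rho> S)))"
    by (subst sum.swap) (simp only: sum_distrib_left)
  also have "\<dots> = (\<Sum>S\<in>G. b S * cnj (b S))"
    by (intro sum.cong refl, subst fourier_inversion) (simp_all add: mult.commute)
  finally show ?thesis .
qed

lemma fourier_invariant:
  assumes "trig_poly g" "T \<in> G"
  shows "fourier k (\<omega> + \<rho> T) (\<lambda>S. g (\<omega> + \<rho> T + \<rho> S)) = fourier k \<omega> (\<lambda>S. g (\<omega> + \<rho> S))"
  unfolding fourier_def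
  using sum_translate[of "\<lambda>\<omega>. cnj (ortho_char k \<omega>) * g \<omega>", OF _ assms(2)] assms(1)
  by (simp add: trig_poly_mult trig_poly_cnj trig_poly_ortho_char)

lemma trig_poly_fourier:
  assumes "trig_poly g" shows "trig_poly (\<lambda>\<omega>. fourier k \<omega> (\<lambda>S. g (\<omega> + \<rho> S)))"
  unfolding fourier_def by (intro trig_poly_sum trig_poly_mult trig_poly_cnj trig_poly_translate trig_poly_ortho_char assms)

text \<open>
  The Fourier coefficients of \<open>\<lambda>S. h (\<omega> + \<rho> S)\<close> are invariant functions of \<open>\<omega>\<close>, and by
  the Parseval identity their squares add up to the squares of the translates of \<open>h\<close>.
\<close>
lemma invariant_squares:
  assumes h: "trig_poly h"
  shows "\<exists>g :: int ^ 'd \<Rightarrow> real ^ 'd \<Rightarrow> complex. (\<forall>k. trig_poly (g k)) \<and> (\<forall>k \<omega>. \<forall>T\<in>G. g k (\<omega> + \<rho> T) = g k \<omega>) \<and>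
    (\<forall>\<omega>. (\<Sum>k\<in>exp_box n. cnj (g k \<omega>) * g k \<omega>) = (\<Sum>S\<in>G. of_real ((norm (h (\<omega> + \<rho> S)))\<^sup>2)) / of_nat (card G))"
proof -
  let ?s = "complex_of_real (1 / sqrt (real (card G)))"
  have card: "card G > 0" using finite_G G_nonempty by (simp add: card_gt_0_iff)
  show ?thesis
  proof (rule exI[of _ "\<lambda>k \<omega>. ?s * fourier k \<omega> (\<lambda>S. h (\<omega> + \<rho> S))"], intro conjI allI ballI)
    show "trig_poly (\<lambda>\<omega>. ?s * fourier k \<omega> (\<lambda>S. h (\<omega> + \<rho> S)))" for k
      by (intro trig_poly_mult trig_poly_const trig_poly_fourier h)
    show "?s * fourier k (\<omega> + \<rho> T) (\<lambda>S. h (\<omega> + \<rho> T + \<rho> S)) = ?s * fourier k \<omega> (\<lambda>S. h (\<omega> + \<rho> S))"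
      if "T \<in> G" for k \<omega> T by (simp only: fourier_invariant[OF h that])
    fix \<omega>
    let ?f = "\<lambda>k. fourier k \<omega> (\<lambda>S. h (\<omega> + \<rho> S))"
    have s: "cnj ?s * ?s = 1 / of_nat (card G)"
    proof -
      have "cnj ?s * ?s = of_real (1 / sqrt (real (card G)) * (1 / sqrt (real (card G))))"
        by (simp only: complex_cnj_complex_of_real of_real_mult)
      also have "1 / sqrt (real (card G)) * (1 / sqrt (real (card G))) = 1 / real (card G)" by simp
      finally show ?thesis by simp
    qed
    have "cnj (?s * ?f k) * (?s * ?f k) = (cnj ?s * ?s) * (?f k * cnj (?f k))" for k
      by (simp only: complex_cnj_mult mult_ac)
    then have "(\<Sum>k\<in>exp_box n. cnj (?s * ?f k) * (?s * ?f k)) = (cnj ?s * ?s) * (\<Sum>k\<in>exp_box n. ?f k * cnj (?f k))"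
      by (simp only: sum_distrib_left)
    then show "(\<Sum>k\<in>exp_box n. cnj (?s * ?f k) * (?s * ?f k)) = (\<Sum>S\<in>G. of_real ((norm (h (\<omega> + \<rho> S)))\<^sup>2)) / of_nat (card G)"
      unfolding s fourier_parseval by (simp only: complex_norm_square times_divide_eq_left mult_1)
  qed
qed

text \<open>
  The summands are \<open>a k - c k * p\<close> and \<open>g j k * p\<close> with invariant \<open>c k\<close> and \<open>g j k\<close>.
  Expanding the first family with the inversion formula and the Parseval identity gives
  \<open>\<delta> - cnj (p S) * p T * (1 + f)\<close>, and the second family adds \<open>f * cnj (p S) * p T\<close>.
\<close>
theorem sos_imp_matrix_sos:
  assumes p: "trig_poly p" and sos: "sos (\<lambda>\<omega>. 1 - (\<Sum>S\<in>G. (norm (p (\<omega> + \<rho> S)))\<^sup>2))"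
  shows "\<exists>(N::nat) q. (\<forall>j. trig_poly (q j)) \<and> (\<forall>S\<in>G. \<forall>T\<in>G. \<forall>\<omega>.
     (if S = T then 1 else 0) - cnj (p (\<omega> + \<rho> S)) * p (\<omega> + \<rho> T)
       = (\<Sum>j=1..N. cnj (q j (\<omega> + \<rho> S)) * q j (\<omega> + \<rho> T)))"
proof -
  define f where "f \<omega> = 1 - (\<Sum>S\<in>G. (norm (p (\<omega> + \<rho> S)))\<^sup>2)" for \<omega>
  have f_inv: "f (\<omega> + \<rho> T) = f \<omega>" if "T \<in> G" for \<omega> T
  proof -
    have "(\<Sum>S\<in>G. complex_of_real ((norm (p (\<omega> + \<rho> T + \<rho> S)))\<^sup>2)) = (\<Sum>S\<in>G. of_real ((norm (p (\<omega> + \<rho> S)))\<^sup>2))"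
      unfolding complex_norm_square
      by (rule sum_translate[OF _ that]) (intro trig_poly_mult trig_poly_cnj p)
    then show ?thesis unfolding f_def of_real_sum[symmetric] of_real_eq_iff by simp
  qed
  obtain m :: nat and h where "\<forall>j. trig_poly (h j)" "\<forall>\<omega>. f \<omega> = (\<Sum>j<m. (norm (h j \<omega>))\<^sup>2)"
    using sos_imp_sum_of_squares[OF sos, folded f_def] by (elim exE conjE) (rule that)
  note h = this[rule_format]
  have "\<forall>j. \<exists>g :: int ^ 'd \<Rightarrow> real ^ 'd \<Rightarrow> complex. (\<forall>k. trig_poly (g k)) \<and> (\<forall>k \<omega>. \<forall>T\<in>G. g k (\<omega> + \<rho> T) = g k \<omega>) \<and>
    (\<forall>\<omega>. (\<Sum>k\<in>exp_box n. cnj (g k \<omega>) * g k \<omega>) = (\<Sum>S\<in>G. of_real ((norm (h j (\<omega> + \<rho> S)))\<^sup>2)) / of_nat (card G))"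
    by (intro allI invariant_squares h(1))
  from choice[OF this] obtain g :: "nat \<Rightarrow> int ^ 'd \<Rightarrow> real ^ 'd \<Rightarrow> complex" where g_all:
    "\<forall>j. (\<forall>k. trig_poly (g j k)) \<and> (\<forall>k \<omega>. \<forall>T\<in>G. g j k (\<omega> + \<rho> T) = g j k \<omega>) \<and>
    (\<forall>\<omega>. (\<Sum>k\<in>exp_box n. cnj (g j k \<omega>) * g j k \<omega>) = (\<Sum>S\<in>G. of_real ((norm (h j (\<omega> + \<rho> S)))\<^sup>2)) / of_nat (card G))"
    by (rule exE)
  have g: "trig_poly (g j k)" "T \<in> G \<Longrightarrow> g j k (\<omega> + \<rho> T) = g j k \<omega>"
    "(\<Sum>k\<in>exp_box n. cnj (g j k \<omega>) * g j k \<omega>) = (\<Sum>S\<in>G. of_real ((norm (h j (\<omega> + \<rho> S)))\<^sup>2)) / of_nat (card G)"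
    for j k \<omega> T using g_all by simp_all
  have g_sum: "(\<Sum>j<m. \<Sum>k\<in>exp_box n. cnj (g j k \<omega>) * g j k \<omega>) = of_real (f \<omega>)" for \<omega>
  proof -
    have "(\<Sum>j<m. \<Sum>k\<in>exp_box n. cnj (g j k \<omega>) * g j k \<omega>) = of_real (\<Sum>j<m. \<Sum>S\<in>G. (norm (h j (\<omega> + \<rho> S)))\<^sup>2) / of_nat (card G)"
      unfolding g(3) by (simp only: of_real_sum sum_divide_distrib)
    also have "(\<Sum>j<m. \<Sum>S\<in>G. (norm (h j (\<omega> + \<rho> S)))\<^sup>2) = (\<Sum>S\<in>G. f (\<omega> + \<rho> S))"
      by (subst sum.swap) (simp only: h(2))
    also have "\<dots> = (\<Sum>S\<in>G. f \<omega>)" by (intro sum.cong refl f_inv)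
    also have "\<dots> = of_nat (card G) * f \<omega>" by simp
    finally show ?thesis using finite_G G_nonempty by simp
  qed
  \<comment> \<open>Conjugation turns the Fourier coefficient of \<open>p\<close> into \<open>\<Sum>S. ortho_char k (\<omega> + \<rho> S) * cnj (p (\<omega> + \<rho> S))\<close>.\<close>
  define c where "c k \<omega> = cnj (fourier k \<omega> (\<lambda>S. p (\<omega> + \<rho> S)))" for k \<omega>
  have c: "trig_poly (c k)" for k unfolding c_def[abs_def] by (intro trig_poly_cnj trig_poly_fourier p)
  have c_inv: "c k (\<omega> + \<rho> T) = c k \<omega>" if "T \<in> G" for k \<omega> T
    unfolding c_def fourier_invariant[OF p that] ..
  define Q where "Q x = (case x of Inl k \<Rightarrow> (\<lambda>\<omega>. ortho_char k \<omega> - c k \<omega> * p \<omega>) | Inr (j, k) \<Rightarrow> (\<lambda>\<omega>. g j k \<omega> * p \<omega>))"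
    for x :: "(int ^ 'd) + (nat \<times> (int ^ 'd))"
  have Q: "trig_poly (Q x)" for x
    unfolding Q_def by (auto split: sum.split intro!: trig_poly_diff trig_poly_mult trig_poly_ortho_char c p g(1))
  let ?I = "exp_box n <+> ({..<m} \<times> exp_box n) :: ((int ^ 'd) + (nat \<times> (int ^ 'd))) set"
  have finI: "finite ?I" by simp
  have main: "(if S = T then 1 else 0) - cnj (p (\<omega> + \<rho> S)) * p (\<omega> + \<rho> T) = (\<Sum>x\<in>?I. cnj (Q x (\<omega> + \<rho> S)) * Q x (\<omega> + \<rho> T))"
    if S: "S \<in> G" and T: "T \<in> G" for S T \<omega>
  proof -
    let ?pS = "p (\<omega> + \<rho> S)" and ?pT = "p (\<omega> + \<rho> T)"
    have inv1: "(\<Sum>k\<in>exp_box n. cnj (c k \<omega>) * ortho_char k (\<omega> + \<rho> U)) = p (\<omega> + \<rho> U)" if "U \<in> G" for U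
      using fourier_inversion[OF that, of \<omega> "\<lambda>S. p (\<omega> + \<rho> S)"] by (simp add: c_def)
    then have inv2: "(\<Sum>k\<in>exp_box n. cnj (ortho_char k (\<omega> + \<rho> S)) * c k \<omega>) = cnj ?pS"
      using arg_cong[OF inv1[OF S], of cnj] by (simp add: mult.commute)
    have inv3: "(\<Sum>k\<in>exp_box n. cnj (c k \<omega>) * c k \<omega>) = 1 - of_real (f \<omega>)"
      using fourier_parseval[of \<omega> "\<lambda>S. p (\<omega> + \<rho> S)"]
      by (simp add: c_def f_def complex_norm_square del: of_real_power)
    have "(\<Sum>x\<in>?I. cnj (Q x (\<omega> + \<rho> S)) * Q x (\<omega> + \<rho> T))
      = (\<Sum>k\<in>exp_box n. cnj (ortho_char k (\<omega> + \<rho> S) - c k \<omega> * ?pS) * (ortho_char k (\<omega> + \<rho> T) - c k \<omega> * ?pT))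
       + (\<Sum>(j, k)\<in>{..<m} \<times> exp_box n. cnj (g j k \<omega> * ?pS) * (g j k \<omega> * ?pT))"
      by (subst sum.Plus) (auto simp: Q_def c_inv g(2) S T case_prod_unfold intro!: sum.cong)
    also have "(\<Sum>(j, k)\<in>{..<m} \<times> exp_box n. cnj (g j k \<omega> * ?pS) * (g j k \<omega> * ?pT)) = cnj ?pS * ?pT * of_real (f \<omega>)"
      unfolding g_sum[symmetric] sum.cartesian_product[symmetric] sum_distrib_left
      by (intro sum.cong refl) (simp add: mult_ac)
    also have "(\<Sum>k\<in>exp_box n. cnj (ortho_char k (\<omega> + \<rho> S) - c k \<omega> * ?pS) * (ortho_char k (\<omega> + \<rho> T) - c k \<omega> * ?pT))
      = (\<Sum>k\<in>exp_box n. cnj (ortho_char k (\<omega> + \<rho> S)) * ortho_char k (\<omega> + \<rho> T)) - ?pT * (\<Sum>k\<in>exp_box n. cnj (ortho_char k (\<omega> + \<rho> S)) * c k \<omega>)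
        - cnj ?pS * (\<Sum>k\<in>exp_box n. cnj (c k \<omega>) * ortho_char k (\<omega> + \<rho> T)) + cnj ?pS * ?pT * (\<Sum>k\<in>exp_box n. cnj (c k \<omega>) * c k \<omega>)"
      unfolding sum_distrib_left sum_subtractf[symmetric] sum.distrib[symmetric]
      by (intro sum.cong refl) (simp add: algebra_simps)
    finally show ?thesis unfolding inv1[OF T] inv2 inv3 ortho_char_orthonormal[OF S T] by (simp add: algebra_simps)
  qed
  obtain b where b: "bij_betw b {1..card ?I} ?I"
    using ex_bij_betw_nat_finite_1[OF finI] by blast
  have "(if S = T then 1 else 0) - cnj (p (\<omega> + \<rho> S)) * p (\<omega> + \<rho> T) = (\<Sum>j=1..card ?I. cnj (Q (b j) (\<omega> + \<rho> S)) * Q (b j) (\<omega> + \<rho> T))"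
    if "S \<in> G" "T \<in> G" for S T \<omega>
    unfolding main[OF that] by (rule sum.reindex_bij_betw[OF b, symmetric])
  then show ?thesis using Q by (intro exI[of _ "card ?I"] exI[of _ "\<lambda>j. Q (b j)"] conjI allI ballI)
qed

end


section \<open>The dual group of an expansive matrix\<close>

lemma expansive_det_nonzero:
  fixes M :: "int ^ 'd ^ 'd"
  assumes "expansive M"
  shows "det (map_matrix real_of_int M) \<noteq> 0"
proof
  assume "det (map_matrix real_of_int M) = 0"
  then have "\<not> (\<exists>B. B ** map_matrix real_of_int M = mat 1)"
    by (simp only: invertible_left_inverse[symmetric] invertible_det_nz)
  then obtain x where x: "x \<noteq> 0" "map_matrix real_of_int M *v x = 0"
    unfolding matrix_left_invertible_ker by blast
  define v :: "complex ^ 'd" where "v = (\<chi> i. of_real (x $ i))"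
  have "v \<noteq> 0" using x(1) by (auto simp: v_def vec_eq_iff)
  moreover have "map_matrix of_int M *v v = 0 *s v"
  proof -
    have "(\<Sum>j\<in>UNIV. of_int (M $ i $ j) * complex_of_real (x $ j)) = of_real ((map_matrix real_of_int M *v x) $ i)" for i
      by (simp add: matrix_vector_mult_def)
    then have "(\<Sum>j\<in>UNIV. of_int (M $ i $ j) * complex_of_real (x $ j)) = 0" for i
      unfolding x(2) by simp
    then show ?thesis by (simp add: vec_eq_iff matrix_vector_mult_def v_def)
  qed
  ultimately have "norm (0::complex) > 1" using assms unfolding expansive_def by blast
  then show False by simp
qed

lemma det_in_Ints:
  fixes A :: "'a::comm_ring_1 ^ 'n ^ 'n"
  assumes "\<And>i j. A $ i $ j \<in> \<int>"
  shows "det A \<in> \<int>"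
  unfolding det_def by (intro Ints_sum Ints_mult Ints_prod assms) auto

text \<open>
  By Cramer's rule the inverse of an integer matrix is integral after multiplication by the
  determinant.
\<close>
lemma dual_lattice_scaled:
  fixes M :: "int ^ 'd ^ 'd"
  assumes "det (map_matrix real_of_int M) \<noteq> 0" and \<sigma>: "\<sigma> \<in> dual_lattice M"
  shows "det (map_matrix real_of_int M) * (\<sigma> $ i / (2 * pi)) \<in> \<int>"
proof -
  let ?A = "transpose (map_matrix real_of_int M)"
  have det: "det ?A \<noteq> 0" using assms(1) by simp
  obtain x where x: "\<sigma> = (2 * pi) *\<^sub>R (matrix_inv ?A *v x)" "\<And>i. x $ i \<in> \<int>"
    using \<sigma> unfolding dual_lattice_def by blast
  define y where "y = matrix_inv ?A *v x"
  have "\<exists>B. ?A ** B = mat 1 \<and> B ** ?A = mat 1"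
    using det by (simp only: invertible_det_nz[symmetric] invertible_def)
  from someI_ex[OF this] have "?A ** matrix_inv ?A = mat 1"
    unfolding matrix_inv_def by (rule conjunct1)
  then have "?A *v y = x" by (simp add: y_def matrix_vector_mul_assoc)
  then have y_eq: "y = (\<chi> k. det (\<chi> i j. if j = k then x $ i else ?A $ i $ j) / det ?A)"
    by (simp only: cramer[OF det])
  have "y $ i = det (\<chi> i' j. if j = i then x $ i' else ?A $ i' $ j) / det ?A"
    by (subst y_eq) (rule vec_lambda_beta)
  then have "det ?A * y $ i = det (\<chi> i' j. if j = i then x $ i' else ?A $ i' $ j)"
    using det by (simp only: eq_divide_eq not_False_eq_True if_True mult.commute)
  moreover have "det (\<chi> i' j. if j = i then x $ i' else ?A $ i' $ j) \<in> \<int>"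
    by (rule det_in_Ints) (auto simp: x(2) transpose_def)
  moreover have "\<sigma> $ i / (2 * pi) = y $ i" by (simp add: x(1) y_def)
  ultimately show ?thesis by simp
qed

lemma torus_exp_power_eq_1:
  assumes "real n * (\<sigma> $ i / (2 * pi)) \<in> \<int>"
  shows "(torus_exp \<sigma> $ i) ^ n = 1"
proof -
  have "torus_exp \<sigma> $ i = cis (- (\<sigma> $ i))" by (simp add: torus_exp_def cis_conv_exp)
  then have "(torus_exp \<sigma> $ i) ^ n = cis (2 * pi * (- (real n * (\<sigma> $ i / (2 * pi)))))"
    by (simp add: Complex.DeMoivre)
  also have "\<dots> = 1" using assms by (intro cis_multiple_2pi Ints_minus)
  finally show ?thesis .
qed

lemma torus_exp_eq_iff: "torus_exp \<sigma> = torus_exp \<tau> \<longleftrightarrow> \<sigma> - \<tau> \<in> period_lattice"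
proof -
  have "torus_exp \<sigma> $ i = torus_exp \<tau> $ i \<longleftrightarrow> (\<sigma> $ i - \<tau> $ i) / (2 * pi) \<in> \<int>" for i
  proof -
    have "torus_exp \<sigma> $ i = torus_exp \<tau> $ i \<longleftrightarrow> (\<exists>n::int. - \<sigma> $ i = - \<tau> $ i + of_int (2 * n) * pi)"
      unfolding torus_exp_def vec_lambda_beta exp_eq by (simp add: complex_eq_iff)
    also have "\<dots> \<longleftrightarrow> (\<exists>n::int. (\<sigma> $ i - \<tau> $ i) / (2 * pi) = of_int n)"
    proof
      assume "\<exists>n::int. - \<sigma> $ i = - \<tau> $ i + of_int (2 * n) * pi"
      then obtain n :: int where "- \<sigma> $ i = - \<tau> $ i + of_int (2 * n) * pi" ..
      then have "(\<sigma> $ i - \<tau> $ i) / (2 * pi) = of_int (- n)" by (simp add: field_simps)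
      then show "\<exists>n::int. (\<sigma> $ i - \<tau> $ i) / (2 * pi) = of_int n" ..
    next
      assume "\<exists>n::int. (\<sigma> $ i - \<tau> $ i) / (2 * pi) = of_int n"
      then obtain n :: int where "(\<sigma> $ i - \<tau> $ i) / (2 * pi) = of_int n" ..
      then have "- \<sigma> $ i = - \<tau> $ i + of_int (2 * - n) * pi" by (simp add: field_simps)
      then show "\<exists>n::int. - \<sigma> $ i = - \<tau> $ i + of_int (2 * n) * pi" ..
    qed
    also have "\<dots> \<longleftrightarrow> (\<sigma> $ i - \<tau> $ i) / (2 * pi) \<in> \<int>" by (auto elim: Ints_cases)
    finally show ?thesis .
  qed
  then have "torus_exp \<sigma> = torus_exp \<tau> \<longleftrightarrow> (\<forall>i. (\<sigma> $ i - \<tau> $ i) / (2 * pi) \<in> \<int>)"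
    by (simp add: vec_eq_iff)
  also have "\<dots> \<longleftrightarrow> \<sigma> - \<tau> \<in> period_lattice"
  proof
    assume *: "\<forall>i. (\<sigma> $ i - \<tau> $ i) / (2 * pi) \<in> \<int>"
    have "\<sigma> - \<tau> = (2 * pi) *\<^sub>R (\<chi> i. (\<sigma> $ i - \<tau> $ i) / (2 * pi))" by (simp add: vec_eq_iff)
    with * show "\<sigma> - \<tau> \<in> period_lattice" unfolding period_lattice_def by (auto intro!: exI)
  next
    assume "\<sigma> - \<tau> \<in> period_lattice"
    then obtain x where x: "\<sigma> - \<tau> = (2 * pi) *\<^sub>R x" "\<forall>i. x $ i \<in> \<int>" unfolding period_lattice_def by blast
    have "(\<sigma> $ i - \<tau> $ i) / (2 * pi) = x $ i" for i
      using arg_cong[OF x(1), of "\<lambda>v. v $ i"] by simp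
    with x(2) show "\<forall>i. (\<sigma> $ i - \<tau> $ i) / (2 * pi) \<in> \<int>" by simp
  qed
  finally show ?thesis .
qed

abbreviation period_rel :: "((real ^ 'd) \<times> (real ^ 'd)) set" where
  "period_rel \<equiv> {(x, y). x - y \<in> period_lattice}"

lemma coset_eq_iff: "period_rel `` {\<sigma>} = period_rel `` {\<tau>} \<longleftrightarrow> torus_exp \<sigma> = torus_exp \<tau>"
  unfolding torus_exp_eq_iff[symmetric] by (auto simp: set_eq_iff)

definition coset_rep :: "int ^ 'd ^ 'd \<Rightarrow> (real ^ 'd) set \<Rightarrow> real ^ 'd" where
  "coset_rep M S = (SOME \<sigma>. \<sigma> \<in> dual_lattice M \<and> S = period_rel `` {\<sigma>})"

lemma coset_rep:
  assumes "S \<in> dual_group M"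
  shows "coset_rep M S \<in> dual_lattice M" "S = period_rel `` {coset_rep M S}"
proof -
  have "\<exists>\<sigma>. \<sigma> \<in> dual_lattice M \<and> S = period_rel `` {\<sigma>}"
    using assms unfolding dual_group_def by (auto elim!: quotientE)
  from someI_ex[OF this] show "coset_rep M S \<in> dual_lattice M" "S = period_rel `` {coset_rep M S}"
    unfolding coset_rep_def by blast+
qed

lemma dual_lattice_add:
  assumes "\<sigma> \<in> dual_lattice M" "\<tau> \<in> dual_lattice M"
  shows "\<sigma> + \<tau> \<in> dual_lattice M"
proof -
  let ?B = "matrix_inv (transpose (map_matrix real_of_int M))"
  obtain x y where "\<sigma> = (2 * pi) *\<^sub>R (?B *v x)" "\<forall>i. x $ i \<in> \<int>" "\<tau> = (2 * pi) *\<^sub>R (?B *v y)" "\<forall>i. y $ i \<in> \<int>"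
    using assms unfolding dual_lattice_def by blast
  then have "\<sigma> + \<tau> = (2 * pi) *\<^sub>R (?B *v (x + y)) \<and> (\<forall>i. (x + y) $ i \<in> \<int>)"
    by (simp add: matrix_vector_right_distrib scaleR_add_right)
  then show ?thesis unfolding dual_lattice_def by blast
qed

lemma zero_in_dual_lattice: "0 \<in> dual_lattice M"
  unfolding dual_lattice_def by (auto intro!: exI[of _ 0] simp: matrix_vector_mult_0_right)

text \<open>
  The absolute value of the determinant annihilates the dual lattice modulo periods. Finiteness of the
  group follows because the coordinates of its elements are roots of unity of that order.
\<close>
lemma torus_subgroup_dual_group:
  fixes M :: "int ^ 'd ^ 'd"
  assumes "expansive M"
  obtains n where "torus_subgroup (dual_group M) (coset_rep M) n"
proof -
  let ?d = "det (map_matrix real_of_int M)"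
  have "?d \<in> \<int>" by (rule det_in_Ints) simp
  then obtain z where z: "?d = of_int z" by (auto elim: Ints_cases)
  define n where "n = nat \<bar>z\<bar>"
  have "z \<noteq> 0" using expansive_det_nonzero[OF assms] z by auto
  then have n: "n > 0" by (simp add: n_def)
  have rep_inj: "S = T" if "S \<in> dual_group M" "T \<in> dual_group M" "torus_exp (coset_rep M S) = torus_exp (coset_rep M T)" for S T
  proof -
    have "S = period_rel `` {coset_rep M S}" by (rule coset_rep(2)[OF that(1)])
    also have "\<dots> = period_rel `` {coset_rep M T}" unfolding coset_eq_iff by (rule that(3))
    also have "\<dots> = T" by (rule coset_rep(2)[OF that(2), symmetric])
    finally show ?thesis .
  qed
  have order: "(torus_exp (coset_rep M S) $ i) ^ n = 1" if "S \<in> dual_group M" for S i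
  proof (rule torus_exp_power_eq_1)
    let ?y = "coset_rep M S $ i / (2 * pi)"
    have "of_int z * ?y \<in> \<int>"
      using dual_lattice_scaled[OF expansive_det_nonzero[OF assms] coset_rep(1)[OF that], of i] z by simp
    moreover have "real n * ?y = of_int z * ?y \<or> real n * ?y = - (of_int z * ?y)"
      by (cases "z \<ge> 0") (simp_all add: n_def)
    ultimately show "real n * ?y \<in> \<int>" by (metis Ints_minus)
  qed
  have "finite {x::complex. x ^ n = 1}" using n by (intro finite_roots_unity) simp
  then have "finite (vec_lambda ` (UNIV \<rightarrow>\<^sub>E {x::complex. x ^ n = 1}) :: (complex ^ 'd) set)"
    by (intro finite_imageI finite_PiE) auto
  moreover have "(torus_exp \<circ> coset_rep M) ` dual_group M \<subseteq> vec_lambda ` (UNIV \<rightarrow>\<^sub>E {x::complex. x ^ n = 1})"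
  proof
    fix \<xi> assume "\<xi> \<in> (torus_exp \<circ> coset_rep M) ` dual_group M"
    then have "vec_nth \<xi> \<in> UNIV \<rightarrow>\<^sub>E {x::complex. x ^ n = 1}" using order by auto
    then show "\<xi> \<in> vec_lambda ` (UNIV \<rightarrow>\<^sub>E {x::complex. x ^ n = 1})" by (metis image_eqI vec_nth_inverse)
  qed
  ultimately have "finite ((torus_exp \<circ> coset_rep M) ` dual_group M)" by (rule finite_subset[rotated])
  then have fin: "finite (dual_group M)"
    by (rule finite_imageD) (rule inj_onI, rule rep_inj, simp_all)
  have cosetI: "period_rel `` {\<sigma>} \<in> dual_group M" if "\<sigma> \<in> dual_lattice M" for \<sigma>
    using that unfolding dual_group_def by (rule quotientI)
  have "torus_subgroup (dual_group M) (coset_rep M) n"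
  proof
    show "dual_group M \<noteq> {}" using cosetI[OF zero_in_dual_lattice] by blast
    fix S T assume S: "S \<in> dual_group M" and T: "T \<in> dual_group M"
    let ?U = "period_rel `` {coset_rep M S + coset_rep M T}"
    have U: "?U \<in> dual_group M" by (intro cosetI dual_lattice_add coset_rep(1) S T)
    have "torus_exp (coset_rep M ?U) = torus_exp (coset_rep M S + coset_rep M T)"
      using coset_rep(2)[OF U] unfolding coset_eq_iff by (rule sym)
    with U show "\<exists>U\<in>dual_group M. torus_exp (coset_rep M U) = torus_exp (coset_rep M S + coset_rep M T)" by blast
  qed (use fin n order rep_inj in auto)
  then show ?thesis by (rule that)
qed

lemma on_torus_shift_coset:
  assumes "S \<in> dual_group M"
  shows "on_torus (laurent_shift_coset p S) \<omega> = on_torus p (\<omega> + coset_rep M S)"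
proof -
  have "laurent_shift_coset p S = laurent_shift p (coset_rep M S)"
    by (rule trans[OF arg_cong[OF coset_rep(2)[OF assms], of "laurent_shift_coset p"] laurent_shift_coset_eq])
  then show ?thesis by (simp only: on_torus_shift)
qed

theorem theorem4p5:
  fixes M :: "int ^ 'd ^ 'd" and p f :: "'d laurent"
  assumes "expansive M"
    and "laurent_eval p 1 = 1"
    and "f = 1 - (\<Sum>\<sigma>\<in>dual_group M.
                    laurent_star (laurent_shift_coset p \<sigma>) * laurent_shift_coset p \<sigma>)"
    and "\<forall>z\<in>torus. laurent_eval f z \<in> \<real>\<^sub>\<ge>\<^sub>0"
    and "\<forall>\<omega>. laurent_eval f (torus_exp \<omega>) = 0 \<longrightarrow>
           positive_definite (hessian (\<lambda>\<omega>'. Re (laurent_eval f (torus_exp \<omega>'))) \<omega>)"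
  shows "\<exists>(N::nat) (q :: nat \<Rightarrow> 'd laurent). \<forall>\<sigma>\<in>dual_group M. \<forall>\<tau>\<in>dual_group M.
           (if \<sigma> = \<tau> then 1 else 0) - laurent_star (laurent_shift_coset p \<sigma>) * laurent_shift_coset p \<tau>
             = (\<Sum>j=1..N. laurent_star (laurent_shift_coset (q j) \<sigma>) * laurent_shift_coset (q j) \<tau>)"
proof -
  obtain n where "torus_subgroup (dual_group M) (coset_rep M) n"
    using torus_subgroup_dual_group[OF assms(1)] .
  then interpret torus_subgroup "dual_group M" "coset_rep M" n .
  have f_eq: "on_torus f \<omega> = of_real (1 - (\<Sum>S\<in>dual_group M. (norm (on_torus p (\<omega> + coset_rep M S)))\<^sup>2))" for \<omega>
    unfolding assms(3)
    by (simp add: on_torus_minus on_torus_sum on_torus_mult on_torus_star on_torus_shift_coset complex_norm_square mult.commute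
        del: of_real_power)
  have "sos (\<lambda>\<omega>. Re (on_torus f \<omega>))"
  proof (rule sos_of_nondegenerate_zeros)
    show "on_torus f \<omega> \<in> \<real>\<^sub>\<ge>\<^sub>0" for \<omega> using assms(4) by (simp add: on_torus_def)
    show "positive_definite (hessian (\<lambda>\<omega>. Re (on_torus f \<omega>)) \<omega>)" if "on_torus f \<omega> = 0" for \<omega>
      using assms(5) that by (simp add: on_torus_def)
  qed simp
  then have "sos (\<lambda>\<omega>. 1 - (\<Sum>S\<in>dual_group M. (norm (on_torus p (\<omega> + coset_rep M S)))\<^sup>2))"
    unfolding f_eq by (simp only: Re_complex_of_real)
  from sos_imp_matrix_sos[OF trig_poly_on_torus this] obtain N :: nat and q where
    "\<forall>j. trig_poly (q j)" and
    "\<forall>S\<in>dual_group M. \<forall>T\<in>dual_group M. \<forall>\<omega>. (if S = T then 1 else 0) - cnj (on_torus p (\<omega> + coset_rep M S)) * on_torus p (\<omega> + coset_rep M T)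
       = (\<Sum>j=1..N. cnj (q j (\<omega> + coset_rep M S)) * q j (\<omega> + coset_rep M T))"
    by (elim exE conjE) (rule that)
  note q = this[rule_format]
  have "\<forall>j. \<exists>r. q j = on_torus r" using q(1) by (auto simp: trig_poly_def)
  from choice[OF this] obtain r where r: "\<And>j. q j = on_torus (r j)" by blast
  show ?thesis
  proof (intro exI[of _ N] exI[of _ r] ballI on_torus_inject)
    fix S T and \<omega> :: "real ^ 'd" assume S: "S \<in> dual_group M" and T: "T \<in> dual_group M"
    have "on_torus (if S = T then 1 else 0) \<omega> = (if S = T then 1 else 0)" by simp
    moreover have "(if S = T then 1 else 0) - cnj (on_torus p (\<omega> + coset_rep M S)) * on_torus p (\<omega> + coset_rep M T)
       = (\<Sum>j=1..N. cnj (on_torus (r j) (\<omega> + coset_rep M S)) * on_torus (r j) (\<omega> + coset_rep M T))"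
      using q(2)[OF S T, of \<omega>] unfolding r .
    ultimately show "on_torus ((if S = T then 1 else 0) - laurent_star (laurent_shift_coset p S) * laurent_shift_coset p T) \<omega>
      = on_torus (\<Sum>j=1..N. laurent_star (laurent_shift_coset (r j) S) * laurent_shift_coset (r j) T) \<omega>"
      by (simp only: on_torus_minus on_torus_sum on_torus_mult on_torus_star on_torus_shift_coset[OF S] on_torus_shift_coset[OF T])
  qed
qed

end
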